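(* Let $d\in\{1,2,3\}$ and let $\mathbb{T}^d$ be the $d$-dimensional torus. Consider the stochastic Schr\"odinger equation $\mathrm{i}\,\mathrm{d}u=\Delta u\,\mathrm{d}t+V(x)u\,\mathrm{d}t+\mathrm{d}W$ on $\mathbb{T}^d\times(0,\infty)$, $u(\cdot,0)=u_0$, where $V$ is a real-valued potential, $u_0$ is $\mathcal{F}_0$-measurable and $W$ is a $Q$-Wiener process. Let $M(u)=\int_{\mathbb{T}^d}|u|^2\,\mathrm{d}x$. Assume that $\mathbb{E}[M(u_0)]$ is finite, that $V\in H^2$, and that $Q$ is trace-class. Then the exact (mild) solution $$u(t)=S(t)u_0-\mathrm{i}\int_0^tS(t-r)Vu(r)\,\mathrm{d}r-\mathrm{i}\int_0^tS(t-r)\,\mathrm{d}W(r)$$ satisfies $$\mathbb{E}[M(u(t))]=\mathbb{E}[M(u_0)]+t\,\mathrm{Tr}(Q)\qquad\text{for all }t\ge0.$$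
   Context: $L^2=L^2(\mathbb{T}^d)$ is the space of complex-valued square integrable functions on the torus, with inner product $(u,v)=\mathrm{Re}\int_{\mathbb{T}^d}u\bar v\,\mathrm{d}x$; $H^2=H^2(\mathbb{T}^d)$ is the Sobolev space of order 2. $S(t)=\mathrm{e}^{-\mathrm{i}t\Delta}$ is the unitary group generated by $-\mathrm{i}\Delta$. $(\Omega,\mathcal{F},\mathbb{P},\{\mathcal{F}_t\}_{t\ge0})$ is a filtered probability space with a normal filtration; $Q$ is a nonnegative self-adjoint operator on $L^2$, and $W$ is a complex-valued (i.e. $L^2$-valued), square integrable $Q$-Wiener process with respect to $\{\mathcal{F}_t\}$, so $W(t)=\sum_j\beta_j(t)Q^{1/2}e_j$ for an orthonormal basis $(e_j)$ of $L^2$ and independent standard real Brownian motions $\beta_j$. $\mathrm{Tr}(Q)=\sum_j\|Q^{1/2}e_j\|_{L^2}^2$. *)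

theory Defs
  imports "HOL-Probability.Probability"
begin

text \<open>
  The torus is \<open>(\<real> / 2\<pi>\<int>)\<^sup>d\<close> with \<open>d = CARD('d)\<close>. Functions on it are
  functions on \<open>real ^ 'd\<close> of which only the values on the half-open fundamental cube matter.
\<close>

definition torus :: "(real ^ 'd::finite) measure" where
  "torus = restrict_space lborel {x. \<forall>i. 0 \<le> x $ i \<and> x $ i < 2 * pi}"

definition square_integrable :: "(real ^ 'd::finite \<Rightarrow> complex) \<Rightarrow> bool" where
  "square_integrable f \<longleftrightarrow>
     f \<in> borel_measurable torus \<and> integrable torus (\<lambda>x. (cmod (f x))\<^sup>2)"

lemma cube_sets: "{x::real ^ 'd::finite. \<forall>i. 0 \<le> x $ i \<and> x $ i < 2 * pi} \<in> sets lborel"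
proof -
  have "{x::real ^ 'd. 0 \<le> x $ i \<and> x $ i < 2 * pi} \<in> sets lborel" for i
    by measurable
  then have "(\<Inter>i. {x::real ^ 'd. 0 \<le> x $ i \<and> x $ i < 2 * pi}) \<in> sets lborel"
    by (intro sets.countable_INT'') auto
  then show ?thesis by (simp add: Collect_all_eq)
qed

lemma finite_measure_torus: "finite_measure (torus :: (real ^ 'd::finite) measure)"
proof
  let ?C = "{x::real ^ 'd. \<forall>i. 0 \<le> x $ i \<and> x $ i < 2 * pi}"
  have "emeasure lborel ?C \<le> emeasure lborel (cbox 0 (\<chi> i. 2 * pi) :: (real ^ 'd) set)"
    by (intro emeasure_mono) (auto simp: mem_box_cart less_imp_le)
  also have "\<dots> < \<infinity>" by (rule emeasure_lborel_cbox_finite)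
  finally show "emeasure torus (space (torus :: (real ^ 'd) measure)) \<noteq> \<infinity>"
    using cube_sets[where 'd='d] by (simp add: torus_def emeasure_restrict_space space_restrict_space)
qed

interpretation torus: finite_measure "torus :: (real ^ 'd::finite) measure"
  by (rule finite_measure_torus)

lemma sqi_measurable [measurable_dest]: "square_integrable f \<Longrightarrow> f \<in> borel_measurable torus"
  by (simp add: square_integrable_def)

lemma sqi_dominated:
  assumes [measurable]: "f \<in> borel_measurable torus" and "integrable torus w"
    and "AE x in torus. (cmod (f x))\<^sup>2 \<le> w x"
  shows "square_integrable f"
  unfolding square_integrable_def using assms
  by (auto intro!: Bochner_Integration.integrable_bound[OF assms(2)] elim!: AE_mp)

lemma sq_add_le: "(cmod (a + b))\<^sup>2 \<le> 2 * (cmod a)\<^sup>2 + 2 * (cmod b)\<^sup>2"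
proof -
  have "(cmod (a + b))\<^sup>2 \<le> (cmod a + cmod b)\<^sup>2"
    by (intro power_mono norm_triangle_ineq) auto
  also have "\<dots> \<le> 2 * (cmod a)\<^sup>2 + 2 * (cmod b)\<^sup>2"
    using sum_squares_bound[of "cmod a" "cmod b"] by (simp add: power2_sum)
  finally show ?thesis .
qed

lemma sqi_add: "square_integrable f \<Longrightarrow> square_integrable g \<Longrightarrow> square_integrable (\<lambda>x. f x + g x)"
  by (rule sqi_dominated[where w="\<lambda>x. 2 * (cmod (f x))\<^sup>2 + 2 * (cmod (g x))\<^sup>2"])
     (auto simp: square_integrable_def sq_add_le)

lemma sqi_cmult: "square_integrable f \<Longrightarrow> square_integrable (\<lambda>x. c * f x)"
  by (auto simp: square_integrable_def norm_mult power_mult_distrib)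

lemma sqi_scaleR: "square_integrable f \<Longrightarrow> square_integrable (\<lambda>x. c *\<^sub>R f x)"
  using sqi_cmult[of f "of_real c"] by (simp add: scaleR_conv_of_real)

lemma sqi_uminus: "square_integrable f \<Longrightarrow> square_integrable (\<lambda>x. - f x)"
  using sqi_cmult[of f "-1"] by simp

lemma sqi_diff: "square_integrable f \<Longrightarrow> square_integrable g \<Longrightarrow> square_integrable (\<lambda>x. f x - g x)"
  using sqi_add[of f "\<lambda>x. - g x"] sqi_uminus[of g] by simp

lemma sqi_zero: "square_integrable (\<lambda>x. 0)"
  by (simp add: square_integrable_def)

lemma sqi_bounded:
  "f \<in> borel_measurable torus \<Longrightarrow> (\<And>x. cmod (f x) \<le> B) \<Longrightarrow> square_integrable f"
  by (rule sqi_dominated[where w="\<lambda>x. B\<^sup>2"]) (auto intro!: power_mono)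

lemma sqi_prod_integrable:
  assumes "square_integrable f" "square_integrable g"
  shows "integrable torus (\<lambda>x. f x * cnj (g x))"
proof -
  note [measurable] = sqi_measurable[OF assms(1)] sqi_measurable[OF assms(2)]
  have "integrable torus (\<lambda>x. (cmod (f x))\<^sup>2 + (cmod (g x))\<^sup>2)"
    using assms by (auto simp: square_integrable_def)
  then show ?thesis
  proof (rule Bochner_Integration.integrable_bound)
    show "(\<lambda>x. f x * cnj (g x)) \<in> borel_measurable torus"
      by (intro borel_measurable_times borel_measurable_continuous_on[of cnj]) (auto intro: continuous_intros)
    have "a * b \<le> a\<^sup>2 + b\<^sup>2" if "a \<ge> 0" "b \<ge> 0" for a b :: real
      using sum_squares_bound[of a b] mult_nonneg_nonneg[OF that] by simp
    then show "AE x in torus. norm (f x * cnj (g x)) \<le> norm ((cmod (f x))\<^sup>2 + (cmod (g x))\<^sup>2)"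
      by (auto simp: norm_mult)
  qed
qed

text \<open>
  \<open>L\<^sup>2\<close> of the torus: square integrable complex functions modulo equality almost
  everywhere. It is made a real Hilbert space by \<open>(u, v) = Re \<integral> u v\<^sup>*\<close>; complex
  scalars act through a separate operation.
\<close>

quotient_type 'd L2 = "real ^ 'd::finite \<Rightarrow> complex" / partial:
  "\<lambda>f g. square_integrable f \<and> square_integrable g \<and> (AE x in torus. f x = g x)"
proof (rule part_equivpI)
  show "\<exists>f. square_integrable f \<and> square_integrable f \<and> (AE x in torus. (f :: real ^ 'd \<Rightarrow> complex) x = f x)"
    using sqi_zero by auto
qed (auto intro!: sympI transpI)

lemma inner_cong:
  assumes "square_integrable f \<and> square_integrable f' \<and> (AE x in torus. f x = f' x)"
    and "square_integrable g \<and> square_integrable g' \<and> (AE x in torus. g x = g' x)"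
  shows "(\<integral>x. f x * cnj (g x) \<partial>torus) = (\<integral>x. f' x * cnj (g' x) \<partial>torus)"
  using assms by (intro integral_cong_AE borel_measurable_integrable sqi_prod_integrable) auto

instantiation L2 :: (finite) real_vector
begin

lift_definition zero_L2 :: "'a L2" is "\<lambda>x. 0" by (simp add: sqi_zero)
lift_definition plus_L2 :: "'a L2 \<Rightarrow> 'a L2 \<Rightarrow> 'a L2" is "\<lambda>f g x. f x + g x"
  by (auto intro: sqi_add)
lift_definition minus_L2 :: "'a L2 \<Rightarrow> 'a L2 \<Rightarrow> 'a L2" is "\<lambda>f g x. f x - g x"
  by (auto intro: sqi_diff)
lift_definition uminus_L2 :: "'a L2 \<Rightarrow> 'a L2" is "\<lambda>f x. - f x"
  by (auto intro: sqi_uminus)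
lift_definition scaleR_L2 :: "real \<Rightarrow> 'a L2 \<Rightarrow> 'a L2" is "\<lambda>c f x. c *\<^sub>R f x"
  by (auto intro: sqi_scaleR)
instance
proof
  fix x y z :: "'a L2" and a b :: real
  show "x + y + z = x + (y + z)" by transfer (auto simp: add.assoc intro!: sqi_add)
  show "x + y = y + x" by transfer (auto simp: add.commute intro!: sqi_add)
  show "0 + x = x" by transfer auto
  show "- x + x = 0" by transfer (auto intro: sqi_zero)
  show "x - y = x + - y" by transfer (auto intro!: sqi_diff)
  show "a *\<^sub>R (x + y) = a *\<^sub>R x + a *\<^sub>R y"
    by transfer (auto simp: scaleR_add_right intro!: sqi_add sqi_scaleR)
  show "(a + b) *\<^sub>R x = a *\<^sub>R x + b *\<^sub>R x"
    by transfer (auto simp: scaleR_add_left intro!: sqi_add sqi_scaleR)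
  show "a *\<^sub>R b *\<^sub>R x = (a * b) *\<^sub>R x"
    by transfer (auto intro!: sqi_scaleR)
  show "1 *\<^sub>R x = x" by transfer auto
qed

end

instantiation L2 :: (finite) real_inner
begin

lift_definition inner_L2 :: "'a L2 \<Rightarrow> 'a L2 \<Rightarrow> real"
  is "\<lambda>f g. Re (\<integral>x. f x * cnj (g x) \<partial>torus)"
  by (rule arg_cong[where f=Re], rule inner_cong)

definition norm_L2 :: "'a L2 \<Rightarrow> real" where "norm_L2 u = sqrt (inner u u)"
definition sgn_L2 :: "'a L2 \<Rightarrow> 'a L2" where "sgn_L2 u = u /\<^sub>R norm u"
definition dist_L2 :: "'a L2 \<Rightarrow> 'a L2 \<Rightarrow> real" where "dist_L2 u v = norm (u - v)"
definition uniformity_L2 :: "('a L2 \<times> 'a L2) filter" where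
  "uniformity_L2 = (INF e\<in>{0<..}. principal {(u, v). dist u v < e})"
definition open_L2 :: "'a L2 set \<Rightarrow> bool" where
  "open_L2 U = (\<forall>u\<in>U. eventually (\<lambda>(u', v). u' = u \<longrightarrow> v \<in> U) uniformity)"

lemma inner_self_fun:
  assumes "square_integrable f"
  shows "Re (\<integral>x. f x * cnj (f x) \<partial>torus) = (\<integral>x. (cmod (f x))\<^sup>2 \<partial>torus)"
proof -
  have "(\<integral>x. f x * cnj (f x) \<partial>torus) = (\<integral>x. complex_of_real ((cmod (f x))\<^sup>2) \<partial>torus)"
    by (simp only: complex_norm_square)
  then show ?thesis by (simp only: integral_complex_of_real Re_complex_of_real)
qed

instance
proof
  fix x y z :: "'a L2" and a b :: real
  show "dist x y = norm (x - y)" by (rule dist_L2_def)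
  show "sgn x = x /\<^sub>R norm x" by (rule sgn_L2_def)
  show "uniformity = (INF e\<in>{0<..}. principal {(x, y). dist x (y :: 'a L2) < e})"
    by (rule uniformity_L2_def)
  show "open U = (\<forall>x\<in>U. \<forall>\<^sub>F (x', y) in uniformity. x' = x \<longrightarrow> y \<in> U)" for U :: "'a L2 set"
    by (rule open_L2_def)
  show "norm x = sqrt (inner x x)" by (rule norm_L2_def)
  show "inner x y = inner y x"
  proof transfer
    fix x y :: "real ^ 'a \<Rightarrow> complex"
    have "(\<integral>z. x z * cnj (y z) \<partial>torus) = (\<integral>z. cnj (y z * cnj (x z)) \<partial>torus)"
      by (simp add: mult.commute)
    also have "\<dots> = cnj (\<integral>z. y z * cnj (x z) \<partial>torus)" by (rule Bochner_Integration.integral_cnj)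
    finally show "Re (\<integral>z. x z * cnj (y z) \<partial>torus) = Re (\<integral>z. y z * cnj (x z) \<partial>torus)" by simp
  qed
  show "inner (x + y) z = inner x z + inner y z"
    by transfer (simp add: distrib_right sqi_prod_integrable)
  show "inner (a *\<^sub>R x) y = a * inner x y"
    by transfer (simp add: scaleR_conv_of_real mult.assoc)
  show "0 \<le> inner x x" by transfer (simp add: inner_self_fun)
  show "(inner x x = 0) = (x = 0)"
  proof transfer
    fix f :: "real ^ 'a \<Rightarrow> complex"
    assume "square_integrable f \<and> square_integrable f \<and> (AE x in torus. f x = f x)"
    then have f: "square_integrable f" by simp
    then have "integrable torus (\<lambda>x. (cmod (f x))\<^sup>2)" by (simp add: square_integrable_def)
    from integral_nonneg_eq_0_iff_AE[OF this]
    show "(Re (\<integral>x. f x * cnj (f x) \<partial>torus) = 0) =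
      (square_integrable f \<and> square_integrable (\<lambda>x. 0) \<and> (AE x in torus. f x = 0))"
      using f by (simp add: inner_self_fun sqi_zero)
  qed
qed

end

lemma norm_abs_L2:
  assumes "square_integrable f"
  shows "(norm (abs_L2 f))\<^sup>2 = (\<integral>x. (cmod (f x))\<^sup>2 \<partial>torus)"
proof -
  have "inner (abs_L2 f) (abs_L2 f) = Re (\<integral>x. f x * cnj (f x) \<partial>torus)"
    using assms by (intro inner_L2.abs_eq) (auto simp: eq_onp_def)
  then show ?thesis
    using assms by (simp add: inner_self_fun norm_eq_sqrt_inner)
qed

lemma L2_cases:
  obtains f where "square_integrable f" "u = abs_L2 f"
  using Quotient_abs_rep[OF Quotient_L2, of u] Quotient_rep_reflp[OF Quotient_L2, of u]
  that[of "rep_L2 u"] by simp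

lemma abs_L2_plus: "square_integrable f \<Longrightarrow> square_integrable g \<Longrightarrow>
    abs_L2 f + abs_L2 g = abs_L2 (\<lambda>x. f x + g x)"
  by (intro plus_L2.abs_eq) auto

lemma abs_L2_minus: "square_integrable f \<Longrightarrow> square_integrable g \<Longrightarrow>
    abs_L2 f - abs_L2 g = abs_L2 (\<lambda>x. f x - g x)"
  by (intro minus_L2.abs_eq) auto

lemma abs_L2_scaleR: "square_integrable f \<Longrightarrow> c *\<^sub>R abs_L2 f = abs_L2 (\<lambda>x. c *\<^sub>R f x)"
  by (intro scaleR_L2.abs_eq) auto

lemma abs_L2_eqI: "square_integrable f \<Longrightarrow> square_integrable g \<Longrightarrow>
    AE x in torus. f x = g x \<Longrightarrow> abs_L2 f = abs_L2 g"
  by (rule Quotient_rel_abs[OF Quotient_L2]) auto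

lemma tendsto_L2_dominated:
  fixes f :: "real ^ 'd::finite \<Rightarrow> complex"
  assumes s: "\<And>i. square_integrable (s i)" and f: "square_integrable f"
    and w: "integrable torus (\<lambda>x. (w x)\<^sup>2)"
    and lim: "AE x in torus. (\<lambda>i. s i x) \<longlonglongrightarrow> f x"
    and dom: "\<And>i. AE x in torus. cmod (s i x - f x) \<le> w x"
  shows "(\<lambda>i. abs_L2 (s i)) \<longlonglongrightarrow> abs_L2 f"
proof -
  note [measurable] = sqi_measurable[OF s] sqi_measurable[OF f]
  have "(\<lambda>i. \<integral>x. (cmod (s i x - f x))\<^sup>2 \<partial>torus) \<longlonglongrightarrow>
      (\<integral>x. 0 \<partial>(torus :: (real ^ 'd) measure))"
  proof (rule Bochner_Integration.integral_dominated_convergence[where w="\<lambda>x. (w x)\<^sup>2"])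
    show "AE x in torus. (\<lambda>i. (cmod (s i x - f x))\<^sup>2) \<longlonglongrightarrow> 0"
      using lim
    proof eventually_elim
      case (elim x)
      then have "(\<lambda>i. s i x - f x) \<longlonglongrightarrow> 0" by (simp add: LIM_zero)
      then have "(\<lambda>i. (cmod (s i x - f x))\<^sup>2) \<longlonglongrightarrow> (cmod 0)\<^sup>2"
        by (intro tendsto_power tendsto_norm)
      then show ?case by simp
    qed
    show "AE x in torus. norm ((cmod (s i x - f x))\<^sup>2) \<le> (w x)\<^sup>2" for i
      using dom[of i] by eventually_elim (auto intro!: power_mono)
    show "(\<lambda>x. (cmod (s i x - f x))\<^sup>2) \<in> borel_measurable torus" for i by measurable
  qed (simp_all add: w)
  then have "(\<lambda>i. (norm (abs_L2 (s i) - abs_L2 f))\<^sup>2) \<longlonglongrightarrow> 0"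
    using s f by (simp add: abs_L2_minus norm_abs_L2 sqi_diff)
  then have "(\<lambda>i. sqrt ((norm (abs_L2 (s i) - abs_L2 f))\<^sup>2)) \<longlonglongrightarrow> sqrt 0"
    by (rule tendsto_real_sqrt)
  then show ?thesis by (simp add: tendsto_norm_zero_iff LIM_zero_iff)
qed


lemma L2_summable_converges:
  fixes F :: "nat \<Rightarrow> real ^ 'd::finite \<Rightarrow> complex"
  assumes F: "\<And>n. square_integrable (F n)"
    and small: "\<And>m n. n \<le> m \<Longrightarrow> norm (abs_L2 (F m) - abs_L2 (F n)) \<le> (1/2) ^ n"
  shows "\<exists>u. (\<lambda>n. abs_L2 (F n)) \<longlonglongrightarrow> u"
proof -
  note [measurable] = sqi_measurable[OF F]
  have nn: "(\<integral>\<^sup>+x. ennreal ((cmod (F m x - F n x))\<^sup>2) \<partial>torus) \<le> ennreal ((1/4) ^ n)"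
    if "n \<le> m" for m n
  proof -
    have "(\<integral>\<^sup>+x. ennreal ((cmod (F m x - F n x))\<^sup>2) \<partial>torus)
        = ennreal (\<integral>x. (cmod (F m x - F n x))\<^sup>2 \<partial>torus)"
      using sqi_diff[OF F F, of m n] by (intro nn_integral_eq_integral) (auto simp: square_integrable_def)
    also have "(\<integral>x. (cmod (F m x - F n x))\<^sup>2 \<partial>torus) = (norm (abs_L2 (F m) - abs_L2 (F n)))\<^sup>2"
      using sqi_diff[OF F F, of m n] by (simp add: abs_L2_minus F norm_abs_L2)
    also have "\<dots> \<le> ((1/2) ^ n)\<^sup>2"
      using small[OF that] by (intro power_mono) auto
    also have "\<dots> = (1/4) ^ n" by (simp add: power2_eq_square flip: power_mult_distrib)
    finally show ?thesis by (simp add: ennreal_leI)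
  qed
  define \<mu> where "\<mu> = measure (torus :: (real ^ 'd) measure) (space torus)"
  have \<mu>: "emeasure (torus :: (real ^ 'd) measure) (space torus) = ennreal \<mu>"
    by (simp add: \<mu>_def torus.emeasure_eq_measure)
  have \<mu>0: "\<mu> \<ge> 0" by (simp add: \<mu>_def)
  define D where "D k x = cmod (F (Suc k) x - F k x)" for k x
  have [measurable]: "D k \<in> borel_measurable torus" for k unfolding D_def by measurable
  have D1: "(\<integral>\<^sup>+x. ennreal (D k x) \<partial>torus) \<le> ennreal ((\<mu> + 1) * (1/2) ^ k)" for k
  proof -
    have "D k x \<le> (1/2) ^ k + 2 ^ k * (D k x)\<^sup>2" for x
    proof -
      have *: "a * b \<le> a\<^sup>2 + b\<^sup>2" if "a \<ge> 0" "b \<ge> 0" for a b :: real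
        using sum_squares_bound[of a b] mult_nonneg_nonneg[OF that] by simp
      have "2 ^ k * D k x * 1 \<le> (2 ^ k * D k x)\<^sup>2 + 1\<^sup>2"
        by (intro *) (auto simp: D_def)
      then have "(2 ^ k * D k x) / 2 ^ k \<le> ((2 ^ k * D k x)\<^sup>2 + 1) / 2 ^ k"
        by (intro divide_right_mono) auto
      then show ?thesis by (simp add: field_simps power2_eq_square)
    qed
    then have "(\<integral>\<^sup>+x. ennreal (D k x) \<partial>torus)
        \<le> (\<integral>\<^sup>+x. ennreal ((1/2) ^ k) + ennreal (2 ^ k) * ennreal ((D k x)\<^sup>2) \<partial>torus)"
      by (intro nn_integral_mono) (simp add: ennreal_leI flip: ennreal_mult ennreal_plus)
    also have "\<dots> = ennreal ((1/2) ^ k) * ennreal \<mu> +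
        ennreal (2 ^ k) * (\<integral>\<^sup>+x. ennreal ((D k x)\<^sup>2) \<partial>torus)"
      by (subst nn_integral_add) (auto simp: nn_integral_cmult \<mu>)
    also have "\<dots> \<le> ennreal ((1/2) ^ k) * ennreal \<mu> + ennreal (2 ^ k) * ennreal ((1/4) ^ k)"
      using nn[of k "Suc k"] unfolding D_def by (intro add_mono mult_left_mono) auto
    also have "\<dots> = ennreal ((1/2) ^ k * \<mu> + 2 ^ k * (1/4) ^ k)"
      using \<mu>0 by (simp flip: ennreal_mult ennreal_plus)
    also have "(1/2) ^ k * \<mu> + 2 ^ k * (1/4) ^ k = (\<mu> + 1) * (1/2::real) ^ k"
      by (simp add: algebra_simps flip: power_mult_distrib)
    finally show ?thesis .
  qed
  have "(\<integral>\<^sup>+x. (\<Sum>k. ennreal (D k x)) \<partial>torus) = (\<Sum>k. \<integral>\<^sup>+x. ennreal (D k x) \<partial>torus)"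
    by (intro nn_integral_suminf) auto
  also have "\<dots> \<le> (\<Sum>k. ennreal ((\<mu> + 1) * (1/2) ^ k))"
    by (intro suminf_le D1) auto
  also have "\<dots> = ennreal (\<Sum>k. (\<mu> + 1) * (1/2) ^ k)"
    using \<mu>0 by (intro suminf_ennreal2) (auto intro!: summable_mult)
  also have "\<dots> < \<infinity>" by simp
  finally have fin: "(\<integral>\<^sup>+x. (\<Sum>k. ennreal (D k x)) \<partial>torus) \<noteq> \<infinity>" by simp
  have "AE x in torus. (\<Sum>k. ennreal (D k x)) \<noteq> \<infinity>"
    by (intro nn_integral_PInf_AE fin) auto
  then have conv: "AE x in torus. convergent (\<lambda>n. F n x)"
  proof eventually_elim
    case (elim x)
    have "summable (\<lambda>k. D k x)"
      using elim by (intro summable_suminf_not_top) (auto simp: D_def)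
    then have "summable (\<lambda>k. F (Suc k) x - F k x)"
      unfolding D_def by (rule summable_norm_cancel)
    then have "convergent (\<lambda>n. (\<Sum>k<n. F (Suc k) x - F k x) + F 0 x)"
      by (intro convergent_add convergent_const) (simp add: summable_iff_convergent)
    then show ?case
      unfolding sum_lessThan_telescope[of "\<lambda>n. F n x"] by simp
  qed
  define f where "f x = lim (\<lambda>n. F n x)" for x
  have [measurable]: "f \<in> borel_measurable torus" unfolding f_def by measurable
  have le: "(\<integral>\<^sup>+x. ennreal ((cmod (f x - F n x))\<^sup>2) \<partial>torus) \<le> ennreal ((1/4) ^ n)" for n
  proof -
    have "(\<integral>\<^sup>+x. ennreal ((cmod (f x - F n x))\<^sup>2) \<partial>torus)
        = (\<integral>\<^sup>+x. liminf (\<lambda>m. ennreal ((cmod (F m x - F n x))\<^sup>2)) \<partial>torus)"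
    proof (rule nn_integral_cong_AE, use conv in eventually_elim)
      case (elim x)
      then have "(\<lambda>m. F m x) \<longlonglongrightarrow> f x"
        unfolding f_def by (simp add: convergent_LIMSEQ_iff)
      then have "(\<lambda>m. ennreal ((cmod (F m x - F n x))\<^sup>2)) \<longlonglongrightarrow> ennreal ((cmod (f x - F n x))\<^sup>2)"
        by (intro tendsto_intros)
      from lim_imp_Liminf[OF sequentially_bot this] show ?case by simp
    qed
    also have "\<dots> \<le> liminf (\<lambda>m. \<integral>\<^sup>+x. ennreal ((cmod (F m x - F n x))\<^sup>2) \<partial>torus)"
      by (intro nn_integral_liminf) auto
    also have "\<dots> \<le> ennreal ((1/4) ^ n)"
    proof -
      have "liminf (\<lambda>m. \<integral>\<^sup>+x. ennreal ((cmod (F m x - F n x))\<^sup>2) \<partial>torus)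
          \<le> liminf (\<lambda>m. ennreal ((1/4) ^ n))"
        by (intro Liminf_mono eventually_sequentiallyI[of n] nn)
      then show ?thesis by (simp add: Liminf_const)
    qed
    finally show ?thesis .
  qed
  have diff: "square_integrable (\<lambda>x. f x - F n x)" for n
    unfolding square_integrable_def using le[of n]
    by (auto intro!: integrableI_bounded simp: order_le_less_trans)
  have f: "square_integrable f"
    using sqi_add[OF diff[of 0] F[of 0]] by simp
  have "norm (abs_L2 (F n) - abs_L2 f) \<le> (1/2) ^ n" for n
  proof -
    have "ennreal (\<integral>x. (cmod (f x - F n x))\<^sup>2 \<partial>torus)
        = (\<integral>\<^sup>+x. ennreal ((cmod (f x - F n x))\<^sup>2) \<partial>torus)"
      using diff[of n] by (intro nn_integral_eq_integral[symmetric]) (auto simp: square_integrable_def)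
    also note le[of n]
    also have "(\<integral>x. (cmod (f x - F n x))\<^sup>2 \<partial>torus) = (norm (abs_L2 f - abs_L2 (F n)))\<^sup>2"
      by (simp add: abs_L2_minus f F norm_abs_L2 diff)
    finally have "(norm (abs_L2 f - abs_L2 (F n)))\<^sup>2 \<le> ((1/2) ^ n)\<^sup>2"
      by (simp add: power2_eq_square flip: power_mult_distrib)
    then show ?thesis
      by (subst norm_minus_commute) (rule power2_le_imp_le, auto)
  qed
  then have "(\<lambda>n. abs_L2 (F n) - abs_L2 f) \<longlonglongrightarrow> 0"
    by (intro Lim_null_comparison[OF _ LIMSEQ_power_zero[of "1/2::real"]]) auto
  then show ?thesis by (auto simp: LIM_zero_iff)
qed

instance L2 :: (finite) banach
proof
  fix X :: "nat \<Rightarrow> 'a L2" assume X: "Cauchy X"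
  have "\<exists>M. \<forall>m\<ge>M. \<forall>n\<ge>M. norm (X m - X n) < (1/2) ^ k" for k
    using X unfolding Cauchy_def dist_norm by (metis half_gt_zero_iff zero_less_one zero_less_power)
  then obtain N where N: "\<And>k m n. m \<ge> N k \<Longrightarrow> n \<ge> N k \<Longrightarrow> norm (X m - X n) < (1/2) ^ k"
    by metis
  define r where "r k = (\<Sum>i\<le>k. N i) + k" for k
  have r: "strict_mono r" by (auto simp: strict_mono_Suc_iff r_def)
  have rN: "N k \<le> r k" for k
    unfolding r_def by (rule trans_le_add1, rule member_le_sum) auto
  define F where "F k = rep_L2 (X (r k))" for k
  have F: "square_integrable (F k)" "abs_L2 (F k) = X (r k)" for k
    using Quotient_abs_rep[OF Quotient_L2] Quotient_rep_reflp[OF Quotient_L2, of "X (r k)"]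
    by (auto simp: F_def)
  have "\<exists>u. (\<lambda>n. abs_L2 (F n)) \<longlonglongrightarrow> u"
  proof (rule L2_summable_converges)
    fix m n :: nat assume "n \<le> m"
    then have "r n \<le> r m" using r by (simp add: strict_mono_less_eq)
    then show "norm (abs_L2 (F m) - abs_L2 (F n)) \<le> (1/2) ^ n"
      using N[of n "r m" "r n"] rN[of n] by (simp add: F)
  qed (rule F)
  then obtain u where "(X \<circ> r) \<longlonglongrightarrow> u" by (auto simp: F comp_def)
  then show "convergent X"
    using Cauchy_converges_subseq[OF X r] convergent_def by blast
qed

definition ind_L2 :: "complex \<Rightarrow> (real ^ 'd::finite) set \<Rightarrow> 'd L2" where
  "ind_L2 c A = abs_L2 (\<lambda>x. indicator A x * c)"

lemma sqi_ind:
  assumes "A \<in> sets borel"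
  shows "square_integrable (\<lambda>x. indicator A x * c)"
proof (rule sqi_bounded)
  have "(\<lambda>x. indicator A x * c) \<in> borel_measurable borel" using assms by measurable
  then show "(\<lambda>x. indicator A x * c) \<in> borel_measurable torus"
    unfolding torus_def by (intro measurable_restrict_space1) simp
  show "cmod (indicator A x * c) \<le> cmod c" for x by (simp add: indicator_def)
qed

lemma subspace_closure_rat:
  fixes G :: "'a::real_normed_vector set"
  assumes "countable G"
  shows "\<exists>D. countable D \<and> G \<subseteq> closure D \<and> subspace (closure D)"
proof -
  define D where "D = (\<lambda>L. \<Sum>(q, g)\<leftarrow>L. q *\<^sub>R g) ` lists ((\<rat> :: real set) \<times> G)"
  have c: "countable D"
    unfolding D_def using assms countable_rat by (intro countable_image countable_lists countable_SIGMA) auto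
  have D0: "0 \<in> D" unfolding D_def by (rule image_eqI[of _ _ "[]"]) auto
  have Dadd: "x + y \<in> D" if "x \<in> D" "y \<in> D" for x y
    using that unfolding D_def by (auto intro!: image_eqI[where x="_ @ _"])
  have Dsc: "q *\<^sub>R x \<in> D" if q: "q \<in> \<rat>" and x: "x \<in> D" for q x
  proof -
    from x obtain L where L: "L \<in> lists (\<rat> \<times> G)" "x = (\<Sum>(q, g)\<leftarrow>L. q *\<^sub>R g)"
      by (auto simp: D_def)
    have "q *\<^sub>R (\<Sum>(q, g)\<leftarrow>L. q *\<^sub>R g) = (\<Sum>(q, g)\<leftarrow>map (\<lambda>(p, g). (q * p, g)) L. q *\<^sub>R g)" for L :: "(real \<times> 'a) list"
      by (induction L) (auto simp: scaleR_add_right)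
    moreover have "map (\<lambda>(p, g). (q * p, g)) L \<in> lists (\<rat> \<times> G)"
      using L(1) q by (auto simp: in_lists_conv_set intro: Rats_mult)
    ultimately show ?thesis unfolding D_def L(2) by blast
  qed
  have "g \<in> D" if "g \<in> G" for g
    unfolding D_def using that by (intro image_eqI[of _ _ "[(1, g)]"]) auto
  then have "G \<subseteq> closure D" using closure_subset by blast
  moreover have "subspace (closure D)"
  proof (rule subspaceI)
    show "0 \<in> closure D" using D0 closure_subset by blast
    fix x y assume "x \<in> closure D" "y \<in> closure D"
    then obtain X Y where "\<And>n. X n \<in> D" "X \<longlonglongrightarrow> x" "\<And>n. Y n \<in> D" "Y \<longlonglongrightarrow> y"
      unfolding closure_sequential by blast
    then show "x + y \<in> closure D"
      unfolding closure_sequential by (intro exI[of _ "\<lambda>n. X n + Y n"]) (auto intro: Dadd tendsto_add)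
  next
    fix c :: real and x assume "x \<in> closure D"
    then obtain X where X: "\<And>n. X n \<in> D" "X \<longlonglongrightarrow> x"
      unfolding closure_sequential by blast
    have "c \<in> closure \<rat>" by (simp add: Rats_closure_real)
    then obtain q where q: "\<And>n. q n \<in> \<rat>" "q \<longlonglongrightarrow> c"
      unfolding closure_sequential by blast
    show "c *\<^sub>R x \<in> closure D"
      unfolding closure_sequential using X q
      by (intro exI[of _ "\<lambda>n. q n *\<^sub>R X n"]) (auto intro: Dsc tendsto_scaleR)
  qed
  ultimately show ?thesis using c by blast
qed

lemma L2_separable: "\<exists>D :: 'd::finite L2 set. countable D \<and> closure D = UNIV"
proof -
  obtain B0 :: "(real ^ 'd) set set" where B0: "countable B0" "topological_basis B0"
    using ex_countable_basis by blast
  define B where "B = insert {} ((\<lambda>F. \<Inter>F) ` {F. finite F \<and> F \<subseteq> B0})"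
  have cB: "countable B"
    unfolding B_def using countable_Collect_finite_subset[OF B0(1)] by auto
  have B_open: "open b" if "b \<in> B" for b
    using that by (auto simp: B_def intro!: open_Inter dest: topological_basis_open[OF B0(2)])
  have "b \<in> B" if "b \<in> B0" for b
    unfolding B_def using that by (intro insertI2 image_eqI[of _ _ "{b}"]) auto
  then have B_gen: "sets borel = sigma_sets UNIV B"
  proof -
    assume sub: "\<And>b. b \<in> B0 \<Longrightarrow> b \<in> B"
    have "sets borel = sigma_sets UNIV B0"
      by (subst borel_eq_countable_basis[OF B0]) (auto intro: sets_measure_of)
    also have "\<dots> \<subseteq> sigma_sets UNIV B"
      by (rule sigma_sets_mono') (use sub in auto)
    finally have "sets borel \<subseteq> sigma_sets UNIV B" .
    moreover have "sigma_sets UNIV B \<subseteq> sets borel"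
    proof -
      have "B \<subseteq> sets borel" using B_open by (auto intro: borel_open)
      from sets.sigma_sets_subset[OF this] show ?thesis by simp
    qed
    ultimately show ?thesis by auto
  qed
  have B_int: "Int_stable B"
  proof (rule Int_stableI)
    fix a b assume "a \<in> B" "b \<in> B"
    then consider "a = {} \<or> b = {}"
      | F G where "finite F" "F \<subseteq> B0" "a = \<Inter>F" "finite G" "G \<subseteq> B0" "b = \<Inter>G"
      by (auto simp: B_def)
    then show "a \<inter> b \<in> B"
    proof cases
      case 2
      then show ?thesis
        unfolding B_def by (intro insertI2 image_eqI[of _ _ "F \<union> G"]) auto
    qed (auto simp: B_def)
  qed
  have UNIV_B: "UNIV \<in> B" unfolding B_def by (intro insertI2 image_eqI[of _ _ "{}"]) auto
  define G :: "'d L2 set" where "G = ind_L2 1 ` B \<union> ind_L2 \<i> ` B"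
  have "countable G" unfolding G_def using cB by auto
  from subspace_closure_rat[OF this] obtain D where
    D: "countable D" "G \<subseteq> closure D" "subspace (closure D)" by blast
  have ind: "ind_L2 c A \<in> closure D" if "A \<in> sets borel" and c: "c \<in> {1, \<i>}" for A c
  proof -
    have "A \<in> sigma_sets UNIV B" using that B_gen by auto
    with B_int have "Int_stable B" "B \<subseteq> Pow UNIV" "A \<in> sigma_sets UNIV B" by auto
    then show ?thesis
    proof (induction rule: sigma_sets_induct_disjoint)
      case (basic A)
      then show ?case using c D(2) by (auto simp: G_def)
    next
      case empty
      have "ind_L2 c ({} :: (real ^ 'd) set) = 0" by (simp add: ind_L2_def zero_L2_def)
      then show ?case using D(3) by (simp add: subspace_0)
    next
      case (compl A)
      then have A: "A \<in> sets borel" by (simp add: B_gen)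
      have "ind_L2 c (UNIV - A) = ind_L2 c UNIV - ind_L2 c A"
      proof -
        have *: "(\<lambda>x. indicator (UNIV - A) x * c) = (\<lambda>x. indicator UNIV x * c - indicator A x * c)"
          by (auto simp: fun_eq_iff indicator_def)
        show ?thesis
          unfolding ind_L2_def * by (intro abs_L2_minus[symmetric] sqi_ind A) auto
      qed
      moreover have "ind_L2 c UNIV \<in> closure D"
        using c D(2) UNIV_B by (auto simp: G_def)
      ultimately show ?case using compl D(3) by (simp add: subspace_diff)
    next
      case (union A)
      then have A: "A i \<in> sets borel" for i by (auto simp: B_gen)
      have "ind_L2 c (\<Union>i<n. A i) \<in> closure D" for n
      proof (induction n)
        case 0
        have "ind_L2 c ({} :: (real ^ 'd) set) = 0" by (simp add: ind_L2_def zero_L2_def)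
        then show ?case using D(3) by (simp add: subspace_0)
      next
        case (Suc n)
        have disj: "A n \<inter> (\<Union>i<n. A i) = {}"
        proof -
          have "A n \<inter> A i = {}" if "i < n" for i
            using disjoint_family_onD[OF union.hyps(1), of n i] that by simp
          then show ?thesis by blast
        qed
        have "ind_L2 c (\<Union>i<Suc n. A i) = ind_L2 c (A n) + ind_L2 c (\<Union>i<n. A i)"
        proof -
          have *: "(\<lambda>x. indicator (\<Union>i<Suc n. A i) x * c) =
              (\<lambda>x. indicator (A n) x * c + indicator (\<Union>i<n. A i) x * c)"
            using disj by (auto simp: fun_eq_iff lessThan_Suc indicator_def)
          show ?thesis
            unfolding ind_L2_def * by (intro abs_L2_plus[symmetric] sqi_ind) (auto intro: A)
        qed
        then show ?case using Suc union.IH[of n] D(3) by (simp add: subspace_add)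
      qed
      moreover have "(\<lambda>n. ind_L2 c (\<Union>i<n. A i)) \<longlonglongrightarrow> ind_L2 c (\<Union>i. A i)"
        unfolding ind_L2_def
      proof (rule tendsto_L2_dominated[where w="\<lambda>_. 2 * cmod c"])
        have "(\<lambda>n. indicator (\<Union>i<n. A i) x :: complex) \<longlonglongrightarrow> indicator (\<Union>i. A i) x" for x
          by (rule LIMSEQ_indicator_UN)
        then show "AE x in torus. (\<lambda>n. indicator (\<Union>i<n. A i) x * c) \<longlonglongrightarrow> indicator (\<Union>i. A i) x * c"
          by (intro AE_I2 tendsto_mult_right)
        show "AE x in torus. cmod (indicator (\<Union>i<n. A i) x * c - indicator (\<Union>i. A i) x * c) \<le> 2 * cmod c" for n
          by (auto simp: indicator_def)
      qed (auto intro!: sqi_ind A)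
      ultimately show ?case by (rule closed_sequentially[OF closed_closure])
    qed
  qed
  have ind': "ind_L2 c A \<in> closure D" if A: "A \<in> sets borel" for A c
  proof -
    have "ind_L2 c A = Re c *\<^sub>R ind_L2 1 A + Im c *\<^sub>R ind_L2 \<i> A"
    proof -
      have *: "(\<lambda>x. indicator A x * c) =
          (\<lambda>x. Re c *\<^sub>R (indicator A x * 1) + Im c *\<^sub>R (indicator A x * \<i>))"
        by (auto simp: fun_eq_iff indicator_def complex_eq_iff)
      show ?thesis
        unfolding ind_L2_def * abs_L2_scaleR[OF sqi_ind[OF A]]
        by (intro abs_L2_plus[symmetric] sqi_scaleR sqi_ind A)
    qed
    then show ?thesis using ind[OF A] D(3) by (simp add: subspace_add subspace_scale)
  qed
  have simple: "abs_L2 s \<in> closure D" if s: "simple_function torus s" for s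
  proof -
    have fin: "finite (s ` space torus)" using s by (rule simple_functionD)
    have Ms: "s -` {y} \<inter> space torus \<in> sets borel" for y
    proof -
      have "s -` {y} \<inter> space torus \<in> sets torus" using s by (rule simple_functionD)
      then show ?thesis using cube_sets[where 'd='d]
        by (auto simp: torus_def sets_restrict_space)
    qed
    define h where "h y x = indicator (s -` {y} \<inter> space torus) x * y" for y x
    have h: "square_integrable (h y)" for y
      unfolding h_def by (intro sqi_ind Ms)
    have h_D: "abs_L2 (h y) \<in> closure D" for y
      using ind'[OF Ms, of y y] by (simp add: ind_L2_def h_def[abs_def])
    have "square_integrable (\<lambda>x. \<Sum>y\<in>Y. h y x) \<and> abs_L2 (\<lambda>x. \<Sum>y\<in>Y. h y x) \<in> closure D"
      if "finite Y" for Y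
      using that
    proof induction
      case empty
      then show ?case using D(3) by (simp add: sqi_zero subspace_0 flip: zero_L2_def)
    next
      case (insert y Y)
      have "abs_L2 (\<lambda>x. h y x + (\<Sum>y\<in>Y. h y x)) = abs_L2 (h y) + abs_L2 (\<lambda>x. \<Sum>y\<in>Y. h y x)"
        using insert by (intro abs_L2_plus[symmetric] h) auto
      moreover have "square_integrable (\<lambda>x. h y x + (\<Sum>y\<in>Y. h y x))"
        using insert by (intro sqi_add h) auto
      ultimately show ?case
        using insert h_D[of y] D(3) by (simp add: subspace_add)
    qed
    note * = this[OF fin]
    have eq: "(\<Sum>y\<in>s ` space torus. h y x) = s x" if "x \<in> space torus" for x
      using simple_function_indicator_representation_banach[OF s that, symmetric]
      by (simp only: h_def scaleR_conv_of_real of_real_indicator)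
    have "s \<in> borel_measurable torus" using s by (rule borel_measurable_simple_function)
    then have "square_integrable s"
    proof (rule sqi_dominated)
      show "integrable torus (\<lambda>x. (cmod (\<Sum>y\<in>s ` space torus. h y x))\<^sup>2)"
        using * unfolding square_integrable_def by blast
      show "AE x in torus. (cmod (s x))\<^sup>2 \<le> (cmod (\<Sum>y\<in>s ` space torus. h y x))\<^sup>2"
        by (rule AE_I2) (simp only: eq order_refl)
    qed
    with * have "abs_L2 s = abs_L2 (\<lambda>x. \<Sum>y\<in>s ` space torus. h y x)"
      by (intro abs_L2_eqI AE_I2) (simp_all only: eq)
    with * show ?thesis by simp
  qed
  have "u \<in> closure D" for u :: "'d L2"
  proof -
    obtain f where f: "square_integrable f" "u = abs_L2 f" by (rule L2_cases)
    note fm = sqi_measurable[OF f(1)]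
    obtain s where s: "\<And>i. simple_function torus (s i)"
      "\<And>x. x \<in> space torus \<Longrightarrow> (\<lambda>i. s i x) \<longlonglongrightarrow> f x"
      "\<And>i x. x \<in> space torus \<Longrightarrow> cmod (s i x) \<le> 2 * cmod (f x)"
      using borel_measurable_implies_sequence_metric[OF fm, of 0] by (auto simp: dist_norm) metis
    have sq: "square_integrable (s i)" for i
    proof (rule sqi_dominated[where w="\<lambda>x. (cmod (2 * f x))\<^sup>2"])
      show "s i \<in> borel_measurable torus" using s(1) by (rule borel_measurable_simple_function)
      show "integrable torus (\<lambda>x. (cmod (2 * f x))\<^sup>2)"
        using sqi_cmult[OF f(1), of 2] by (simp add: square_integrable_def)
      show "AE x in torus. (cmod (s i x))\<^sup>2 \<le> (cmod (2 * f x))\<^sup>2"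
        using s(3)[of _ i] by (intro AE_I2 power_mono) (auto simp: norm_mult)
    qed
    have "(\<lambda>i. abs_L2 (s i)) \<longlonglongrightarrow> abs_L2 f"
    proof (rule tendsto_L2_dominated[where w="\<lambda>x. cmod (3 * f x)"])
      show "integrable torus (\<lambda>x. (cmod (3 * f x))\<^sup>2)"
        using sqi_cmult[OF f(1), of 3] by (simp add: square_integrable_def)
      show "AE x in torus. cmod (s i x - f x) \<le> cmod (3 * f x)" for i
      proof (rule AE_I2)
        fix x :: "real ^ 'd" assume "x \<in> space torus"
        from s(3)[OF this, of i] norm_triangle_ineq4[of "s i x" "f x"]
        show "cmod (s i x - f x) \<le> cmod (3 * f x)" by (simp add: norm_mult)
      qed
    qed (use s sq f in auto)
    then show ?thesis
      unfolding f(2) by (rule closed_sequentially[OF closed_closure simple[OF s(1)]])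
  qed
  then show ?thesis using D(1) by blast
qed

instance L2 :: (finite) second_countable_topology
proof
  obtain D :: "'a L2 set" where D: "countable D" "closure D = UNIV"
    using L2_separable by blast
  define B where "B = (\<lambda>(x, n). ball x (1 / real (Suc n))) ` (D \<times> (UNIV :: nat set))"
  have "countable B" unfolding B_def using D(1) by (intro countable_image countable_SIGMA) auto
  moreover have "topological_basis B"
  proof (rule topological_basisI)
    fix b assume "b \<in> B" then show "open b" by (auto simp: B_def)
  next
    fix U :: "'a L2 set" and x assume "open U" "x \<in> U"
    then obtain e where e: "e > 0" "ball x e \<subseteq> U" using open_contains_ball by blast
    then obtain n where n: "1 / real (Suc n) < e / 2"
      using nat_approx_posE[of "e / 2"] by auto
    have "x \<in> closure D" by (simp add: D(2))
    then obtain y where y: "y \<in> D" "dist y x < 1 / real (Suc n)"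
      unfolding closure_approachable by (metis of_nat_0_less_iff zero_less_Suc zero_less_divide_1_iff)
    have "ball y (1 / real (Suc n)) \<subseteq> ball x e"
    proof
      fix z assume "z \<in> ball y (1 / real (Suc n))"
      then have "dist y z < 1 / real (Suc n)" by simp
      then have "dist x z < e"
        using dist_triangle[of x z y] y(2) n by (simp add: dist_commute)
      then show "z \<in> ball x e" by simp
    qed
    then show "\<exists>b\<in>B. x \<in> b \<and> b \<subseteq> U"
      using y e(2) by (intro bexI[of _ "ball y (1 / real (Suc n))"]) (auto simp: B_def)
  qed
  ultimately show "\<exists>B :: 'a L2 set set. countable B \<and> open = generate_topology B"
    using topological_basis_imp_subbasis by blast
qed


text \<open>
  \<open>mass u\<close> is \<open>M(u) = \<integral> |u|\<^sup>2\<close>.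
\<close>

lift_definition mass :: "'d::finite L2 \<Rightarrow> real" is "\<lambda>f. \<integral>x. (cmod (f x))\<^sup>2 \<partial>torus"
  by (intro integral_cong_AE) (auto dest: sqi_measurable)

lemma mass_eq_norm: "mass u = (norm u)\<^sup>2"
proof -
  obtain f where "square_integrable f" "u = abs_L2 f" by (rule L2_cases)
  then show ?thesis by (simp add: norm_abs_L2 mass.abs_eq)
qed

lift_definition cscale :: "complex \<Rightarrow> 'd::finite L2 \<Rightarrow> 'd L2" (infixr \<open>*\<^sub>C\<close> 75)
  is "\<lambda>c f x. c * f x"
  by (auto intro: sqi_cmult)

text \<open>
  Since the product of two square integrable functions need not be square integrable, products
  outside \<open>L\<^sup>2\<close> are set to \<open>0\<close>. This case does not arise for a factor in \<open>H\<^sup>2\<close> in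
  dimension at most three, because such a factor is essentially bounded.
\<close>

lift_definition mult_L2 :: "'d::finite L2 \<Rightarrow> 'd L2 \<Rightarrow> 'd L2"
  is "\<lambda>g f x. if square_integrable (\<lambda>y. g y * f y) then g x * f x else 0"
proof -
  fix g g' f f' :: "real ^ 'd \<Rightarrow> complex"
  assume g: "square_integrable g \<and> square_integrable g' \<and> (AE x in torus. g x = g' x)"
    and f: "square_integrable f \<and> square_integrable f' \<and> (AE x in torus. f x = f' x)"
  have eq: "AE x in torus. g x * f x = g' x * f' x" using g f by (auto elim: AE_mp)
  have meas: "(\<lambda>x. g x * f x) \<in> borel_measurable torus" "(\<lambda>x. g' x * f' x) \<in> borel_measurable torus"
    using g f by (auto dest!: sqi_measurable)
  have "integrable torus (\<lambda>x. (cmod (g x * f x))\<^sup>2) = integrable torus (\<lambda>x. (cmod (g' x * f' x))\<^sup>2)"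
    using eq meas by (intro integrable_cong_AE) (auto elim: AE_mp)
  then have "square_integrable (\<lambda>x. g x * f x) = square_integrable (\<lambda>x. g' x * f' x)"
    using meas by (simp add: square_integrable_def)
  then show "?thesis g g' f f'"
    using eq by (cases "square_integrable (\<lambda>x. g x * f x)") (auto simp: sqi_zero)
qed

lift_definition real_valued :: "'d::finite L2 \<Rightarrow> bool" is "\<lambda>f. AE x in torus. f x \<in> \<real>"
  by (auto elim: AE_mp)

definition phase :: "int ^ 'd \<Rightarrow> real ^ 'd \<Rightarrow> real" where
  "phase k x = (\<Sum>i\<in>UNIV. real_of_int (k $ i) * x $ i)"

definition freq_sq :: "int ^ 'd \<Rightarrow> real" where
  "freq_sq k = (\<Sum>i\<in>UNIV. (real_of_int (k $ i))\<^sup>2)"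

lemma phase_measurable: "(\<lambda>x. cis (c * phase k x)) \<in> borel_measurable torus"
proof -
  have "continuous_on UNIV (\<lambda>x. cis (c * phase k x))"
    unfolding phase_def cis_conv_exp by (intro continuous_intros)
  then have "(\<lambda>x. cis (c * phase k x)) \<in> borel_measurable borel"
    by (rule borel_measurable_continuous_onI)
  then show ?thesis unfolding torus_def by (intro measurable_restrict_space1) simp
qed

lift_definition fourier_mode :: "int ^ 'd::finite \<Rightarrow> 'd L2" is "\<lambda>k x. cis (phase k x)"
  using phase_measurable[of 1] by (auto intro!: sqi_bounded[where B=1])

lift_definition fourier_coeff :: "'d::finite L2 \<Rightarrow> int ^ 'd \<Rightarrow> complex"
  is "\<lambda>f k. (\<integral>x. f x * cis (- phase k x) \<partial>torus) / (2 * pi) ^ CARD('d)"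
proof -
  fix f g :: "real ^ 'd \<Rightarrow> complex"
  assume *: "square_integrable f \<and> square_integrable g \<and> (AE x in torus. f x = g x)"
  have "(\<integral>x. f x * cis (- phase k x) \<partial>torus) = (\<integral>x. g x * cis (- phase k x) \<partial>torus)" for k
    using * phase_measurable[of "-1" k]
    by (intro integral_cong_AE borel_measurable_times) (auto dest: sqi_measurable elim: AE_mp)
  then show "?thesis f g" by simp
qed

text \<open>
  The periodic Sobolev space of order 2: the sum of
  \<open>(1 + |k|\<^sup>2)\<^sup>2 |u\<^sub>k|\<^sup>2\<close> over the Fourier coefficients is finite.
\<close>

definition H2 :: "'d::finite L2 set" where
  "H2 = {u. (\<lambda>k. (1 + freq_sq k)\<^sup>2 * (cmod (fourier_coeff u k))\<^sup>2) summable_on UNIV}"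

text \<open>
  The group \<open>exp (-\<i> t \<Delta>)\<close> generated by \<open>-\<i> \<Delta>\<close>: on the side-\<open>2\<pi>\<close>
  torus, \<open>\<Delta>\<close> has the eigenvalue \<open>-|k|\<^sup>2\<close> at the Fourier mode \<open>k\<close>, so the multiplier
  is \<open>exp (\<i> t |k|\<^sup>2)\<close>. The sum converges unconditionally in \<open>L\<^sup>2\<close>.
\<close>

definition schroedinger_group :: "real \<Rightarrow> 'd::finite L2 \<Rightarrow> 'd L2" where
  "schroedinger_group t u = (\<Sum>\<^sub>\<infinity>k. (cis (t * freq_sq k) * fourier_coeff u k) *\<^sub>C fourier_mode k)"

text \<open>
  Orthonormality is with respect to the real inner product, so a complex orthonormal basis
  \<open>f\<close> corresponds to the basis consisting of all \<open>f\<^sub>j\<close> and \<open>\<i> f\<^sub>j\<close>. Operators are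
  real-linear, which includes the complex-linear ones.
\<close>

definition orthonormal_basis :: "(nat \<Rightarrow> 'h::real_inner) \<Rightarrow> bool" where
  "orthonormal_basis e \<longleftrightarrow>
     (\<forall>i j. e i \<bullet> e j = (if i = j then 1 else 0)) \<and> closure (span (range e)) = UNIV"

definition nonneg_selfadjoint :: "('h::real_inner \<Rightarrow> 'h) \<Rightarrow> bool" where
  "nonneg_selfadjoint Q \<longleftrightarrow>
     bounded_linear Q \<and> (\<forall>u v. Q u \<bullet> v = u \<bullet> Q v) \<and> (\<forall>u. 0 \<le> Q u \<bullet> u)"

text \<open>
  \<open>Q\<^sup>1\<^sup>/\<^sup>2\<close>, the unique nonnegative self-adjoint square root. The trace is
  \<open>Tr Q = \<Sum>\<^sub>j \<parallel>Q\<^sup>1\<^sup>/\<^sup>2 e\<^sub>j\<parallel>\<^sup>2\<close>, which does not depend on the orthonormal basis \<open>e\<close>.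
\<close>

definition sqrt_op :: "('h::real_inner \<Rightarrow> 'h) \<Rightarrow> 'h \<Rightarrow> 'h" where
  "sqrt_op Q = (THE R. nonneg_selfadjoint R \<and> R \<circ> R = Q)"

definition trace_class :: "(nat \<Rightarrow> 'h::real_inner) \<Rightarrow> ('h \<Rightarrow> 'h) \<Rightarrow> bool" where
  "trace_class e Q \<longleftrightarrow> summable (\<lambda>j. (norm (sqrt_op Q (e j)))\<^sup>2)"

definition trace_op :: "(nat \<Rightarrow> 'h::real_inner) \<Rightarrow> ('h \<Rightarrow> 'h) \<Rightarrow> real" where
  "trace_op e Q = (\<Sum>j. (norm (sqrt_op Q (e j)))\<^sup>2)"

text \<open>
  Only the times \<open>t \<ge> 0\<close> are relevant here and below.
\<close>

definition normal_filtration :: "'a measure \<Rightarrow> (real \<Rightarrow> 'a measure) \<Rightarrow> bool" where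
  "normal_filtration M F \<longleftrightarrow>
     (\<forall>t\<ge>0. subalgebra M (F t)) \<and>
     (\<forall>s t. 0 \<le> s \<and> s \<le> t \<longrightarrow> sets (F s) \<subseteq> sets (F t)) \<and>
     null_sets M \<subseteq> sets (F 0) \<and>
     (\<forall>t\<ge>0. (\<Inter>s\<in>{t<..}. sets (F s)) = sets (F t))"

text \<open>
  \<open>normal_density\<close> takes the standard deviation, so increments over \<open>[s, t]\<close> have variance
  \<open>t - s\<close>.
\<close>

definition standard_brownian_motion :: "'a measure \<Rightarrow> (real \<Rightarrow> 'a \<Rightarrow> real) \<Rightarrow> bool" where
  "standard_brownian_motion M b \<longleftrightarrow>
     (\<forall>t\<ge>0. b t \<in> borel_measurable M) \<and>
     (AE \<omega> in M. b 0 \<omega> = 0) \<and>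
     (AE \<omega> in M. continuous_on {0..} (\<lambda>t. b t \<omega>)) \<and>
     (\<forall>s t. 0 \<le> s \<and> s < t \<longrightarrow>
        distributed M lborel (\<lambda>\<omega>. b t \<omega> - b s \<omega>) (normal_density 0 (sqrt (t - s)))) \<and>
     (\<forall>n \<tau>. 0 \<le> \<tau> 0 \<and> (\<forall>i<n. \<tau> i \<le> \<tau> (Suc i)) \<longrightarrow>
        prob_space.indep_vars M (\<lambda>_. borel) (\<lambda>i \<omega>. b (\<tau> (Suc i)) \<omega> - b (\<tau> i) \<omega>) {..<n})"

text \<open>
  Independence of the processes as random elements of the path space \<open>\<real>\<close> to the power
  \<open>[0, \<infinity>)\<close> with the product sigma-algebra.
\<close>

definition independent_processes :: "'a measure \<Rightarrow> (nat \<Rightarrow> real \<Rightarrow> 'a \<Rightarrow> real) \<Rightarrow> bool" where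
  "independent_processes M \<beta> \<longleftrightarrow>
     prob_space.indep_vars M (\<lambda>_. PiM {0..} (\<lambda>_. borel)) (\<lambda>j \<omega>. \<lambda>t\<in>{0..}. \<beta> j t \<omega>) UNIV"

text \<open>
  A \<open>Q\<close>-Wiener process with respect to the filtration \<open>F\<close>:
  \<open>W(t) = \<Sum>\<^sub>j \<beta>\<^sub>j(t) Q\<^sup>1\<^sup>/\<^sup>2 e\<^sub>j\<close> with convergence in \<open>L\<^sup>2(\<Omega>; H)\<close>, continuous
  paths, adapted, and with increments after time \<open>s\<close> independent of \<open>F s\<close>.
  Mean square quantities are \<open>nn_integral\<close>s, so that non-integrable functions are not assigned
  the value \<open>0\<close>.
\<close>

definition Q_wiener_process ::
  "'a measure \<Rightarrow> (real \<Rightarrow> 'a measure) \<Rightarrow> ('h::{real_inner, second_countable_topology} \<Rightarrow> 'h) \<Rightarrow>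
   (nat \<Rightarrow> 'h) \<Rightarrow> (nat \<Rightarrow> real \<Rightarrow> 'a \<Rightarrow> real) \<Rightarrow> (real \<Rightarrow> 'a \<Rightarrow> 'h) \<Rightarrow> bool" where
  "Q_wiener_process M F Q e \<beta> W \<longleftrightarrow>
     (\<forall>j. standard_brownian_motion M (\<beta> j)) \<and> independent_processes M \<beta> \<and>
     (\<forall>t\<ge>0. (\<lambda>n. \<integral>\<^sup>+\<omega>. ennreal ((norm (W t \<omega> - (\<Sum>j<n. \<beta> j t \<omega> *\<^sub>R sqrt_op Q (e j))))\<^sup>2) \<partial>M)
        \<longlonglongrightarrow> 0) \<and>
     (AE \<omega> in M. continuous_on {0..} (\<lambda>t. W t \<omega>)) \<and>
     (\<forall>t\<ge>0. W t \<in> borel_measurable (F t)) \<and>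
     (\<forall>s t. 0 \<le> s \<and> s \<le> t \<longrightarrow>
        prob_space.indep_set M (sets (F s))
          {(\<lambda>\<omega>. W t \<omega> - W s \<omega>) -` B \<inter> space M |B. B \<in> sets borel})"

text \<open>
  The integral \<open>\<integral>\<^sub>0\<^sup>t \<Phi>(r) dW(r)\<close> of a deterministic operator-valued integrand. For a step
  function \<open>\<Phi> = \<Sum>\<^sub>i 1\<^bsub>(\<tau>\<^sub>i, \<tau>\<^sub>i\<^sub>+\<^sub>1]\<^esub> A\<^sub>i\<close> it is
  \<open>\<Sum>\<^sub>i A\<^sub>i (W(\<tau>\<^sub>i\<^sub>+\<^sub>1) - W(\<tau>\<^sub>i))\<close>; in general it is the limit in \<open>L\<^sup>2(\<Omega>; H)\<close> along
  step functions \<open>\<Phi>\<^sub>m\<close> with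
  \<open>\<integral>\<^sub>0\<^sup>t \<parallel>(\<Phi>(r) - \<Phi>\<^sub>m(r)) Q\<^sup>1\<^sup>/\<^sup>2\<parallel>\<^sub>H\<^sub>S\<^sup>2 dr \<longlonglongrightarrow> 0\<close> in the Hilbert-Schmidt norm, as in
  the construction of the Ito integral.
\<close>

definition elementary_integrand ::
  "nat \<Rightarrow> (nat \<Rightarrow> real) \<Rightarrow> (nat \<Rightarrow> 'h \<Rightarrow> 'h) \<Rightarrow> real \<Rightarrow> 'h \<Rightarrow> 'h::real_vector" where
  "elementary_integrand n \<tau> A r x = (\<Sum>i<n. indicator {\<tau> i<..\<tau> (Suc i)} r *\<^sub>R A i x)"

definition elementary_integral ::
  "nat \<Rightarrow> (nat \<Rightarrow> real) \<Rightarrow> (nat \<Rightarrow> 'h \<Rightarrow> 'h) \<Rightarrow> (real \<Rightarrow> 'a \<Rightarrow> 'h) \<Rightarrow> 'a \<Rightarrow> 'h::real_vector" where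
  "elementary_integral n \<tau> A W \<omega> = (\<Sum>i<n. A i (W (\<tau> (Suc i)) \<omega> - W (\<tau> i) \<omega>))"

definition has_stochastic_integral ::
  "'a measure \<Rightarrow> ('h::{real_inner, second_countable_topology} \<Rightarrow> 'h) \<Rightarrow> (nat \<Rightarrow> 'h) \<Rightarrow>
   (real \<Rightarrow> 'a \<Rightarrow> 'h) \<Rightarrow> real \<Rightarrow> (real \<Rightarrow> 'h \<Rightarrow> 'h) \<Rightarrow> ('a \<Rightarrow> 'h) \<Rightarrow> bool" where
  "has_stochastic_integral M Q e W t \<Phi> X \<longleftrightarrow>
     X \<in> borel_measurable M \<and>
     (\<exists>n \<tau> A.
        (\<forall>m. \<tau> m 0 = 0 \<and> \<tau> m (n m) = t \<and> (\<forall>i<n m. \<tau> m i \<le> \<tau> m (Suc i)) \<and>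
             (\<forall>i<n m. bounded_linear (A m i))) \<and>
        (\<lambda>m. \<integral>\<^sup>+r\<in>{0..t}. (\<Sum>j. ennreal ((norm (\<Phi> r (sqrt_op Q (e j)) -
             elementary_integrand (n m) (\<tau> m) (A m) r (sqrt_op Q (e j))))\<^sup>2)) \<partial>lborel) \<longlonglongrightarrow> 0 \<and>
        (\<lambda>m. \<integral>\<^sup>+\<omega>. ennreal ((norm (X \<omega> -
             elementary_integral (n m) (\<tau> m) (A m) W \<omega>))\<^sup>2) \<partial>M) \<longlonglongrightarrow> 0)"

text \<open>
  Adaptedness together with joint measurability covers in particular predictable processes.
  The mild equation is required at each time almost surely. The potential term is a Bochner
  integral in \<open>L\<^sup>2\<close>.
\<close>

definition mild_solution ::
  "'a measure \<Rightarrow> (real \<Rightarrow> 'a measure) \<Rightarrow> ('d::finite L2 \<Rightarrow> 'd L2) \<Rightarrow> (nat \<Rightarrow> 'd L2) \<Rightarrow>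
   (real \<Rightarrow> 'a \<Rightarrow> 'd L2) \<Rightarrow> 'd L2 \<Rightarrow> ('a \<Rightarrow> 'd L2) \<Rightarrow> (real \<Rightarrow> 'a \<Rightarrow> 'd L2) \<Rightarrow> bool" where
  "mild_solution M F Q e W V u\<^sub>0 u \<longleftrightarrow>
     (\<forall>t\<ge>0. u t \<in> borel_measurable (F t)) \<and>
     (\<lambda>(t, \<omega>). u t \<omega>) \<in> borel_measurable (restrict_space borel {0..} \<Otimes>\<^sub>M M) \<and>
     (AE \<omega> in M. \<forall>t\<ge>0. set_integrable lborel {0..t} (\<lambda>r. u r \<omega>)) \<and>
     (\<forall>t\<ge>0. \<exists>X. has_stochastic_integral M Q e W t (\<lambda>r. schroedinger_group (t - r)) X \<and>
        (AE \<omega> in M. u t \<omega> = schroedinger_group t (u\<^sub>0 \<omega>)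
           - \<i> *\<^sub>C (LINT r:{0..t}|lborel. schroedinger_group (t - r) (mult_L2 V (u r \<omega>)))
           - \<i> *\<^sub>C X \<omega>))"

end

theory Submission
  imports Defs
begin

text \<open>
  In place of the Ito formula, the energy balance is obtained from the increments of
  \<open>\<phi>(t) = E \<parallel>u(t)\<parallel>\<^sup>2\<close>. With \<open>h = t - s\<close>, the mild equation reads
  \<open>u(t) = S(h) u(s) + P + Z\<close>, where \<open>P\<close> is the contribution of the potential and \<open>Z\<close> the stochastic
  convolution, both over \<open>(s, t]\<close>. Here \<open>E \<parallel>Z\<parallel>\<^sup>2 = h Tr Q\<close> by the Ito isometry, \<open>Z\<close> is orthogonal
  to \<open>S(h) u(s)\<close> by independence, and \<open>P = O(h)\<close>. The operator \<open>-\<i> V\<close> is bounded, by the Sobolev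
  embedding in dimension at most three, and skew, so the cross term of \<open>S(h) u(s)\<close> and \<open>P\<close> is only
  \<open>O(h\<^sup>3\<^sup>/\<^sup>2)\<close>. Hence \<open>\<phi>(t) - t Tr Q\<close> has increments \<open>O(h\<^sup>3\<^sup>/\<^sup>2)\<close> and is constant.
\<close>

section \<open>Mean square calculus\<close>

text \<open>An Ito formula for |u|^2 would meet the unbounded operator -i \<Delta>, which does not
  act on every u(t) in L^2. In the mild form only the isometries S(t) occur, and they drop out of
  all norms. Plain Cauchy-Schwarz bounds the cross term of S(h) u(s) and P only by O(h), while
  constancy needs an error per step with an exponent above 1. Skewness replaces u(r), for r in (s,
  t], by its deviation from S(r - s) u(s), which the noise makes of size O(h^(1/2)); integrating
  over (s, t] gives 3/2. P contains the solution after time s, so it is correlated with Z; their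
  cross term has the same order because P = O(h) and Z = O(h^(1/2)). These orders presuppose second
  moments that are bounded on [0, T], whereas a mild solution is only assumed to have integrable
  paths; that bound has to be proved first. The stochastic integrals at s and at t come with
  unrelated approximating step functions. They are compared through their kernels, as elements of
  L^2 over time and modes, where the group law cancels everything before s.\<close>

definition second_moment :: "'a measure \<Rightarrow> ('a \<Rightarrow> 'h::{real_inner, second_countable_topology}) \<Rightarrow> bool" where
  "second_moment M X \<longleftrightarrow> X \<in> borel_measurable M \<and> integrable M (\<lambda>w. (norm (X w))\<^sup>2)"

lemma second_moment_measurable [measurable_dest]: "second_moment M X \<Longrightarrow> X \<in> borel_measurable M"
  by (simp add: second_moment_def)

lemma second_moment_integrable: "second_moment M X \<Longrightarrow> integrable M (\<lambda>w. (norm (X w))\<^sup>2)"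
  by (simp add: second_moment_def)

lemma norm_add_square_le:
  fixes x y :: "'h::real_inner"
  shows "(norm (x + y))\<^sup>2 \<le> 2 * (norm x)\<^sup>2 + 2 * (norm y)\<^sup>2"
proof -
  have "(norm (x + y))\<^sup>2 + (norm (x - y))\<^sup>2 = 2 * (norm x)\<^sup>2 + 2 * (norm y)\<^sup>2"
    by (simp add: power2_norm_eq_inner algebra_simps inner_commute)
  then show ?thesis using zero_le_power2[of "norm (x - y)"] by linarith
qed

text \<open>Young's inequality with a free weight. Taking the square root of the time step for
  \<open>\<delta>\<close> is what balances the mixed terms in
  \<open>energy_increment\<close>.\<close>

lemma inner_le_weighted:
  fixes x y :: "'h::real_inner"
  assumes "0 < \<delta>"
  shows "2 * \<bar>x \<bullet> y\<bar> \<le> \<delta> * (norm x)\<^sup>2 + (norm y)\<^sup>2 / \<delta>"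
proof -
  have "0 \<le> (\<delta> * norm x - norm y)\<^sup>2" by simp
  then have "2 * \<delta> * (norm x * norm y) \<le> \<delta>\<^sup>2 * (norm x)\<^sup>2 + (norm y)\<^sup>2"
    by (simp add: power2_diff power_mult_distrib algebra_simps)
  then have "2 * (norm x * norm y) \<le> \<delta> * (norm x)\<^sup>2 + (norm y)\<^sup>2 / \<delta>"
    using assms by (simp add: field_simps power2_eq_square)
  then show ?thesis using Cauchy_Schwarz_ineq2[of x y] by linarith
qed

text \<open>Integrated, this takes the place of the Minkowski inequality: second moments differ by a
  multiple of the mean square distance plus an arbitrarily small share of one of them.\<close>

lemma norm_square_perturb:
  fixes x y :: "'h::real_inner"
  assumes "0 < \<delta>"
  shows "\<bar>(norm y)\<^sup>2 - (norm x)\<^sup>2\<bar> \<le> (1 + 1 / \<delta>) * (norm (x - y))\<^sup>2 + \<delta> * (norm x)\<^sup>2"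
proof -
  have "(norm y)\<^sup>2 - (norm x)\<^sup>2 = (norm (x - y))\<^sup>2 - 2 * (x \<bullet> (x - y))"
    by (simp add: power2_norm_eq_inner algebra_simps inner_commute)
  moreover have "2 * \<bar>x \<bullet> (x - y)\<bar> \<le> \<delta> * (norm x)\<^sup>2 + (norm (x - y))\<^sup>2 / \<delta>"
    by (rule inner_le_weighted[OF assms])
  moreover have "(1 + 1 / \<delta>) * (norm (x - y))\<^sup>2 = (norm (x - y))\<^sup>2 + (norm (x - y))\<^sup>2 / \<delta>"
    by (simp add: algebra_simps)
  ultimately show ?thesis using zero_le_power2[of "norm (x - y)"] by linarith
qed

lemma second_moment_bound:
  assumes "X \<in> borel_measurable M" "integrable M g" "\<And>w. w \<in> space M \<Longrightarrow> (norm (X w))\<^sup>2 \<le> g w"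
  shows "second_moment M X"
  unfolding second_moment_def using assms
  by (auto intro!: Bochner_Integration.integrable_bound[OF assms(2)]) fastforce

lemma second_moment_add:
  assumes "second_moment M X" "second_moment M Y"
  shows "second_moment M (\<lambda>w. X w + Y w)"
  using assms
  by (intro second_moment_bound[where g="\<lambda>w. 2 * (norm (X w))\<^sup>2 + 2 * (norm (Y w))\<^sup>2"])
     (auto simp: second_moment_def norm_add_square_le)

lemma second_moment_zero [simp]: "second_moment M (\<lambda>w. 0)"
  by (simp add: second_moment_def)

lemma second_moment_linear:
  assumes "bounded_linear A" "second_moment M X"
  shows "second_moment M (\<lambda>w. A (X w))"
proof -
  obtain K where K: "\<And>x. norm (A x) \<le> norm x * K"
    using bounded_linear.bounded[OF assms(1)] by blast
  have [measurable]: "A \<in> borel_measurable borel"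
    using assms(1) by (intro borel_measurable_continuous_onI linear_continuous_on)
  have [measurable]: "X \<in> borel_measurable M" using assms(2) by (rule second_moment_measurable)
  show ?thesis
  proof (rule second_moment_bound)
    show "(\<lambda>w. A (X w)) \<in> borel_measurable M" by measurable
    show "integrable M (\<lambda>w. (norm (X w))\<^sup>2 * K\<^sup>2)" using assms(2) by (simp add: second_moment_def)
    show "(norm (A (X w)))\<^sup>2 \<le> (norm (X w))\<^sup>2 * K\<^sup>2" for w
      using power_mono[OF K norm_ge_zero, of "X w" 2] by (simp add: power_mult_distrib)
  qed
qed

lemma second_moment_scaleR: "second_moment M X \<Longrightarrow> second_moment M (\<lambda>w. c *\<^sub>R X w)"
  by (intro second_moment_linear[of "\<lambda>x. c *\<^sub>R x"] bounded_linear_scaleR_right)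

lemma second_moment_uminus: "second_moment M X \<Longrightarrow> second_moment M (\<lambda>w. - X w)"
  using second_moment_scaleR[of M X "-1"] by simp

lemma second_moment_diff:
  "second_moment M X \<Longrightarrow> second_moment M Y \<Longrightarrow> second_moment M (\<lambda>w. X w - Y w)"
  using second_moment_add[of M X "\<lambda>w. - Y w"] second_moment_uminus[of M Y] by simp

lemma second_moment_sum:
  "(\<And>i. i \<in> I \<Longrightarrow> second_moment M (X i)) \<Longrightarrow> second_moment M (\<lambda>w. \<Sum>i\<in>I. X i w)"
  by (induction I rule: infinite_finite_induct) (auto intro: second_moment_add)

lemma second_moment_inner_integrable:
  assumes "second_moment M X" "second_moment M Y"
  shows "integrable M (\<lambda>w. X w \<bullet> Y w)"
proof (rule Bochner_Integration.integrable_bound)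
  show "integrable M (\<lambda>w. (norm (X w))\<^sup>2 + (norm (Y w))\<^sup>2)"
    using assms by (simp add: second_moment_def)
  show "(\<lambda>w. X w \<bullet> Y w) \<in> borel_measurable M"
    using assms[THEN second_moment_measurable] by measurable
  have "\<bar>x \<bullet> y\<bar> \<le> (norm x)\<^sup>2 + (norm y)\<^sup>2" for x y :: 'b
    using inner_le_weighted[of 1 x y] by (simp; smt (verit) zero_le_power2)
  then show "AE w in M. norm (X w \<bullet> Y w) \<le> norm ((norm (X w))\<^sup>2 + (norm (Y w))\<^sup>2)" by simp
qed

section \<open>Convergence in mean square\<close>

abbreviation mean_square :: "'a measure \<Rightarrow> ('a \<Rightarrow> 'h::real_inner) \<Rightarrow> real" where
  "mean_square M X \<equiv> (\<integral>w. (norm (X w))\<^sup>2 \<partial>M)"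

abbreviation nn_mean_square :: "'a measure \<Rightarrow> ('a \<Rightarrow> 'h::real_inner) \<Rightarrow> ennreal" where
  "nn_mean_square M X \<equiv> (\<integral>\<^sup>+w. ennreal ((norm (X w))\<^sup>2) \<partial>M)"

text \<open>Convergence in L^2(M; H). Square integrability is built in because the Bochner integral
  of a non-integrable square is 0 and would feign convergence. The measure is arbitrary: it is the
  probability in one use and \<open>time_modes\<close> in the other.\<close>

definition ms_tendsto :: "'a measure \<Rightarrow> (nat \<Rightarrow> 'a \<Rightarrow> 'h::{real_inner, second_countable_topology}) \<Rightarrow> ('a \<Rightarrow> 'h) \<Rightarrow> bool" where
  "ms_tendsto M X Y \<longleftrightarrow> (\<forall>n. second_moment M (X n)) \<and> second_moment M Y \<and>
     (\<lambda>n. \<integral>w. (norm (Y w - X n w))\<^sup>2 \<partial>M) \<longlonglongrightarrow> 0"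

text \<open>An \<open>nn_integral\<close> does not hide infinite values, so some
  \<open>Y - X n\<close> has a finite second moment, and then so has its sum with
  \<open>X n\<close>.\<close>

lemma ms_tendstoI:
  assumes X: "\<And>n. second_moment M (X n)" and Y: "Y \<in> borel_measurable M"
    and lim: "(\<lambda>n. \<integral>\<^sup>+w. ennreal ((norm (Y w - X n w))\<^sup>2) \<partial>M) \<longlonglongrightarrow> 0"
  shows "ms_tendsto M X Y"
proof -
  have [measurable]: "X n \<in> borel_measurable M" for n using X by (rule second_moment_measurable)
  note Y[measurable]
  have "eventually (\<lambda>n. (\<integral>\<^sup>+w. ennreal ((norm (Y w - X n w))\<^sup>2) \<partial>M) < 1) sequentially"
    using lim by (rule order_tendstoD) simp
  then obtain n where n: "(\<integral>\<^sup>+w. ennreal ((norm (Y w - X n w))\<^sup>2) \<partial>M) < 1"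
    by (auto simp: eventually_sequentially)
  have "second_moment M (\<lambda>w. Y w - X n w)"
    unfolding second_moment_def using n
    by (auto intro!: integrableI_bounded dest: order.strict_trans[OF _ ennreal_one_less_top])
  from second_moment_add[OF this X[of n]] have Y2: "second_moment M Y" by simp
  have "(\<integral>\<^sup>+w. ennreal ((norm (Y w - X n w))\<^sup>2) \<partial>M) = ennreal (\<integral>w. (norm (Y w - X n w))\<^sup>2 \<partial>M)" for n
    using second_moment_integrable[OF second_moment_diff[OF Y2 X]]
    by (intro nn_integral_eq_integral) auto
  with lim have "(\<lambda>n. ennreal (\<integral>w. (norm (Y w - X n w))\<^sup>2 \<partial>M)) \<longlonglongrightarrow> ennreal 0" by simp
  then have "(\<lambda>n. \<integral>w. (norm (Y w - X n w))\<^sup>2 \<partial>M) \<longlonglongrightarrow> 0"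
    by (subst (asm) tendsto_ennreal_iff) auto
  with X Y2 show ?thesis by (simp add: ms_tendsto_def)
qed

lemma ms_tendsto_const: "second_moment M Y \<Longrightarrow> ms_tendsto M (\<lambda>_. Y) Y"
  by (simp add: ms_tendsto_def)

lemma ms_tendsto_linear:
  assumes A: "bounded_linear A" and X: "ms_tendsto M X Y"
  shows "ms_tendsto M (\<lambda>n w. A (X n w)) (\<lambda>w. A (Y w))"
proof -
  obtain K where K: "\<And>x. norm (A x) \<le> norm x * K"
    using bounded_linear.bounded[OF A] by blast
  let ?c = "\<lambda>n. (\<integral>w. (norm (Y w - X n w))\<^sup>2 \<partial>M)"
    and ?f = "\<lambda>n. (\<integral>w. (norm (A (Y w) - A (X n w)))\<^sup>2 \<partial>M)"
  have 1: "second_moment M (\<lambda>w. Y w - X n w)" for n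
    using X by (auto simp: ms_tendsto_def intro: second_moment_diff)
  have 2: "second_moment M (\<lambda>w. A (X n w))" "second_moment M (\<lambda>w. A (Y w))" for n
    using X by (auto simp: ms_tendsto_def intro: second_moment_linear A)
  have "(\<lambda>n. \<integral>w. (norm (A (Y w) - A (X n w)))\<^sup>2 \<partial>M) \<longlonglongrightarrow> 0"
  proof (rule tendsto_sandwich)
    show "\<forall>\<^sub>F n in sequentially. 0 \<le> ?f n" by simp
    show "\<forall>\<^sub>F n in sequentially. ?f n \<le> ?c n * K\<^sup>2"
    proof (rule always_eventually, rule allI)
      fix n
      have "?f n \<le> (\<integral>w. (norm (Y w - X n w))\<^sup>2 * K\<^sup>2 \<partial>M)"
      proof (rule integral_mono)
        show "integrable M (\<lambda>w. (norm (A (Y w) - A (X n w)))\<^sup>2)"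
          using 2 by (intro second_moment_integrable second_moment_diff)
        show "integrable M (\<lambda>w. (norm (Y w - X n w))\<^sup>2 * K\<^sup>2)"
          using second_moment_integrable[OF 1] by simp
        show "(norm (A (Y w) - A (X n w)))\<^sup>2 \<le> (norm (Y w - X n w))\<^sup>2 * K\<^sup>2" for w
          using power_mono[OF K norm_ge_zero, of "Y w - X n w" 2]
          by (simp add: power_mult_distrib linear_diff[OF bounded_linear.linear[OF A]])
      qed
      then show "?f n \<le> ?c n * K\<^sup>2"
        by simp
    qed
    show "(\<lambda>n. ?c n * K\<^sup>2) \<longlonglongrightarrow> 0"
      using X by (intro tendsto_mult_left_zero) (simp add: ms_tendsto_def)
  qed simp
  with 2 show ?thesis by (simp add: ms_tendsto_def)
qed

lemma ms_tendsto_add: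
  assumes X: "ms_tendsto M X Y" and X': "ms_tendsto M X' Y'"
  shows "ms_tendsto M (\<lambda>n w. X n w + X' n w) (\<lambda>w. Y w + Y' w)"
proof -
  have 1: "second_moment M (\<lambda>w. X n w + X' n w)" "second_moment M (\<lambda>w. Y w + Y' w)"
    "second_moment M (\<lambda>w. Y w - X n w)" "second_moment M (\<lambda>w. Y' w - X' n w)"for n
    using X X' by (auto simp: ms_tendsto_def intro: second_moment_add second_moment_diff)
  let ?D = "\<lambda>n w. (Y w + Y' w) - (X n w + X' n w)"
  let ?d = "\<lambda>n. \<integral>w. (norm (Y w - X n w))\<^sup>2 \<partial>M" and ?d' = "\<lambda>n. \<integral>w. (norm (Y' w - X' n w))\<^sup>2 \<partial>M"
  have "(\<lambda>n. \<integral>w. (norm (?D n w))\<^sup>2 \<partial>M) \<longlonglongrightarrow> 0"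
  proof (rule tendsto_sandwich[OF always_eventually always_eventually tendsto_const])
    show "\<forall>n. 0 \<le> (\<integral>w. (norm (?D n w))\<^sup>2 \<partial>M)" by simp
    show "\<forall>n. (\<integral>w. (norm (?D n w))\<^sup>2 \<partial>M) \<le> 2 * ?d n + 2 * ?d' n"
    proof
      fix n
      have "(\<integral>w. (norm (?D n w))\<^sup>2 \<partial>M)
          \<le> (\<integral>w. 2 * (norm (Y w - X n w))\<^sup>2 + 2 * (norm (Y' w - X' n w))\<^sup>2 \<partial>M)"
      proof (rule integral_mono)
        show "integrable M (\<lambda>w. (norm (?D n w))\<^sup>2)"
          by (intro second_moment_integrable second_moment_diff 1)
        show "integrable M (\<lambda>w. 2 * (norm (Y w - X n w))\<^sup>2 + 2 * (norm (Y' w - X' n w))\<^sup>2)"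
          using 1(3,4)[THEN second_moment_integrable, of n] by simp
        show "(norm (?D n w))\<^sup>2
            \<le> 2 * (norm (Y w - X n w))\<^sup>2 + 2 * (norm (Y' w - X' n w))\<^sup>2" for w
          using norm_add_square_le[of "Y w - X n w" "Y' w - X' n w"] by (simp add: algebra_simps)
      qed
      also have "\<dots> = 2 * ?d n + 2 * ?d' n"
        using 1(3,4)[THEN second_moment_integrable, of n] by simp
      finally show "(\<integral>w. (norm (?D n w))\<^sup>2 \<partial>M) \<le> 2 * ?d n + 2 * ?d' n" .
    qed
    have "(\<lambda>n. 2 * ?d n + 2 * ?d' n) \<longlonglongrightarrow> 2 * 0 + 2 * 0"
      using X X' by (intro tendsto_intros) (auto simp: ms_tendsto_def)
    then show "(\<lambda>n. 2 * ?d n + 2 * ?d' n) \<longlonglongrightarrow> 0" by simp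
  qed
  with 1 show ?thesis by (simp add: ms_tendsto_def)
qed

lemma ms_tendsto_uminus: "ms_tendsto M X Y \<Longrightarrow> ms_tendsto M (\<lambda>n w. - X n w) (\<lambda>w. - Y w)"
  using ms_tendsto_linear[OF bounded_linear_minus[OF bounded_linear_ident], of M X Y] by simp

lemma ms_tendsto_diff:
  "ms_tendsto M X Y \<Longrightarrow> ms_tendsto M X' Y' \<Longrightarrow> ms_tendsto M (\<lambda>n w. X n w - X' n w) (\<lambda>w. Y w - Y' w)"
  using ms_tendsto_add[of M X Y "\<lambda>n w. - X' n w" "\<lambda>w. - Y' w"] ms_tendsto_uminus[of M X' Y'] by simp

lemma ms_tendsto_norm:
  assumes X: "ms_tendsto M X Y"
  shows "(\<lambda>n. \<integral>w. (norm (X n w))\<^sup>2 \<partial>M) \<longlonglongrightarrow> (mean_square M Y)"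
proof -
  define b where "b = (mean_square M Y)"
  define a where "a n = (mean_square M (X n))" for n
  define d where "d n = (\<integral>w. (norm (Y w - X n w))\<^sup>2 \<partial>M)" for n
  have b: "b \<ge> 0" by (simp add: b_def)
  have d: "d \<longlonglongrightarrow> 0" using X by (simp add: ms_tendsto_def d_def[abs_def])
  have i: "integrable M (\<lambda>w. (norm (X n w))\<^sup>2)" "integrable M (\<lambda>w. (norm (Y w))\<^sup>2)"
    "integrable M (\<lambda>w. (norm (Y w - X n w))\<^sup>2)" for n
    using X by (auto simp: ms_tendsto_def intro!: second_moment_integrable second_moment_diff)
  have le: "\<bar>a n - b\<bar> \<le> (1 + 1 / \<delta>) * d n + \<delta> * b" if "0 < \<delta>" for n \<delta>
  proof -
    have "\<bar>a n - b\<bar> = \<bar>\<integral>w. (norm (X n w))\<^sup>2 - (norm (Y w))\<^sup>2 \<partial>M\<bar>"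
      unfolding a_def b_def using i by simp
    also have "\<dots> \<le> (\<integral>w. \<bar>(norm (X n w))\<^sup>2 - (norm (Y w))\<^sup>2\<bar> \<partial>M)"
      by (rule integral_abs_bound)
    also have "\<dots> \<le> (\<integral>w. (1 + 1 / \<delta>) * (norm (Y w - X n w))\<^sup>2 + \<delta> * (norm (Y w))\<^sup>2 \<partial>M)"
      using i by (intro integral_mono norm_square_perturb that) (simp_all del: distrib_right_numeral)
    also have "\<dots> = (1 + 1 / \<delta>) * d n + \<delta> * b"
      unfolding d_def b_def using i by (subst Bochner_Integration.integral_add) auto
    finally show ?thesis .
  qed
  have "a \<longlonglongrightarrow> b"
  proof (rule LIMSEQ_I)
    fix e :: real assume e: "0 < e"
    \<comment> \<open>\<open>b + 1\<close> in place of \<open>b\<close> covers the case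
      \<open>b = 0\<close>.\<close>
    define \<delta> where "\<delta> = e / (2 * (b + 1))"
    have \<delta>: "\<delta> > 0" using e b by (simp add: \<delta>_def)
    have "\<delta> * b = e / 2 * (b / (b + 1))" by (simp add: \<delta>_def)
    also have "\<dots> \<le> e / 2 * 1" using e b by (intro mult_left_mono) (auto simp: field_simps)
    finally have \<delta>b: "\<delta> * b \<le> e / 2" by simp
    have "(\<lambda>n. (1 + 1 / \<delta>) * d n) \<longlonglongrightarrow> (1 + 1 / \<delta>) * 0" by (intro tendsto_intros d)
    then have "eventually (\<lambda>n. (1 + 1 / \<delta>) * d n < e / 2) sequentially"
      using e by (intro order_tendstoD(2)[of _ 0]) auto
    then obtain N where N: "\<And>n. n \<ge> N \<Longrightarrow> (1 + 1 / \<delta>) * d n < e / 2"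
      by (auto simp: eventually_sequentially)
    have "norm (a n - b) < e" if "n \<ge> N" for n
      using le[OF \<delta>, of n] N[OF that] \<delta>b unfolding real_norm_def by linarith
    then show "\<exists>no. \<forall>n\<ge>no. norm (a n - b) < e" by blast
  qed
  then show ?thesis by (simp add: a_def[abs_def] b_def)
qed

text \<open>Polarization reduces the claim to second moments of sums and differences.\<close>

lemma ms_tendsto_inner:
  assumes X: "ms_tendsto M X Y" and X': "ms_tendsto M X' Y'"
  shows "(\<lambda>n. \<integral>w. X n w \<bullet> X' n w \<partial>M) \<longlonglongrightarrow> (\<integral>w. Y w \<bullet> Y' w \<partial>M)"
proof -
  have polar: "(\<integral>w. Z w \<bullet> Z' w \<partial>M) =
      ((\<integral>w. (norm (Z w + Z' w))\<^sup>2 \<partial>M) - (\<integral>w. (norm (Z w - Z' w))\<^sup>2 \<partial>M)) / 4"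
    if "second_moment M Z" "second_moment M Z'" for Z Z' :: "'a \<Rightarrow> 'b"
  proof -
    have "(\<integral>w. (norm (Z w + Z' w))\<^sup>2 \<partial>M) - (\<integral>w. (norm (Z w - Z' w))\<^sup>2 \<partial>M)
        = (\<integral>w. (norm (Z w + Z' w))\<^sup>2 - (norm (Z w - Z' w))\<^sup>2 \<partial>M)"
      using that by (intro Bochner_Integration.integral_diff[symmetric] second_moment_integrable second_moment_add second_moment_diff)
    also have "\<dots> = (\<integral>w. 4 * (Z w \<bullet> Z' w) \<partial>M)"
      by (intro Bochner_Integration.integral_cong refl)
        (simp add: power2_norm_eq_inner algebra_simps inner_commute)
    finally show ?thesis by simp
  qed
  show ?thesis
    using X X' ms_tendsto_norm[OF ms_tendsto_add[OF X X']] ms_tendsto_norm[OF ms_tendsto_diff[OF X X']]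
    by (subst (1 2) polar) (auto simp: ms_tendsto_def intro!: tendsto_intros)
qed

section \<open>Stochastic integrals of deterministic integrands\<close>

definition wiener_coefficients :: "'a measure \<Rightarrow> (nat \<Rightarrow> real \<Rightarrow> 'a \<Rightarrow> real) \<Rightarrow> bool" where
  "wiener_coefficients M \<beta> \<longleftrightarrow> (\<forall>j. standard_brownian_motion M (\<beta> j)) \<and> independent_processes M \<beta>"

context prob_space
begin

section \<open>Covariances of Brownian increments\<close>

lemma brownian_zero: "standard_brownian_motion M b \<Longrightarrow> AE w in M. b 0 w = 0"
  by (simp add: standard_brownian_motion_def)

lemma brownian_increment:
  assumes b: "standard_brownian_motion M b" and st: "0 \<le> s" "s \<le> t"
  shows "second_moment M (\<lambda>w. b t w - b s w)"
    and "expectation (\<lambda>w. b t w - b s w) = 0"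
    and "expectation (\<lambda>w. (b t w - b s w)\<^sup>2) = t - s"
proof -
  have *: "second_moment M (\<lambda>w. b t w - b s w) \<and> expectation (\<lambda>w. b t w - b s w) = 0 \<and>
      expectation (\<lambda>w. (b t w - b s w)\<^sup>2) = t - s"
  proof (cases "s = t")
    case False
    with st have lt: "s < t" by simp
    then have \<sigma>: "0 < sqrt (t - s)" by simp
    have D: "distributed M lborel (\<lambda>w. b t w - b s w) (normal_density 0 (sqrt (t - s)))"
      using b st lt by (simp add: standard_brownian_motion_def)
    have E: "expectation (\<lambda>w. b t w - b s w) = 0"
      by (rule normal_distributed_expectation[OF \<sigma> D])
    have V: "expectation (\<lambda>w. (b t w - b s w)\<^sup>2) = t - s"
      using normal_distributed_variance[OF \<sigma> D] E lt by simp
    have [measurable]: "b s \<in> borel_measurable M" "b t \<in> borel_measurable M"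
      using b st by (auto simp: standard_brownian_motion_def)
    \<comment> \<open>A non-integrable square would have expectation 0 by convention, against the
      variance \<open>t - s > 0\<close>.\<close>
    have "integrable M (\<lambda>w. (b t w - b s w)\<^sup>2)"
    proof (rule ccontr)
      assume "\<not> ?thesis"
      then have "expectation (\<lambda>w. (b t w - b s w)\<^sup>2) = 0" by (rule not_integrable_integral_eq)
      with V lt show False by simp
    qed
    with E V show ?thesis by (simp add: second_moment_def)
  qed simp
  then show "second_moment M (\<lambda>w. b t w - b s w)"
    "expectation (\<lambda>w. b t w - b s w) = 0"
    "expectation (\<lambda>w. (b t w - b s w)\<^sup>2) = t - s" by auto
qed

text \<open>Twice the product of two increments is a signed sum of four squared increments, each
  with mean equal to the distance of its two times. The absolute values add up to twice the overlap
  length, so the intervals need not be cut at common points.\<close>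

lemma brownian_covariance:
  assumes b: "standard_brownian_motion M b"
    and st: "0 \<le> s" "s \<le> t" and st': "0 \<le> s'" "s' \<le> t'"
  shows "expectation (\<lambda>w. (b t w - b s w) * (b t' w - b s' w)) = measure lborel ({s<..t} \<inter> {s'<..t'})"
proof -
  let ?D = "\<lambda>x y. expectation (\<lambda>w. (b y w - b x w)\<^sup>2)"
  have D: "?D x y = \<bar>y - x\<bar>" "integrable M (\<lambda>w. (b y w - b x w)\<^sup>2)" if "0 \<le> x" "0 \<le> y" for x y
    using brownian_increment[OF b, of x y] brownian_increment[OF b, of y x] that
    by (cases "x \<le> y"; simp add: second_moment_def power2_commute)+
  have "expectation (\<lambda>w. (b t w - b s w) * (b t' w - b s' w)) =
      expectation (\<lambda>w. ((b t' w - b s w)\<^sup>2 + (b t w - b s' w)\<^sup>2 - (b t w - b t' w)\<^sup>2 - (b s w - b s' w)\<^sup>2) / 2)"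
    by (intro Bochner_Integration.integral_cong refl) (simp add: power2_eq_square algebra_simps)
  also have "\<dots> = (\<bar>t' - s\<bar> + \<bar>t - s'\<bar> - \<bar>t - t'\<bar> - \<bar>s - s'\<bar>) / 2"
    using st st' by (simp add: D del: power2_diff)
  finally have eq: "expectation (\<lambda>w. (b t w - b s w) * (b t' w - b s' w)) =
      (\<bar>t' - s\<bar> + \<bar>t - s'\<bar> - \<bar>t - t'\<bar> - \<bar>s - s'\<bar>) / 2" .
  have l: "measure lborel {x<..y} = max 0 (y - x)" for x y :: real
    by (cases "x \<le> y") auto
  have "expectation (\<lambda>w. (b t w - b s w) * (b t' w - b s' w)) =
      (\<bar>t' - s\<bar> + \<bar>t - s'\<bar> - \<bar>t - t'\<bar> - \<bar>s - s'\<bar>) / 2" by (rule eq)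
  also have "\<dots> = max 0 (min t t' - max s s')"
    using st st' by (auto simp: max_def min_def)
  also have "\<dots> = measure lborel ({s<..t} \<inter> {s'<..t'})"
    by (simp only: l Int_greaterThanAtMost)
  finally show ?thesis .
qed

text \<open>Independence is given for whole paths. Increments are measurable functionals of the
  paths, so the two factors are independent, and both have mean 0.\<close>

lemma independent_brownian_covariance:
  assumes W: "wiener_coefficients M \<beta>" and "j \<noteq> k"
    and st: "0 \<le> s" "s \<le> t" and st': "0 \<le> s'" "s' \<le> t'"
  shows "expectation (\<lambda>w. (\<beta> j t w - \<beta> j s w) * (\<beta> k t' w - \<beta> k s' w)) = 0"
proof -
  let ?P = "PiM {0..} (\<lambda>_. borel) :: (real \<Rightarrow> real) measure"
  have b: "standard_brownian_motion M (\<beta> j)" for j using W by (simp add: wiener_coefficients_def)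
  have "indep_vars (\<lambda>_. ?P) (\<lambda>j w. \<lambda>t\<in>{0..}. \<beta> j t w) UNIV"
    using W by (simp add: wiener_coefficients_def independent_processes_def)
  \<comment> \<open>The composition asks for a functional at every index: all indices other than
    \<open>j\<close> get the second one, and only \<open>j\<close> and \<open>k\<close> are kept
    afterwards.\<close>
  then have "indep_vars (\<lambda>_. borel) (\<lambda>i w. (\<lambda>f. if i = j then f t - f s else f t' - f s') (\<lambda>t\<in>{0..}. \<beta> i t w)) UNIV"
  proof (rule indep_vars_compose2)
    fix i
    have [measurable]: "(\<lambda>f. f x) \<in> measurable ?P borel" if "0 \<le> x" for x
      using that by (intro measurable_component_singleton) simp
    show "(\<lambda>f. if i = j then f t - f s else f t' - f s') \<in> measurable ?P borel"
      using st st' by (cases "i = j") auto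
  qed
  moreover have "(\<lambda>i w. (\<lambda>f. if i = j then f t - f s else f t' - f s') (\<lambda>t\<in>{0..}. \<beta> i t w)) =
      (\<lambda>i w. if i = j then \<beta> i t w - \<beta> i s w else \<beta> i t' w - \<beta> i s' w)"
    using st st' by (auto simp: fun_eq_iff)
  ultimately have "indep_vars (\<lambda>_. borel)
      (\<lambda>i w. if i = j then \<beta> i t w - \<beta> i s w else \<beta> i t' w - \<beta> i s' w) UNIV"
    by (simp only:)
  then have "indep_vars (\<lambda>_. borel)
      (\<lambda>i w. if i = j then \<beta> i t w - \<beta> i s w else \<beta> i t' w - \<beta> i s' w) {j, k}"
    by (rule indep_vars_subset) simp
  then have "expectation (\<lambda>w. \<Prod>i\<in>{j, k}. if i = j then \<beta> i t w - \<beta> i s w else \<beta> i t' w - \<beta> i s' w) =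
      (\<Prod>i\<in>{j, k}. expectation (\<lambda>w. if i = j then \<beta> i t w - \<beta> i s w else \<beta> i t' w - \<beta> i s' w))"
  proof (rule indep_vars_lebesgue_integral[rotated])
    have i1: "integrable M (\<lambda>w. \<beta> j y w - \<beta> j x w)" if "0 \<le> x" "x \<le> y" for j x y
    proof (rule Bochner_Integration.integrable_bound)
      show "integrable M (\<lambda>w. 1 + (\<beta> j y w - \<beta> j x w)\<^sup>2)"
        using brownian_increment(1)[OF b that, THEN second_moment_integrable] by simp
      show "(\<lambda>w. \<beta> j y w - \<beta> j x w) \<in> borel_measurable M"
        using brownian_increment(1)[OF b that] by (rule second_moment_measurable)
      have "\<bar>x\<bar> \<le> 1 + x\<^sup>2" for x :: real
        using zero_le_power2[of "\<bar>x\<bar> - 1"] zero_le_power2[of x] by (simp add: power2_diff)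
      then show "AE w in M. norm (\<beta> j y w - \<beta> j x w) \<le> norm (1 + (\<beta> j y w - \<beta> j x w)\<^sup>2)"
        by (auto simp del: power2_diff intro: order_trans[OF _ abs_ge_self])
    qed
    show "integrable M (\<lambda>w. if i = j then \<beta> i t w - \<beta> i s w else \<beta> i t' w - \<beta> i s' w)" for i
      using st st' by (cases "i = j") (auto intro: i1)
  qed simp
  then show ?thesis
    using \<open>j \<noteq> k\<close> brownian_increment(2)[OF b st, of j] by simp
qed

end

text \<open>An operator-valued integrand \<open>\<Phi>\<close> is encoded by the function sending
  \<open>(r, j)\<close> to \<open>\<Phi> r (q j)\<close>. Its mean square over this measure is the
  time integral of the squared Hilbert-Schmidt norm of \<open>\<Phi>\<close> composed with the
  square root of the covariance, so the Ito isometry relates two L^2 spaces of functions.\<close>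

definition time_modes :: "(real \<times> nat) measure" where
  "time_modes = lborel \<Otimes>\<^sub>M count_space UNIV"

lemma sigma_finite_nat: "sigma_finite_measure (count_space (UNIV :: nat set))"
  by (simp add: sigma_finite_measure_count_space_countable)

interpretation time_modes: pair_sigma_finite lborel "count_space (UNIV :: nat set)"
  by (intro pair_sigma_finite.intro sigma_finite_nat sigma_finite_lborel)

lemma borel_measurable_time_modes:
  fixes f :: "real \<times> nat \<Rightarrow> 'b::topological_space"
  assumes "\<And>j. (\<lambda>r. f (r, j)) \<in> borel_measurable borel"
  shows "f \<in> borel_measurable time_modes"
proof -
  have "(\<lambda>x. f (snd x, fst x)) \<in> borel_measurable (count_space UNIV \<Otimes>\<^sub>M borel)"
    using assms by (intro measurable_pair_measure_countable1) auto
  then have "(\<lambda>x. (\<lambda>x. f (snd x, fst x)) (case x of (a, b) \<Rightarrow> (b, a))) \<in> borel_measurable (borel \<Otimes>\<^sub>M count_space UNIV)"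
    by (intro measurable_compose[OF measurable_pair_swap']) auto
  moreover have "measurable time_modes borel = measurable (borel \<Otimes>\<^sub>M count_space UNIV) (borel :: 'b measure)"
    unfolding time_modes_def by (intro measurable_cong_sets sets_pair_measure_cong) auto
  ultimately show ?thesis by (simp add: split_beta')
qed

lemma nn_integral_time_modes:
  assumes f: "\<And>j. (\<lambda>r. f (r, j)) \<in> borel_measurable borel"
  shows "(\<integral>\<^sup>+x. f x \<partial>time_modes) = (\<integral>\<^sup>+r. (\<Sum>j. f (r, j)) \<partial>lborel)"
proof -
  have "f \<in> borel_measurable (lborel \<Otimes>\<^sub>M count_space UNIV)"
    using borel_measurable_time_modes[of f] f by (simp add: time_modes_def)
  from time_modes.M2.nn_integral_fst[OF this] show ?thesis
    by (simp add: time_modes_def nn_integral_count_space_nat)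
qed

lemma second_moment_indicator_modes:
  fixes q :: "nat \<Rightarrow> 'h::{real_inner, second_countable_topology}"
  assumes q: "summable (\<lambda>j. (norm (q j))\<^sup>2)"
  shows "second_moment time_modes (\<lambda>(r, j). indicator {a<..b::real} r *\<^sub>R q j)"
  unfolding second_moment_def
proof
  show m: "(\<lambda>(r, j). indicator {a<..b} r *\<^sub>R q j) \<in> borel_measurable time_modes"
    by (rule borel_measurable_time_modes) (auto intro!: borel_measurable_scaleR borel_measurable_indicator)
  have e: "(\<integral>\<^sup>+x. ennreal (norm ((norm ((\<lambda>(r, j). indicator {a<..b} r *\<^sub>R q j) x))\<^sup>2)) \<partial>time_modes)
      = (\<integral>\<^sup>+r. (\<Sum>j. ennreal ((norm (indicator {a<..b} r *\<^sub>R q j))\<^sup>2)) \<partial>lborel)"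
    by (subst nn_integral_time_modes) auto
  also have "\<dots> = (\<integral>\<^sup>+r. ennreal (\<Sum>j. (norm (q j))\<^sup>2) * indicator {a<..b} r \<partial>lborel)"
    using q by (intro nn_integral_cong) (auto simp: indicator_def suminf_ennreal2)
  also have "\<dots> < \<infinity>"
    by (subst nn_integral_cmult) (cases "a \<le> b"; auto simp: ennreal_mult_less_top)+
  finally show "integrable time_modes (\<lambda>x. (norm ((\<lambda>(r, j). indicator {a<..b} r *\<^sub>R q j) x))\<^sup>2)"
    using m by (intro integrableI_bounded) auto
qed

text \<open>Stated as a limit of partial sums because the other side of the isometry is also
  computed on truncations of the series for \<open>W\<close>; \<open>increment_covariance\<close>
  then compares two limits of one sequence.\<close>

lemma integral_time_modes_indicator:
  fixes p q :: "nat \<Rightarrow> 'h::{real_inner, second_countable_topology}"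
  assumes p: "summable (\<lambda>j. (norm (p j))\<^sup>2)" and q: "summable (\<lambda>j. (norm (q j))\<^sup>2)"
  shows "(\<lambda>n. measure lborel ({a<..b} \<inter> {c<..d}) * (\<Sum>j<n. p j \<bullet> q j)) \<longlonglongrightarrow>
    (\<integral>x. (case x of (r, j) \<Rightarrow> indicator {a<..b::real} r *\<^sub>R p j) \<bullet>
       (case x of (r, j) \<Rightarrow> indicator {c<..d} r *\<^sub>R q j) \<partial>time_modes)"
proof -
  have int: "integrable time_modes (\<lambda>x. (case x of (r, j) \<Rightarrow> indicator {a<..b} r *\<^sub>R p j) \<bullet>
      (case x of (r, j) \<Rightarrow> indicator {c<..d} r *\<^sub>R q j))"
    by (intro second_moment_inner_integrable second_moment_indicator_modes p q)
  have "summable (\<lambda>j. \<bar>p j \<bullet> q j\<bar>)"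
  proof (rule summable_comparison_test)
    show "summable (\<lambda>j. (norm (p j))\<^sup>2 + (norm (q j))\<^sup>2)" using p q by (rule summable_add)
    show "\<exists>N. \<forall>n\<ge>N. norm \<bar>p n \<bullet> q n\<bar> \<le> (norm (p n))\<^sup>2 + (norm (q n))\<^sup>2"
      using inner_le_weighted[of 1 "p _" "q _"] by (auto; smt (verit) zero_le_power2 div_by_1 mult_1)
  qed
  then have s: "summable (\<lambda>j. p j \<bullet> q j)" and as: "integrable (count_space UNIV) (\<lambda>j. p j \<bullet> q j)"
    by (auto intro: summable_rabs_cancel simp: integrable_count_space_nat_iff)
  have "(\<integral>x. (case x of (r, j) \<Rightarrow> indicator {a<..b} r *\<^sub>R p j) \<bullet>
       (case x of (r, j) \<Rightarrow> indicator {c<..d} r *\<^sub>R q j) \<partial>time_modes)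
      = (\<integral>r. \<integral>j. (indicator {a<..b} r *\<^sub>R p j) \<bullet> (indicator {c<..d} r *\<^sub>R q j) \<partial>count_space UNIV \<partial>lborel)"
    using time_modes.integral_fst'[OF int[unfolded time_modes_def]] by (simp add: time_modes_def)
  also have "\<dots> = (\<integral>r. indicator ({a<..b} \<inter> {c<..d}) r * (\<Sum>j. p j \<bullet> q j) \<partial>lborel)"
    using as by (intro Bochner_Integration.integral_cong)
      (auto simp: indicator_def integral_count_space_nat)
  also have "\<dots> = measure lborel ({a<..b} \<inter> {c<..d}) * (\<Sum>j. p j \<bullet> q j)"
    by simp
  finally show ?thesis
    using s by (simp add: summable_LIMSEQ tendsto_mult_left)
qed

lemma Int_stable_vimage: "Int_stable {X -` B \<inter> S |B. B \<in> sets N}"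
proof (rule Int_stableI)
  fix a b assume "a \<in> {X -` B \<inter> S |B. B \<in> sets N}" "b \<in> {X -` B \<inter> S |B. B \<in> sets N}"
  then obtain A B where "A \<in> sets N" "B \<in> sets N" "a = X -` A \<inter> S" "b = X -` B \<inter> S" by blast
  then show "a \<inter> b \<in> {X -` B \<inter> S |B. B \<in> sets N}"
    by (intro CollectI exI[of _ "A \<inter> B"]) auto
qed

section \<open>Increments of the Wiener process\<close>

locale wiener = prob_space M
  for M :: "'a measure" +
  fixes F :: "real \<Rightarrow> 'a measure" and Q :: "'h::{real_inner, second_countable_topology} \<Rightarrow> 'h"
    and e :: "nat \<Rightarrow> 'h" and \<beta> :: "nat \<Rightarrow> real \<Rightarrow> 'a \<Rightarrow> real" and W :: "real \<Rightarrow> 'a \<Rightarrow> 'h"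
  assumes filtration: "normal_filtration M F"
    and trace_class: "trace_class e Q"
    and wiener: "Q_wiener_process M F Q e \<beta> W"
begin

definition q :: "nat \<Rightarrow> 'h" where "q j = sqrt_op Q (e j)"

lemma summable_q: "summable (\<lambda>j. (norm (q j))\<^sup>2)"
  using trace_class by (simp add: trace_class_def q_def)

lemma suminf_q: "(\<Sum>j. (norm (q j))\<^sup>2) = trace_op e Q"
  by (simp add: trace_op_def q_def)

lemma summable_linear_q:
  assumes "bounded_linear A" shows "summable (\<lambda>j. (norm (A (q j)))\<^sup>2)"
proof -
  obtain K where K: "\<And>x. norm (A x) \<le> norm x * K"
    using bounded_linear.bounded[OF assms] by blast
  have "norm ((norm (A (q j)))\<^sup>2) \<le> (norm (q j))\<^sup>2 * K\<^sup>2" for j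
    using power_mono[OF K norm_ge_zero, of "q j" 2] by (simp add: power_mult_distrib)
  then show ?thesis
    by (rule summable_comparison_test'[OF summable_mult2[OF summable_q], of 0])
qed

lemma filtration_sets: "\<forall>s t. 0 \<le> s \<and> s \<le> t \<longrightarrow> sets (F s) \<subseteq> sets (F t)"
  and filtration_subalgebra: "0 \<le> t \<Longrightarrow> subalgebra M (F t)"
  by (rule filtration[unfolded normal_filtration_def, THEN conjunct2, THEN conjunct1])
    (rule filtration[unfolded normal_filtration_def, THEN conjunct1, rule_format])

lemma filtration_mono: "0 \<le> s \<Longrightarrow> s \<le> t \<Longrightarrow> subalgebra (F t) (F s)"
proof -
  assume st: "0 \<le> s" "s \<le> t"
  then have "sets (F s) \<subseteq> sets (F t)"
    using filtration_sets by blast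
  with filtration_subalgebra[of s] filtration_subalgebra[of t] st
  show ?thesis by (simp add: subalgebra_def)
qed

lemma filtration_measurable:
  assumes "0 \<le> s" "s \<le> t" "X \<in> measurable (F s) N" shows "X \<in> measurable (F t) N"
  using filtration_mono[OF assms(1,2)] assms(3) by (rule measurable_from_subalg)

lemma filtration_measurable_M:
  assumes "0 \<le> s" "X \<in> measurable (F s) N" shows "X \<in> measurable M N"
  using filtration_subalgebra[OF assms(1)] assms(2) by (rule measurable_from_subalg)

lemma coefficients: "wiener_coefficients M \<beta>"
  using wiener by (simp add: Q_wiener_process_def wiener_coefficients_def)

lemma brownian: "standard_brownian_motion M (\<beta> j)"
  using wiener by (simp add: Q_wiener_process_def)

lemma second_moment_brownian: "0 \<le> t \<Longrightarrow> second_moment M (\<beta> j t)"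
proof -
  assume t: "0 \<le> t"
  have m: "\<beta> j t \<in> borel_measurable M" "\<beta> j 0 \<in> borel_measurable M"
    using brownian[of j] t by (auto simp: standard_brownian_motion_def)
  have "integrable M (\<lambda>w. (norm (\<beta> j t w - \<beta> j 0 w))\<^sup>2)"
    using t by (intro second_moment_integrable brownian_increment brownian) auto
  moreover have "integrable M (\<lambda>w. (norm (\<beta> j t w - \<beta> j 0 w))\<^sup>2) = integrable M (\<lambda>w. (norm (\<beta> j t w))\<^sup>2)"
  proof (rule integrable_cong_AE)
    show "AE w in M. (norm (\<beta> j t w - \<beta> j 0 w))\<^sup>2 = (norm (\<beta> j t w))\<^sup>2"
      using brownian_zero[OF brownian, of j] by eventually_elim simp
  qed (use m in measurable)
  ultimately show ?thesis using m by (simp add: second_moment_def)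
qed

lemma W_measurable: "0 \<le> t \<Longrightarrow> W t \<in> borel_measurable (F t)"
  using wiener by (simp add: Q_wiener_process_def)

lemma second_moment_real_scaleR:
  fixes f :: "'a \<Rightarrow> real" shows "second_moment M f \<Longrightarrow> second_moment M (\<lambda>w. f w *\<^sub>R (x :: 'h))"
  by (rule second_moment_linear[of "\<lambda>c. c *\<^sub>R x"]) (auto intro: bounded_linear_scaleR_left)

lemma ms_tendsto_W:
  assumes "0 \<le> t" shows "ms_tendsto M (\<lambda>n w. \<Sum>j<n. \<beta> j t w *\<^sub>R q j) (W t)"
proof (rule ms_tendstoI)
  show "second_moment M (\<lambda>w. \<Sum>j<n. \<beta> j t w *\<^sub>R q j)" for n
    using assms by (intro second_moment_sum second_moment_real_scaleR second_moment_brownian)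
  show "W t \<in> borel_measurable M"
    by (rule filtration_measurable_M[OF assms W_measurable[OF assms]])
  show "(\<lambda>n. \<integral>\<^sup>+w. ennreal ((norm (W t w - (\<Sum>j<n. \<beta> j t w *\<^sub>R q j)))\<^sup>2) \<partial>M) \<longlonglongrightarrow> 0"
    using wiener assms by (simp add: Q_wiener_process_def q_def)
qed

lemma ms_tendsto_increment:
  assumes "0 \<le> a" "0 \<le> b" "bounded_linear A"
  shows "ms_tendsto M (\<lambda>n w. \<Sum>j<n. (\<beta> j b w - \<beta> j a w) *\<^sub>R A (q j)) (\<lambda>w. A (W b w - W a w))"
proof -
  have "ms_tendsto M (\<lambda>n w. A ((\<Sum>j<n. \<beta> j b w *\<^sub>R q j) - (\<Sum>j<n. \<beta> j a w *\<^sub>R q j))) (\<lambda>w. A (W b w - W a w))"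
    by (rule ms_tendsto_linear[OF assms(3) ms_tendsto_diff[OF ms_tendsto_W[OF assms(2)] ms_tendsto_W[OF assms(1)]]])
  also have "(\<lambda>n w. A ((\<Sum>j<n. \<beta> j b w *\<^sub>R q j) - (\<Sum>j<n. \<beta> j a w *\<^sub>R q j))) =
      (\<lambda>n w. \<Sum>j<n. (\<beta> j b w - \<beta> j a w) *\<^sub>R A (q j))"
    using bounded_linear.linear[OF assms(3)]
    by (simp add: fun_eq_iff linear_sum linear_cmul flip: sum_subtractf scaleR_diff_left)
  finally show ?thesis .
qed

abbreviation step_fun :: "real \<Rightarrow> real \<Rightarrow> ('h \<Rightarrow> 'h) \<Rightarrow> real \<times> nat \<Rightarrow> 'h" where
  "step_fun a b A x \<equiv> (case x of (r, j) \<Rightarrow> indicator {a<..b} r *\<^sub>R A (q j))"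

text \<open>For truncated series the off-diagonal terms vanish by independence and each diagonal
  term contributes the overlap length; both sides are limits of the resulting sums.\<close>

lemma increment_covariance:
  fixes A B :: "'h \<Rightarrow> 'h"
  assumes ab: "0 \<le> a" "a \<le> b" and cd: "0 \<le> c" "c \<le> d" and A: "bounded_linear A" "bounded_linear B"
  shows "(\<integral>w. A (W b w - W a w) \<bullet> B (W d w - W c w) \<partial>M) =
    (\<integral>x. step_fun a b A x \<bullet>
       step_fun c d B x \<partial>time_modes)"
proof (rule LIMSEQ_unique)
  have sm: "second_moment M (\<lambda>w. \<beta> j y w - \<beta> j x w)" if "0 \<le> x" "x \<le> y" for j x y
    using that by (intro second_moment_diff second_moment_brownian) auto
  have i: "integrable M (\<lambda>w. (\<beta> j b w - \<beta> j a w) * (\<beta> k d w - \<beta> k c w))" for j k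
    using second_moment_inner_integrable[OF sm[OF ab] sm[OF cd], of j k] by simp
  let ?l = "measure lborel ({a<..b} \<inter> {c<..d})"
  have "(\<integral>w. (\<Sum>j<n. (\<beta> j b w - \<beta> j a w) *\<^sub>R A (q j)) \<bullet> (\<Sum>k<n. (\<beta> k d w - \<beta> k c w) *\<^sub>R B (q k)) \<partial>M) =
      ?l * (\<Sum>j<n. A (q j) \<bullet> B (q j))" for n
  proof -
    have "(\<integral>w. (\<Sum>j<n. (\<beta> j b w - \<beta> j a w) *\<^sub>R A (q j)) \<bullet> (\<Sum>k<n. (\<beta> k d w - \<beta> k c w) *\<^sub>R B (q k)) \<partial>M) =
      (\<integral>w. (\<Sum>j<n. \<Sum>k<n. ((\<beta> j b w - \<beta> j a w) * (\<beta> k d w - \<beta> k c w)) * (A (q j) \<bullet> B (q k))) \<partial>M)"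
      by (subst sum.swap) (simp add: inner_sum_left inner_sum_right mult.assoc mult.left_commute sum_distrib_left)
    also have "\<dots> = (\<Sum>j<n. \<Sum>k<n. (\<integral>w. (\<beta> j b w - \<beta> j a w) * (\<beta> k d w - \<beta> k c w) \<partial>M) * (A (q j) \<bullet> B (q k)))"
      using i by (simp add: Bochner_Integration.integral_sum)
    also have "\<dots> = (\<Sum>j<n. \<Sum>k<n. if j = k then ?l * (A (q j) \<bullet> B (q k)) else 0)"
      using brownian_covariance[OF brownian ab cd] independent_brownian_covariance[OF coefficients _ ab cd]
      by (intro sum.cong refl) auto
    also have "\<dots> = ?l * (\<Sum>j<n. A (q j) \<bullet> B (q j))"
      by (simp add: sum_distrib_left)
    finally show ?thesis .
  qed
  then show "(\<lambda>n. ?l * (\<Sum>j<n. A (q j) \<bullet> B (q j))) \<longlonglongrightarrow>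
      (\<integral>w. A (W b w - W a w) \<bullet> B (W d w - W c w) \<partial>M)"
    using ms_tendsto_inner[OF ms_tendsto_increment[of a b A] ms_tendsto_increment[of c d B]] ab cd A by simp
  show "(\<lambda>n. ?l * (\<Sum>j<n. A (q j) \<bullet> B (q j))) \<longlonglongrightarrow>
    (\<integral>x. step_fun a b A x \<bullet>
       step_fun c d B x \<partial>time_modes)"
    by (intro integral_time_modes_indicator summable_linear_q A)
qed

lemma increment_mean_zero:
  fixes A :: "'h \<Rightarrow> 'h"
  assumes ab: "0 \<le> a" "a \<le> b" and A: "bounded_linear A"
  shows "(\<integral>w. x \<bullet> A (W b w - W a w) \<partial>M) = 0"
proof (rule LIMSEQ_unique)
  have "integrable M (\<lambda>w. 1 * (\<beta> j b w - \<beta> j a w))" for j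
    using second_moment_inner_integrable[of M "\<lambda>_. 1" "\<lambda>w. \<beta> j b w - \<beta> j a w"] brownian_increment(1)[OF brownian ab, of j]
    by (simp add: second_moment_def)
  then have "(\<integral>w. x \<bullet> (\<Sum>j<n. (\<beta> j b w - \<beta> j a w) *\<^sub>R A (q j)) \<partial>M) = 0" for n
    using brownian_increment(2)[OF brownian ab]
    by (simp add: inner_sum_right Bochner_Integration.integral_sum)
  then show "(\<lambda>n. 0) \<longlonglongrightarrow> (\<integral>w. x \<bullet> A (W b w - W a w) \<partial>M)"
    using ms_tendsto_inner[OF ms_tendsto_const ms_tendsto_increment[of a b A], of "\<lambda>_. x"] ab A
    by (simp add: second_moment_def)
qed simp

lemma second_moment_increment:
  "0 \<le> a \<Longrightarrow> 0 \<le> b \<Longrightarrow> bounded_linear A \<Longrightarrow> second_moment M (\<lambda>w. A (W b w - W a w))"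
  using ms_tendsto_increment[of a b A] by (simp add: ms_tendsto_def)

text \<open>\<open>Y\<close> is measurable at time \<open>a\<close>, hence independent of the
  increment, and their joint law is a product. Fubini integrates out the increment first, with the
  value of \<open>Y\<close> frozen, where \<open>increment_mean_zero\<close> applies.\<close>

lemma increment_orthogonal:
  fixes A :: "'h \<Rightarrow> 'h"
  assumes s: "0 \<le> s" "s \<le> a" "a \<le> b" and A: "bounded_linear A"
    and Y: "Y \<in> borel_measurable (F s)" "second_moment M Y"
  shows "(\<integral>w. Y w \<bullet> A (W b w - W a w) \<partial>M) = 0"
proof -
  let ?D = "\<lambda>w. W b w - W a w"
  note D = second_moment_increment[of a b "\<lambda>x. x", OF _ _ bounded_linear_ident]
  have Ya: "Y \<in> borel_measurable (F a)" by (rule filtration_measurable[OF s(1,2) Y(1)])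
  have sp: "space (F a) = space M" using filtration_subalgebra[of a] s by (simp add: subalgebra_def)
  have [measurable]: "Y \<in> borel_measurable M" "?D \<in> borel_measurable M"
    using Y(2) D s by (auto dest: second_moment_measurable)
  have "indep_set (sets (F a)) {?D -` B \<inter> space M |B. B \<in> sets borel}"
    using wiener s by (simp add: Q_wiener_process_def)
  then have "indep_set {Y -` B \<inter> space M |B. B \<in> sets borel} {?D -` B \<inter> space M |B. B \<in> sets borel}"
    unfolding indep_set_def
    by (rule indep_sets_mono_sets) (use measurable_sets[OF Ya] sp in \<open>auto split: bool.split\<close>)
  then have "indep_set (sigma_sets (space M) {Y -` B \<inter> space M |B. B \<in> sets borel})
      (sigma_sets (space M) {?D -` B \<inter> space M |B. B \<in> sets borel})"
    by (rule indep_set_sigma_sets) (rule Int_stable_vimage)+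
  then have iv: "indep_var borel Y borel ?D" by (simp add: indep_var_eq)
  then have eq: "distr M borel Y \<Otimes>\<^sub>M distr M borel ?D = distr M (borel \<Otimes>\<^sub>M borel) (\<lambda>w. (Y w, ?D w))"
    by (simp add: indep_var_distribution_eq)
  interpret Y: prob_space "distr M borel Y" by (rule prob_space_distr) simp
  interpret D: prob_space "distr M borel ?D" by (rule prob_space_distr) simp
  interpret YD: pair_prob_space "distr M borel Y" "distr M borel ?D" ..
  have [measurable]: "A \<in> borel_measurable borel"
    using A by (intro borel_measurable_continuous_onI linear_continuous_on)
  have i: "integrable M (\<lambda>w. Y w \<bullet> A (?D w))"
    using Y(2) A s by (intro second_moment_inner_integrable second_moment_increment) auto
  have m: "(\<lambda>(y, d). y \<bullet> A d) \<in> borel_measurable (borel \<Otimes>\<^sub>M borel)" by measurable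
  have "integrable (distr M borel Y \<Otimes>\<^sub>M distr M borel ?D) (\<lambda>(y, d). y \<bullet> A d)"
    unfolding eq using i m by (subst integrable_distr_eq) auto
  then have "(\<integral>y. \<integral>d. y \<bullet> A d \<partial>distr M borel ?D \<partial>distr M borel Y) =
      (\<integral>x. (case x of (y, d) \<Rightarrow> y \<bullet> A d) \<partial>(distr M borel Y \<Otimes>\<^sub>M distr M borel ?D))"
    using YD.integral_fst'[of "\<lambda>(y, d). y \<bullet> A d"] by simp
  also have "\<dots> = (\<integral>w. Y w \<bullet> A (?D w) \<partial>M)"
    unfolding eq using m by (subst integral_distr) auto
  also have "(\<integral>y. \<integral>d. y \<bullet> A d \<partial>distr M borel ?D \<partial>distr M borel Y) = (\<integral>y. 0 \<partial>distr M borel Y)"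
    using s by (intro Bochner_Integration.integral_cong refl) (simp add: integral_distr increment_mean_zero A)
  finally show ?thesis by simp
qed

section \<open>Step integrals and the Ito isometry\<close>

definition step_integral :: "(real \<times> real \<times> ('h \<Rightarrow> 'h)) list \<Rightarrow> 'a \<Rightarrow> 'h" where
  "step_integral L w = (\<Sum>(a, b, A)\<leftarrow>L. A (W b w - W a w))"

definition step_kernel :: "(real \<times> real \<times> ('h \<Rightarrow> 'h)) list \<Rightarrow> real \<times> nat \<Rightarrow> 'h" where
  "step_kernel L x = (\<Sum>(a, b, A)\<leftarrow>L. indicator {a<..b} (fst x) *\<^sub>R A (q (snd x)))"

text \<open>Intervals may overlap and come in any order. Sums of step integrands are then
  concatenations, and no common refinement of partitions has to be formed.\<close>

definition steps :: "(real \<times> real \<times> ('h \<Rightarrow> 'h)) list set" where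
  "steps = lists {(a, b, A). 0 \<le> a \<and> a \<le> b \<and> bounded_linear A}"

lemma steps_simps [simp]:
  "[] \<in> steps" "(a, b, A) # L \<in> steps \<longleftrightarrow> 0 \<le> a \<and> a \<le> b \<and> bounded_linear A \<and> L \<in> steps"
  "L @ L' \<in> steps \<longleftrightarrow> L \<in> steps \<and> L' \<in> steps"
  by (auto simp: steps_def)

lemma step_simps [simp]:
  "step_integral [] w = 0" "step_integral ((a, b, A) # L) w = A (W b w - W a w) + step_integral L w"
  "step_integral (L @ L') w = step_integral L w + step_integral L' w"
  "step_kernel [] x = 0"
  "step_kernel ((a, b, A) # L) x = step_fun a b A x + step_kernel L x"
  "step_kernel (L @ L') x = step_kernel L x + step_kernel L' x"
  by (simp_all add: step_integral_def step_kernel_def split_beta)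

lemma step_Nil: "step_integral [] = (\<lambda>_. 0)" "step_kernel [] = (\<lambda>_. 0)"
  by (simp_all add: fun_eq_iff)

lemma second_moment_step_integral: "L \<in> steps \<Longrightarrow> second_moment M (step_integral L)"
proof (induction L)
  case (Cons p L)
  obtain a b A where p: "p = (a, b, A)" by (cases p)
  have "step_integral (p # L) = (\<lambda>w. A (W b w - W a w) + step_integral L w)" by (simp add: fun_eq_iff p)
  with Cons show ?case by (auto simp: p intro!: second_moment_add second_moment_increment)
qed (simp add: step_Nil)

lemma second_moment_step_kernel: "L \<in> steps \<Longrightarrow> second_moment time_modes (step_kernel L)"
proof (induction L)
  case (Cons p L)
  obtain a b A where p: "p = (a, b, A)" by (cases p)
  have "step_kernel (p # L) = (\<lambda>x. step_fun a b A x + step_kernel L x)"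
    by (simp add: fun_eq_iff p)
  with Cons show ?case by (auto simp: p intro!: second_moment_add second_moment_indicator_modes summable_linear_q)
qed (simp add: step_Nil)

text \<open>Both sides are additive in each list, so two inductions reduce the claim to single
  steps, where it is \<open>increment_covariance\<close>.\<close>

lemma step_isometry_inner:
  assumes "L \<in> steps" "L' \<in> steps"
  shows "(\<integral>w. step_integral L w \<bullet> step_integral L' w \<partial>M) = (\<integral>x. step_kernel L x \<bullet> step_kernel L' x \<partial>time_modes)"
proof -
  have 1: "(\<integral>w. A (W b w - W a w) \<bullet> step_integral L' w \<partial>M) =
      (\<integral>x. step_fun a b A x \<bullet> step_kernel L' x \<partial>time_modes)"
    if ab: "0 \<le> a" "a \<le> b" "bounded_linear A" for a b A
    using assms(2)
  proof (induction L')
    case (Cons p L')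
    obtain c d B where p: "p = (c, d, B)" by (cases p)
    with Cons.prems have cd: "0 \<le> c" "c \<le> d" "bounded_linear B" "L' \<in> steps" by auto
    have i: "integrable M (\<lambda>w. A (W b w - W a w) \<bullet> B (W d w - W c w))"
      "integrable M (\<lambda>w. A (W b w - W a w) \<bullet> step_integral L' w)"
      "integrable time_modes (\<lambda>x. step_fun a b A x \<bullet>
         step_fun c d B x)"
      "integrable time_modes (\<lambda>x. step_fun a b A x \<bullet> step_kernel L' x)"
      using ab cd by (auto intro!: second_moment_inner_integrable second_moment_increment
        second_moment_step_integral second_moment_step_kernel second_moment_indicator_modes summable_linear_q)
    show ?case
      using i Cons.IH[OF cd(4)] increment_covariance[OF ab(1,2) cd(1,2) ab(3) cd(3)]
      by (simp add: p inner_add_right)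
  qed simp
  show ?thesis
    using assms(1)
  proof (induction L)
    case (Cons p L)
    obtain a b A where p: "p = (a, b, A)" by (cases p)
    with Cons.prems have ab: "0 \<le> a" "a \<le> b" "bounded_linear A" "L \<in> steps" by auto
    have i: "integrable M (\<lambda>w. A (W b w - W a w) \<bullet> step_integral L' w)"
      "integrable M (\<lambda>w. step_integral L w \<bullet> step_integral L' w)"
      "integrable time_modes (\<lambda>x. step_fun a b A x \<bullet> step_kernel L' x)"
      "integrable time_modes (\<lambda>x. step_kernel L x \<bullet> step_kernel L' x)"
      using ab assms(2) by (auto intro!: second_moment_inner_integrable second_moment_increment
        second_moment_step_integral second_moment_step_kernel second_moment_indicator_modes summable_linear_q)
    show ?case
      using i Cons.IH[OF ab(4)] 1[OF ab(1-3)] by (simp add: p inner_add_left)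
  qed simp
qed

lemma step_isometry:
  "L \<in> steps \<Longrightarrow> (mean_square M (step_integral L)) = (mean_square time_modes (step_kernel L))"
  using step_isometry_inner[of L L] by (simp add: power2_norm_eq_inner)

text \<open>The closure of the graph of the step isometry: one sequence of lists approximates both
  the integral and the kernel. The time horizon is no parameter but part of the kernel, so that
  integrals up to different times can be added.\<close>

definition has_wiener_integral :: "('a \<Rightarrow> 'h) \<Rightarrow> (real \<times> nat \<Rightarrow> 'h) \<Rightarrow> bool" where
  "has_wiener_integral X K \<longleftrightarrow> (\<exists>L. (\<forall>m. L m \<in> steps) \<and>
     ms_tendsto M (\<lambda>m. step_integral (L m)) X \<and> ms_tendsto time_modes (\<lambda>m. step_kernel (L m)) K)"

lemma has_wiener_integral_second_moment:
  "has_wiener_integral X K \<Longrightarrow> second_moment M X" "has_wiener_integral X K \<Longrightarrow> second_moment time_modes K"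
  by (auto simp: has_wiener_integral_def ms_tendsto_def)

lemma has_wiener_integral_isometry:
  assumes "has_wiener_integral X K"
  shows "mean_square M X = (mean_square time_modes K)"
proof -
  from assms obtain L where L: "\<And>m. L m \<in> steps" "ms_tendsto M (\<lambda>m. step_integral (L m)) X"
    "ms_tendsto time_modes (\<lambda>m. step_kernel (L m)) K"
    by (auto simp: has_wiener_integral_def)
  show ?thesis
    using ms_tendsto_norm[OF L(2)] ms_tendsto_norm[OF L(3)]
    by (simp add: step_isometry L(1) LIMSEQ_unique)
qed

lemma has_wiener_integral_add:
  assumes "has_wiener_integral X K" "has_wiener_integral X' K'"
  shows "has_wiener_integral (\<lambda>w. X w + X' w) (\<lambda>x. K x + K' x)"
proof -
  from assms obtain L L' where L: "\<And>m. L m \<in> steps" "ms_tendsto M (\<lambda>m. step_integral (L m)) X"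
    "ms_tendsto time_modes (\<lambda>m. step_kernel (L m)) K"
    and L': "\<And>m. L' m \<in> steps" "ms_tendsto M (\<lambda>m. step_integral (L' m)) X'"
    "ms_tendsto time_modes (\<lambda>m. step_kernel (L' m)) K'"
    by (auto simp: has_wiener_integral_def)
  have "(\<lambda>m. step_integral (L m @ L' m)) = (\<lambda>m w. step_integral (L m) w + step_integral (L' m) w)"
    "(\<lambda>m. step_kernel (L m @ L' m)) = (\<lambda>m x. step_kernel (L m) x + step_kernel (L' m) x)"
    by (simp_all add: fun_eq_iff)
  then show ?thesis
    unfolding has_wiener_integral_def using L L'
    by (intro exI[of _ "\<lambda>m. L m @ L' m"]) (simp add: ms_tendsto_add)
qed

lemma step_map:
  assumes T: "bounded_linear T" and L: "L \<in> steps"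
  shows "map (\<lambda>(a, b, A). (a, b, T \<circ> A)) L \<in> steps"
    and "step_integral (map (\<lambda>(a, b, A). (a, b, T \<circ> A)) L) w = T (step_integral L w)"
    and "step_kernel (map (\<lambda>(a, b, A). (a, b, T \<circ> A)) L) x = T (step_kernel L x)"
proof -
  interpret T: bounded_linear T by (rule T)
  have *: "map (\<lambda>(a, b, A). (a, b, T \<circ> A)) L \<in> steps \<and>
    step_integral (map (\<lambda>(a, b, A). (a, b, T \<circ> A)) L) w = T (step_integral L w) \<and>
    step_kernel (map (\<lambda>(a, b, A). (a, b, T \<circ> A)) L) x = T (step_kernel L x)"
    using L
  proof (induction L)
    case (Cons p L)
    then show ?case
      by (cases p; cases x)
        (auto simp: T.add T.scaleR T.zero comp_def intro: bounded_linear_compose[OF T])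
  qed (simp add: T.zero)
  then show "map (\<lambda>(a, b, A). (a, b, T \<circ> A)) L \<in> steps"
    "step_integral (map (\<lambda>(a, b, A). (a, b, T \<circ> A)) L) w = T (step_integral L w)"
    "step_kernel (map (\<lambda>(a, b, A). (a, b, T \<circ> A)) L) x = T (step_kernel L x)" by auto
qed

lemma has_wiener_integral_linear:
  assumes T: "bounded_linear T" and "has_wiener_integral X K"
  shows "has_wiener_integral (\<lambda>w. T (X w)) (\<lambda>x. T (K x))"
proof -
  from assms obtain L where L: "\<And>m. L m \<in> steps" "ms_tendsto M (\<lambda>m. step_integral (L m)) X"
    "ms_tendsto time_modes (\<lambda>m. step_kernel (L m)) K"
    by (auto simp: has_wiener_integral_def)
  have "(\<lambda>m. step_integral (map (\<lambda>(a, b, A). (a, b, T \<circ> A)) (L m))) = (\<lambda>m w. T (step_integral (L m) w))"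
    "(\<lambda>m. step_kernel (map (\<lambda>(a, b, A). (a, b, T \<circ> A)) (L m))) = (\<lambda>m x. T (step_kernel (L m) x))"
    using step_map[OF T L(1)] by (simp_all add: fun_eq_iff)
  then show ?thesis
    unfolding has_wiener_integral_def using L step_map(1)[OF T L(1)]
    by (intro exI[of _ "\<lambda>m. map (\<lambda>(a, b, A). (a, b, T \<circ> A)) (L m)"]) (simp add: ms_tendsto_linear[OF T])
qed

end

context wiener
begin

text \<open>
  Cutting the steps at time \<open>s\<close> splits a step integral into a part before \<open>s\<close>, which is small
  when the kernel lives after \<open>s\<close>, and a part after \<open>s\<close>, which is orthogonal to the past.
\<close>

definition before :: "real \<Rightarrow> (real \<times> real \<times> ('h \<Rightarrow> 'h)) list \<Rightarrow> (real \<times> real \<times> ('h \<Rightarrow> 'h)) list" where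
  "before s L = map (\<lambda>(a, b, A). (min a s, min b s, A)) L"

definition after :: "real \<Rightarrow> (real \<times> real \<times> ('h \<Rightarrow> 'h)) list \<Rightarrow> (real \<times> real \<times> ('h \<Rightarrow> 'h)) list" where
  "after s L = map (\<lambda>(a, b, A). (max a s, max b s, A)) L"

lemma before_steps: "0 \<le> s \<Longrightarrow> L \<in> steps \<Longrightarrow> before s L \<in> steps"
  by (induction L) (auto simp: before_def steps_def)

lemma after_steps: "L \<in> steps \<Longrightarrow> 0 \<le> s \<Longrightarrow> after s L \<in> steps"
  by (induction L) (auto simp: after_def steps_def)

lemma step_integral_split:
  assumes "L \<in> steps"
  shows "step_integral L w = step_integral (before s L) w + step_integral (after s L) w"
  using assms
proof (induction L)
  case (Cons p L)
  obtain a b A where p: "p = (a, b, A)" by (cases p)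
  with Cons.prems have ab: "a \<le> b" "linear A" "L \<in> steps" by (auto dest: bounded_linear.linear)
  have "A (W b w - W a w) =
      A (W (min b s) w - W (min a s) w) + A (W (max b s) w - W (max a s) w)"
    unfolding linear_add[OF ab(2), symmetric] by (intro arg_cong[of _ _ A]) (auto simp: min_def max_def)
  then show ?case using Cons.IH[OF ab(3)] by (simp add: p before_def after_def)
qed (simp add: before_def after_def)

lemma step_kernel_before:
  assumes "L \<in> steps"
  shows "step_kernel (before s L) x = indicator {..s} (fst x) *\<^sub>R step_kernel L x"
  using assms
proof (induction L)
  case (Cons p L)
  then show ?case
    by (cases p; cases x) (auto simp: before_def indicator_def split: if_splits)
qed (simp add: before_def)

lemma step_after_orthogonal:
  assumes s: "0 \<le> s" and Y: "Y \<in> borel_measurable (F s)" "second_moment M Y" and L: "L \<in> steps"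
  shows "(\<integral>w. Y w \<bullet> step_integral (after s L) w \<partial>M) = 0"
  using L
proof (induction L)
  case (Cons p L)
  obtain a b A where p: "p = (a, b, A)" by (cases p)
  with Cons.prems have ab: "0 \<le> a" "a \<le> b" "bounded_linear A" "L \<in> steps" by auto
  have "after s L \<in> steps" using ab(4) s by (rule after_steps)
  then have i: "integrable M (\<lambda>w. Y w \<bullet> step_integral (after s L) w)"
    "integrable M (\<lambda>w. Y w \<bullet> A (W (max b s) w - W (max a s) w))"
    using ab Y by (auto intro!: second_moment_inner_integrable second_moment_step_integral second_moment_increment)
  show ?case
    using i Cons.IH[OF ab(4)] increment_orthogonal[of s "max a s" "max b s" A Y] ab s Y
    by (simp add: p after_def inner_add_right)
qed (simp add: after_def)

lemma has_wiener_integral_orthogonal: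
  assumes X: "has_wiener_integral X K" and s: "0 \<le> s" and K: "\<And>x. fst x \<le> s \<Longrightarrow> K x = 0"
    and Y: "Y \<in> borel_measurable (F s)" "second_moment M Y"
  shows "(\<integral>w. Y w \<bullet> X w \<partial>M) = 0"
proof -
  from X obtain L where L: "\<And>m. L m \<in> steps" "ms_tendsto M (\<lambda>m. step_integral (L m)) X"
    "ms_tendsto time_modes (\<lambda>m. step_kernel (L m)) K"
    by (auto simp: has_wiener_integral_def)
  let ?a = "\<lambda>m. (\<integral>w. (norm (0 - step_integral (before s (L m)) w))\<^sup>2 \<partial>M)"
    and ?b = "\<lambda>m. (\<integral>x. (norm (K x - step_kernel (L m) x))\<^sup>2 \<partial>time_modes)"
  have sK: "second_moment time_modes K" using L(3) by (simp add: ms_tendsto_def)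
  have sb: "second_moment M (step_integral (before s (L m)))" for m
    by (intro second_moment_step_integral before_steps s L)
  have "(\<lambda>m. \<integral>w. (norm (0 - step_integral (before s (L m)) w))\<^sup>2 \<partial>M) \<longlonglongrightarrow> 0"
  proof (rule tendsto_sandwich[OF always_eventually always_eventually tendsto_const])
    show "\<forall>m. ?a m
        \<le> ?b m"
    proof
      fix m
      have "?a m
          = (\<integral>x. (norm (step_kernel (before s (L m)) x))\<^sup>2 \<partial>time_modes)"
        by (simp add: step_isometry before_steps s L)
      also have "\<dots> \<le> ?b m"
      proof (rule integral_mono)
        show "integrable time_modes (\<lambda>x. (norm (step_kernel (before s (L m)) x))\<^sup>2)"
          by (intro second_moment_integrable second_moment_step_kernel before_steps s L)
        show "integrable time_modes (\<lambda>x. (norm (K x - step_kernel (L m) x))\<^sup>2)"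
          by (intro second_moment_integrable second_moment_diff second_moment_step_kernel sK L)
        \<comment> \<open>For times up to \<open>s\<close> the kernel \<open>K\<close> vanishes, so
          there the cut step kernel is, up to sign, the approximation error itself.\<close>
        show "(norm (step_kernel (before s (L m)) x))\<^sup>2 \<le> (norm (K x - step_kernel (L m) x))\<^sup>2" for x
          using K[of x] by (auto simp: step_kernel_before L indicator_def)
      qed
      finally show "?a m
        \<le> ?b m" .
    qed
    show "(\<lambda>m. \<integral>x. (norm (K x - step_kernel (L m) x))\<^sup>2 \<partial>time_modes) \<longlonglongrightarrow> 0"
      using L(3) by (simp add: ms_tendsto_def)
  qed simp
  with sb have "ms_tendsto M (\<lambda>m. step_integral (before s (L m))) (\<lambda>_. 0)"
    by (simp add: ms_tendsto_def)
  \<comment> \<open>Since the part before \<open>s\<close> vanishes in the limit, the part after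
    \<open>s\<close> converges to the whole of \<open>X\<close>.\<close>
  from ms_tendsto_diff[OF L(2) this]
  have "ms_tendsto M (\<lambda>m. step_integral (after s (L m))) X"
    by (simp add: step_integral_split[OF L(1), of _ _ s])
  from ms_tendsto_inner[OF ms_tendsto_const[OF Y(2)] this]
  show ?thesis
    using step_after_orthogonal[OF s Y L(1)] by (simp add: LIMSEQ_const_iff)
qed

text \<open>The partitions of \<open>[0, t]\<close> become step lists. The cutoff at
  \<open>t\<close> moves into the kernel, where \<open>has_wiener_integral\<close> expects the
  horizon.\<close>

lemma has_stochastic_integral_wiener:
  assumes X: "has_stochastic_integral M Q e W t \<Phi> X"
    and \<Phi>: "\<And>x. (\<lambda>r. \<Phi> r x) \<in> borel_measurable borel"
  shows "has_wiener_integral X (\<lambda>(r, j). indicator {0..t} r *\<^sub>R \<Phi> r (q j))"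
proof -
  let ?K = "\<lambda>(r, j). indicator {0..t} r *\<^sub>R \<Phi> r (q j)"
  from X obtain n \<tau> A where \<tau>: "\<And>m. \<tau> m 0 = 0" "\<And>m. \<tau> m (n m) = t" "\<And>m i. i < n m \<Longrightarrow> \<tau> m i \<le> \<tau> m (Suc i)"
    and A: "\<And>m i. i < n m \<Longrightarrow> bounded_linear (A m i)" and Xm: "X \<in> borel_measurable M"
    and limK: "(\<lambda>m. \<integral>\<^sup>+r\<in>{0..t}. (\<Sum>j. ennreal ((norm (\<Phi> r (sqrt_op Q (e j)) -
             elementary_integrand (n m) (\<tau> m) (A m) r (sqrt_op Q (e j))))\<^sup>2)) \<partial>lborel) \<longlonglongrightarrow> 0"
    and limX: "(\<lambda>m. \<integral>\<^sup>+w. ennreal ((norm (X w -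
             elementary_integral (n m) (\<tau> m) (A m) W w))\<^sup>2) \<partial>M) \<longlonglongrightarrow> 0"
    unfolding has_stochastic_integral_def by blast
  let ?E = "\<lambda>m. elementary_integrand (n m) (\<tau> m) (A m)"
  define L where "L m = map (\<lambda>i. (\<tau> m i, \<tau> m (Suc i), A m i)) [0..<n m]" for m
  have \<tau>0: "0 \<le> \<tau> m i" if "i \<le> n m" for m i
    using that by (induction i) (auto simp: \<tau>(1) intro: order_trans[OF _ \<tau>(3)])
  have \<tau>t: "\<tau> m i \<le> t" if "i \<le> n m" for m i
    using that by (induction i rule: inc_induct) (auto simp: \<tau>(2) intro: order_trans[OF \<tau>(3)])
  have L: "L m \<in> steps" for m
    using \<tau>0 \<tau>(3) A by (auto simp: L_def steps_def)
  have LX: "step_integral (L m) = elementary_integral (n m) (\<tau> m) (A m) W" for m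
    by (simp add: fun_eq_iff step_integral_def L_def elementary_integral_def comp_def
      interv_sum_list_conv_sum_set_nat atLeast0LessThan)
  have LK: "step_kernel (L m) (r, j) = ?E m r (q j)" for m r j
    by (simp add: step_kernel_def L_def elementary_integrand_def comp_def
      interv_sum_list_conv_sum_set_nat atLeast0LessThan)
  have [measurable]: "(\<lambda>r. \<Phi> r x) \<in> borel_measurable borel" for x by (rule \<Phi>)
  have m2: "(\<lambda>r. ennreal ((norm (indicator {0..t} r *\<^sub>R f r - g r))\<^sup>2)) \<in> borel_measurable borel"
    if [measurable]: "f \<in> borel_measurable borel" "g \<in> borel_measurable borel" for f g :: "real \<Rightarrow> 'h"
    by measurable
  have m1: "(\<lambda>r. ?E m r x) \<in> borel_measurable borel" for m x
    unfolding elementary_integrand_def by measurable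
  \<comment> \<open>The distance in \<open>has_stochastic_integral\<close> is taken over
    \<open>[0, t]\<close>, whereas \<open>time_modes\<close> covers the whole line; the two agree
    because all partition points lie in \<open>[0, t]\<close>.\<close>
  have zero: "step_kernel (L m) (r, j) = 0" if "r \<notin> {0..t}" for m r j
    unfolding LK elementary_integrand_def
  proof (intro sum.neutral ballI)
    fix i assume "i \<in> {..<n m}"
    then show "indicator {\<tau> m i<..\<tau> m (Suc i)} r *\<^sub>R A m i (q j) = 0"
      using that \<tau>0[of i m] \<tau>t[of "Suc i" m] by (auto simp: indicator_def)
  qed
  have "ms_tendsto time_modes (\<lambda>m. step_kernel (L m)) ?K"
  proof (rule ms_tendstoI)
    show "second_moment time_modes (step_kernel (L m))" for m by (intro second_moment_step_kernel L)
    show "?K \<in> borel_measurable time_modes" by (rule borel_measurable_time_modes) simp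
    have "(\<integral>\<^sup>+x. ennreal ((norm (?K x - step_kernel (L m) x))\<^sup>2) \<partial>time_modes) =
        (\<integral>\<^sup>+r\<in>{0..t}. (\<Sum>j. ennreal ((norm (\<Phi> r (q j) -
             ?E m r (q j)))\<^sup>2)) \<partial>lborel)" for m
    proof -
      have "(\<integral>\<^sup>+x. ennreal ((norm (?K x - step_kernel (L m) x))\<^sup>2) \<partial>time_modes) =
          (\<integral>\<^sup>+r. (\<Sum>j. ennreal ((norm (?K (r, j) - step_kernel (L m) (r, j)))\<^sup>2)) \<partial>lborel)"
        by (rule nn_integral_time_modes, unfold LK prod.case, rule m2[OF \<Phi> m1])
      also have "\<dots> = (\<integral>\<^sup>+r\<in>{0..t}. (\<Sum>j. ennreal ((norm (\<Phi> r (q j) -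
             ?E m r (q j)))\<^sup>2)) \<partial>lborel)"
      proof (rule nn_integral_cong)
        fix r :: real
        show "(\<Sum>j. ennreal ((norm (?K (r, j) - step_kernel (L m) (r, j)))\<^sup>2)) =
          (\<Sum>j. ennreal ((norm (\<Phi> r (q j) -
             ?E m r (q j)))\<^sup>2)) * indicator {0..t} r"
        proof (cases "r \<in> {0..t}")
          case True
          then have i: "indicator {0..t} r = (1 :: real)" "indicator {0..t} r = (1 :: ennreal)"
            by (simp_all add: indicator_def)
          show ?thesis unfolding LK prod.case i by (simp only: scaleR_one mult_1_right)
        next
          case False
          then have i: "indicator {0..t} r = (0 :: real)" "indicator {0..t} r = (0 :: ennreal)"
            by (auto simp: indicator_def)
          show ?thesis unfolding prod.case i zero[OF False] by simp
        qed
      qed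
      finally show ?thesis .
    qed
    with limK show "(\<lambda>m. \<integral>\<^sup>+x. ennreal ((norm (?K x - step_kernel (L m) x))\<^sup>2) \<partial>time_modes) \<longlonglongrightarrow> 0"
      by (simp add: q_def)
  qed
  moreover have "ms_tendsto M (\<lambda>m. step_integral (L m)) X"
    using limX Xm by (intro ms_tendstoI second_moment_step_integral L) (simp_all add: LX)
  ultimately show ?thesis using L unfolding has_wiener_integral_def by blast
qed

section \<open>Stochastic convolutions with a group of isometries\<close>

lemma convolution_kernel_norm:
  assumes S: "\<And>t x. norm (S t x) = norm x" "\<And>x. (\<lambda>t. S t x) \<in> borel_measurable borel"
    and J: "\<And>x. norm (J x :: 'h) = norm x"
    and B: "B \<in> sets borel" "emeasure lborel B < \<infinity>"
    and K: "has_wiener_integral Z (\<lambda>(r, j). indicator B r *\<^sub>R J (S (t - r) (q j)))"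
  shows "mean_square M Z = measure lborel B * trace_op e Q"
proof -
  let ?K = "\<lambda>(r, j). indicator B r *\<^sub>R J (S (t - r) (q j))"
  note B(1)[measurable]
  have "ennreal (mean_square time_modes ?K) = (\<integral>\<^sup>+x. ennreal ((norm (?K x))\<^sup>2) \<partial>time_modes)"
    using second_moment_integrable[OF has_wiener_integral_second_moment(2)[OF K]]
    by (intro nn_integral_eq_integral[symmetric]) auto
  also have "\<dots> = (\<integral>\<^sup>+r. (\<Sum>j. ennreal ((norm (?K (r, j)))\<^sup>2)) \<partial>lborel)"
    using B(1) by (intro nn_integral_time_modes) (simp add: J S(1) power_mult_distrib)
  \<comment> \<open>\<open>J\<close> and \<open>S\<close> preserve norms, so the sum over the modes
    equals the trace at every time in \<open>B\<close>.\<close>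
  also have "\<dots> = (\<integral>\<^sup>+r. ennreal (trace_op e Q) * indicator B r \<partial>lborel)"
    using summable_q by (intro nn_integral_cong) (auto simp: indicator_def S(1) J suminf_ennreal2 suminf_q)
  also have "\<dots> = ennreal (trace_op e Q) * ennreal (measure lborel B)"
    using B by (subst nn_integral_cmult) (auto simp: emeasure_eq_ennreal_measure)
  also have "\<dots> = ennreal (measure lborel B * trace_op e Q)"
    by (simp add: ennreal_mult'' mult.commute)
  finally have "(mean_square time_modes ?K) = measure lborel B * trace_op e Q"
    by (subst (asm) ennreal_inj) (auto intro!: mult_nonneg_nonneg suminf_nonneg summable_q simp flip: suminf_q)
  with has_wiener_integral_isometry[OF K] show ?thesis by simp
qed

text \<open>
  The process \<open>X\<^sub>t - S(t - s) X\<^sub>s\<close> is the Wiener integral of \<open>S(t - r)\<close> over \<open>(s, t]\<close>.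
\<close>

lemma convolution_increment:
  assumes S: "\<And>t. linear (S t)" "\<And>t x. norm (S t x) = norm x" "\<And>s t x. S s (S t x) = S (s + t) x"
    "\<And>x. (\<lambda>t. S t x) \<in> borel_measurable borel"
    and J: "linear J" "\<And>x. norm (J x :: 'h) = norm x"
    and X: "has_stochastic_integral M Q e W s (\<lambda>r. S (s - r)) X"
    and X': "has_stochastic_integral M Q e W t (\<lambda>r. S (t - r)) X'"
    and st: "0 \<le> s" "s \<le> t"
  defines "Z \<equiv> \<lambda>w. J (X' w) - S (t - s) (J (X w))"
  assumes SJ: "\<And>t x. S t (J x) = J (S t x)"
  shows "second_moment M Z" "mean_square M Z = (t - s) * trace_op e Q"
    and "\<And>Y. Y \<in> borel_measurable (F s) \<Longrightarrow> second_moment M Y \<Longrightarrow> (\<integral>w. Y w \<bullet> Z w \<partial>M) = 0"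
    and "second_moment M X'" "mean_square M X' = t * trace_op e Q"
proof -
  have bl: "bounded_linear (S t)" for t
    using S(1,2) by (intro bounded_linear_intro[where K=1]) (auto simp: linear_add linear_scale)
  have bJ: "bounded_linear J"
    using J by (intro bounded_linear_intro[where K=1]) (auto simp: linear_add linear_scale)
  have [measurable]: "(\<lambda>t. S t x) \<in> borel_measurable borel" for x by (rule S(4))
  let ?K = "\<lambda>(r, j). indicator {s<..t} r *\<^sub>R J (S (t - r) (q j))"
  have 1: "has_wiener_integral X' (\<lambda>(r, j). indicator {0..t} r *\<^sub>R S (t - r) (q j))"
    by (rule has_stochastic_integral_wiener[OF X']) simp
  have 2: "has_wiener_integral X (\<lambda>(r, j). indicator {0..s} r *\<^sub>R S (s - r) (q j))"
    by (rule has_stochastic_integral_wiener[OF X]) simp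
  have "bounded_linear (\<lambda>x. - S (t - s) (J x))"
    by (rule bounded_linear_minus[OF bounded_linear_compose[OF bl bJ]])
  from has_wiener_integral_add[OF has_wiener_integral_linear[OF bJ 1] has_wiener_integral_linear[OF this 2]]
  have "has_wiener_integral Z (\<lambda>x. J (case x of (r, j) \<Rightarrow> indicator {0..t} r *\<^sub>R S (t - r) (q j)) +
      - S (t - s) (J (case x of (r, j) \<Rightarrow> indicator {0..s} r *\<^sub>R S (s - r) (q j))))"
    by (simp add: Z_def)
  \<comment> \<open>For \<open>r \<le> s\<close> the group law gives
    \<open>S (t - s) (S (s - r) x) = S (t - r) x\<close>, so the two kernels cancel there and only
    \<open>(s, t]\<close> remains.\<close>
  also have "(\<lambda>x. J (case x of (r, j) \<Rightarrow> indicator {0..t} r *\<^sub>R S (t - r) (q j)) +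
      - S (t - s) (J (case x of (r, j) \<Rightarrow> indicator {0..s} r *\<^sub>R S (s - r) (q j)))) = ?K"
    using st by (auto simp: fun_eq_iff indicator_def linear_0[OF S(1)] linear_0[OF J(1)] S(3) SJ)
  finally have Z: "has_wiener_integral Z ?K" .
  show "second_moment M Z" by (rule has_wiener_integral_second_moment[OF Z])
  show "(\<integral>w. Y w \<bullet> Z w \<partial>M) = 0" if "Y \<in> borel_measurable (F s)" "second_moment M Y" for Y
    by (rule has_wiener_integral_orthogonal[OF Z st(1) _ that]) auto
  show "mean_square M Z = (t - s) * trace_op e Q"
    using st convolution_kernel_norm[where S=S and J=J, OF S(2,4) J(2) _ _ Z] by simp
  show "second_moment M X'" by (rule has_wiener_integral_second_moment[OF 1])
  show "mean_square M X' = t * trace_op e Q"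
    using st convolution_kernel_norm[where S=S and J="\<lambda>x. x", OF S(2,4) _ _ _ 1] by simp
qed

end

section \<open>Energy balance of mild solutions\<close>

text \<open>Bootstraps the crude bound \<open>B\<close>. If
  \<open>\<psi> t \<le> c * exp (2 * b * t)\<close>, the integral inequality returns the same bound
  with \<open>a + c / 2\<close> for \<open>c\<close>; the rate \<open>2 * b\<close> instead of
  \<open>b\<close> is what produces the factor 1/2. The constants \<open>2 * a + B / 2 ^ n\<close>
  tend to \<open>2 * a\<close>, so \<open>B\<close> leaves no trace in the result.\<close>

lemma gronwall_nn_integral:
  fixes \<psi> :: "real \<Rightarrow> ennreal"
  assumes "0 \<le> a" "0 < b" "0 \<le> B"
    and bound: "\<And>t. t \<in> {0..T} \<Longrightarrow> \<psi> t \<le> ennreal B"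
    and step: "\<And>t. t \<in> {0..T} \<Longrightarrow> \<psi> t \<le> ennreal a + ennreal b * (\<integral>\<^sup>+r\<in>{0..t}. \<psi> r \<partial>lborel)"
    and t: "t \<in> {0..T}"
  shows "\<psi> t \<le> ennreal (2 * a * exp (2 * b * t))"
proof -
  have iter: "\<psi> t \<le> ennreal ((2 * a + B / 2 ^ n) * exp (2 * b * t))" if "t \<in> {0..T}" for t n
    using that
  proof (induction n arbitrary: t)
    case 0
    have "B * 1 \<le> (2 * a + B) * exp (2 * b * t)"
      using 0 assms(1-3) by (intro mult_mono) auto
    then show ?case using bound[OF 0] by (auto intro: order_trans ennreal_leI)
  next
    case (Suc n)
    define c where "c = 2 * a + B / 2 ^ n"
    have c: "0 \<le> c" using assms by (simp add: c_def)
    have t: "0 \<le> t" using Suc.prems by simp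
    have "(\<integral>\<^sup>+r\<in>{0..t}. \<psi> r \<partial>lborel) \<le> (\<integral>\<^sup>+r\<in>{0..t}. ennreal (c * exp (2 * b * r)) \<partial>lborel)"
      using Suc.IH Suc.prems by (intro nn_integral_mono) (auto simp: indicator_def c_def)
    also have "\<dots> = ennreal (c / (2 * b) * exp (2 * b * t) - c / (2 * b) * exp (2 * b * 0))"
    proof (rule nn_integral_FTC_Icc)
      show "((\<lambda>r. c / (2 * b) * exp (2 * b * r)) has_real_derivative c * exp (2 * b * x)) (at x)" for x
        using \<open>0 < b\<close> by (auto intro!: derivative_eq_intros)
    qed (use c t in auto)
    finally have "\<psi> t \<le> ennreal a + ennreal b * ennreal (c / (2 * b) * exp (2 * b * t) - c / (2 * b))"
      using step[OF Suc.prems] by (auto intro!: order_trans[OF step[OF Suc.prems]] add_left_mono mult_left_mono)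
    also have "\<dots> = ennreal (a + b * (c / (2 * b) * exp (2 * b * t) - c / (2 * b)))"
    proof -
      have "0 \<le> c / (2 * b) * exp (2 * b * t) - c / (2 * b)"
        using mult_left_mono[of 1 "exp (2 * b * t)" "c / (2 * b)"] assms(2) c t by simp
      then show ?thesis
        using assms(1,2) by (simp only: ennreal_mult ennreal_plus mult_nonneg_nonneg less_imp_le)
    qed
    also have "\<dots> \<le> ennreal ((2 * a + B / 2 ^ Suc n) * exp (2 * b * t))"
    proof (rule ennreal_leI)
      have "a + b * (c / (2 * b) * exp (2 * b * t) - c / (2 * b)) = a - c / 2 + c / 2 * exp (2 * b * t)"
        using assms(2) by (simp add: field_simps)
      also have "\<dots> \<le> a * exp (2 * b * t) + c / 2 * exp (2 * b * t)"
        using mult_left_mono[of 1 "exp (2 * b * t)" a] assms(1,2) t c by simp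
      also have "\<dots> = (2 * a + B / 2 ^ Suc n) * exp (2 * b * t)"
        by (simp add: c_def field_simps)
      finally show "a + b * (c / (2 * b) * exp (2 * b * t) - c / (2 * b)) \<le> (2 * a + B / 2 ^ Suc n) * exp (2 * b * t)" .
    qed
    finally show ?case .
  qed
  have "(\<lambda>n. B * (1 / 2) ^ n) \<longlonglongrightarrow> B * 0"
    by (intro tendsto_intros LIMSEQ_power_zero) simp
  then have "(\<lambda>n. (2 * a + B / 2 ^ n) * exp (2 * b * t)) \<longlonglongrightarrow> (2 * a + 0) * exp (2 * b * t)"
    by (intro tendsto_intros) (simp add: power_divide)
  then have "(\<lambda>n. ennreal ((2 * a + B / 2 ^ n) * exp (2 * b * t))) \<longlonglongrightarrow> ennreal (2 * a * exp (2 * b * t))"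
    by (intro tendsto_ennrealI) simp
  then show ?thesis
    by (rule LIMSEQ_le_const) (use iter[OF t] in auto)
qed

text \<open>On a partition into \<open>n + 1\<close> equal pieces the increments have order
  \<open>(T / (n + 1)) powr (3 / 2)\<close> each, hence order \<open>1 / sqrt (n + 1)\<close> in
  total.\<close>

lemma constant_of_increments:
  fixes f :: "real \<Rightarrow> real"
  assumes T: "0 < T" and inc: "\<And>s t. 0 \<le> s \<Longrightarrow> s < t \<Longrightarrow> t \<le> T \<Longrightarrow> \<bar>f t - f s\<bar> \<le> K * ((t - s) * sqrt (t - s))"
  shows "f T = f 0"
proof -
  have le: "\<bar>f T - f 0\<bar> \<le> K * T * sqrt (T / real (Suc n))" for n
  proof -
    define x where "x i = T * (real i / real (Suc n))" for i
    have d: "x (Suc i) - x i = T / real (Suc n)" for i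
      by (simp add: x_def add_divide_distrib distrib_left)
    have *: "\<bar>f (x (Suc i)) - f (x i)\<bar> \<le> K * (T / real (Suc n) * sqrt (T / real (Suc n)))" if "i < Suc n" for i
    proof -
      have "x i < x (Suc i)" using T d[of i] by (smt (verit) divide_pos_pos of_nat_0_less_iff zero_less_Suc)
      moreover have "x (Suc i) \<le> T" using that T by (simp add: x_def field_simps)
      moreover have "0 \<le> x i" using T by (simp add: x_def)
      ultimately show ?thesis using inc[of "x i" "x (Suc i)"] by (simp only: d)
    qed
    have "x 0 = 0" "x (Suc n) = T" by (simp_all add: x_def)
    then have "\<bar>f T - f 0\<bar> = \<bar>\<Sum>i<Suc n. f (x (Suc i)) - f (x i)\<bar>"
      using sum_lessThan_telescope[of "\<lambda>i. f (x i)" "Suc n"] by simp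
    also have "\<dots> \<le> (\<Sum>i<Suc n. \<bar>f (x (Suc i)) - f (x i)\<bar>)" by (rule sum_abs)
    also have "\<dots> \<le> (\<Sum>i<Suc n. K * (T / real (Suc n) * sqrt (T / real (Suc n))))"
      using * by (intro sum_mono) auto
    also have "\<dots> = real (Suc n) * (K * (T / real (Suc n) * sqrt (T / real (Suc n))))"
      by (simp only: sum_constant card_lessThan)
    also have "\<dots> = K * T * sqrt (T / real (Suc n))"
      by (simp del: of_nat_Suc)
    finally show ?thesis .
  qed
  have "(\<lambda>n. K * T * sqrt (T * (1 / real (Suc n)))) \<longlonglongrightarrow> K * T * sqrt (T * 0)"
    by (intro tendsto_intros LIMSEQ_Suc[OF lim_1_over_n])
  then have "(\<lambda>n. K * T * sqrt (T / real (Suc n))) \<longlonglongrightarrow> 0" by simp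
  then have "\<bar>f T - f 0\<bar> \<le> 0"
    by (rule LIMSEQ_le_const) (use le in auto)
  then show ?thesis by simp
qed

text \<open>Isometry upgrades strong continuity to joint continuity: moving both arguments costs at
  most the distance of the vectors plus the change of the orbit of one fixed vector.\<close>

lemma borel_measurable_action:
  fixes S :: "real \<Rightarrow> 'h::{real_normed_vector, second_countable_topology} \<Rightarrow> 'h"
  assumes S: "\<And>t. linear (S t)" "\<And>t x. norm (S t x) = norm x" "\<And>x. continuous_on UNIV (\<lambda>t. S t x)"
    and f: "f \<in> borel_measurable N" and g: "g \<in> borel_measurable N"
  shows "(\<lambda>x. S (f x) (g x)) \<in> borel_measurable N"
proof -
  have "continuous_on UNIV (\<lambda>z. S (fst z) (snd z))"
    unfolding continuous_on_def
  proof
    fix z :: "real \<times> 'h"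
    have "((\<lambda>y. S (fst y) (snd y) - S (fst z) (snd z)) \<longlongrightarrow> 0) (at z within UNIV)"
    proof (rule Lim_null_comparison)
      show "\<forall>\<^sub>F y in at z within UNIV. norm (S (fst y) (snd y) - S (fst z) (snd z)) \<le>
          norm (snd y - snd z) + norm (S (fst y) (snd z) - S (fst z) (snd z))"
      proof (rule always_eventually, rule allI)
        fix y :: "real \<times> 'h"
        have "S (fst y) (snd y) - S (fst z) (snd z) =
            S (fst y) (snd y - snd z) + (S (fst y) (snd z) - S (fst z) (snd z))"
          by (simp add: linear_diff[OF S(1)])
        then show "norm (S (fst y) (snd y) - S (fst z) (snd z)) \<le>
            norm (snd y - snd z) + norm (S (fst y) (snd z) - S (fst z) (snd z))"
          by (metis norm_triangle_ineq S(2))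
      qed
      have "((\<lambda>t. S t (snd z)) \<longlongrightarrow> S (fst z) (snd z)) (at (fst z))"
        using S(3)[of "snd z"] by (simp add: continuous_on_def)
      then have "isCont (\<lambda>t. S t (snd z)) (fst z)" by (simp add: isCont_def)
      then have c: "((\<lambda>y. S (fst y) (snd z)) \<longlongrightarrow> S (fst z) (snd z)) (at z within UNIV)"
        by (intro isCont_tendsto_compose[of _ "\<lambda>t. S t (snd z)"] tendsto_intros)
      have "((\<lambda>y. norm (snd y - snd z) + norm (S (fst y) (snd z) - S (fst z) (snd z))) \<longlongrightarrow>
          norm (snd z - snd z) + norm (S (fst z) (snd z) - S (fst z) (snd z))) (at z within UNIV)"
        by (intro tendsto_intros c)
      then show "((\<lambda>y. norm (snd y - snd z) + norm (S (fst y) (snd z) - S (fst z) (snd z))) \<longlongrightarrow> 0) (at z within UNIV)"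
        by simp
    qed
    then show "((\<lambda>z. S (fst z) (snd z)) \<longlongrightarrow> S (fst z) (snd z)) (at z within UNIV)"
      by (simp add: LIM_zero_iff)
  qed
  then have "(\<lambda>z. S (fst z) (snd z)) \<in> borel_measurable (borel \<Otimes>\<^sub>M borel)"
    by (simp add: borel_prod borel_measurable_continuous_onI)
  from measurable_compose[OF measurable_Pair[OF f g] this] show ?thesis by simp
qed

text \<open>The equation stripped of the torus: \<open>S\<close> stands for the free group,
  \<open>A\<close> for multiplication by -i V and \<open>J\<close> for multiplication by -i, all as
  real-linear maps of a real Hilbert space. Joint measurability of \<open>u\<close> serves the
  exchange of time integral and expectation.\<close>

locale mild_energy = wiener M F Q e \<beta> W
  for M :: "'a measure" and F :: "real \<Rightarrow> 'a measure"
    and Q :: "'h::{real_inner, banach, second_countable_topology} \<Rightarrow> 'h"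
    and e :: "nat \<Rightarrow> 'h" and \<beta> :: "nat \<Rightarrow> real \<Rightarrow> 'a \<Rightarrow> real" and W :: "real \<Rightarrow> 'a \<Rightarrow> 'h" +
  fixes S :: "real \<Rightarrow> 'h \<Rightarrow> 'h" and J :: "'h \<Rightarrow> 'h" and A :: "'h \<Rightarrow> 'h" and C :: real
    and X :: "real \<Rightarrow> 'a \<Rightarrow> 'h" and u\<^sub>0 :: "'a \<Rightarrow> 'h" and u :: "real \<Rightarrow> 'a \<Rightarrow> 'h"
  assumes S_linear: "linear (S t)" and S_norm: "norm (S t x) = norm x"
    and S_group: "S s (S t x) = S (s + t) x"
    and S_cont: "continuous_on UNIV (\<lambda>t. S t x)"
    and J: "linear J" "norm (J x) = norm x" and SJ: "S t (J x) = J (S t x)"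
    and A_linear: "linear A" and A_bound: "norm (A x) \<le> C * norm x" and C: "0 \<le> C"
    and A_skew: "x \<bullet> A x = 0"
    and u0: "u\<^sub>0 \<in> borel_measurable (F 0)" "second_moment M u\<^sub>0"
    and u_adapted: "0 \<le> t \<Longrightarrow> u t \<in> borel_measurable (F t)"
    and u_joint: "(\<lambda>(t, w). u t w) \<in> borel_measurable (borel \<Otimes>\<^sub>M M)"
    and u_integrable: "AE w in M. \<forall>t\<ge>0. set_integrable lborel {0..t} (\<lambda>r. u r w)"
    and X: "0 \<le> t \<Longrightarrow> has_stochastic_integral M Q e W t (\<lambda>r. S (t - r)) (X t)"
    and mild: "0 \<le> t \<Longrightarrow> AE w in M. u t w = S t (u\<^sub>0 w) +
      (LINT r:{0..t}|lborel. S (t - r) (A (u r w))) + J (X t w)"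
begin

sublocale time_space: pair_sigma_finite lborel M
  by (intro pair_sigma_finite.intro sigma_finite_lborel sigma_finite_measure_axioms)

lemma S_bounded: "bounded_linear (S t)"
  using S_linear S_norm by (intro bounded_linear_intro[where K=1]) (auto simp: linear_add linear_scale)

lemma A_bounded: "bounded_linear A"
  using A_linear A_bound by (intro bounded_linear_intro[where K=C]) (auto simp: linear_add linear_scale mult.commute)

lemma S_inner: "S t x \<bullet> S t y = x \<bullet> y"
proof -
  have "4 * (S t x \<bullet> S t y) = (norm (S t (x + y)))\<^sup>2 - (norm (S t (x - y)))\<^sup>2"
    by (simp add: linear_add[OF S_linear] linear_diff[OF S_linear] power2_norm_eq_inner algebra_simps inner_commute)
  also have "\<dots> = 4 * (x \<bullet> y)"
    by (simp add: S_norm power2_norm_eq_inner algebra_simps inner_commute)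
  finally show ?thesis by simp
qed

lemma S_measurable [measurable (raw)]:
  "f \<in> borel_measurable N \<Longrightarrow> g \<in> borel_measurable N \<Longrightarrow> (\<lambda>x. S (f x) (g x)) \<in> borel_measurable N"
  by (rule borel_measurable_action[OF S_linear S_norm S_cont])

lemma A_measurable [measurable]: "A \<in> borel_measurable borel"
  by (intro borel_measurable_continuous_onI linear_continuous_on A_bounded)

lemma u_measurable [measurable (raw)]:
  assumes "f \<in> borel_measurable N" "g \<in> measurable N M"
  shows "(\<lambda>x. u (f x) (g x)) \<in> borel_measurable N"
  using measurable_compose[OF measurable_Pair[OF assms] u_joint] by simp

lemma X_measurable [measurable]: "0 \<le> t \<Longrightarrow> X t \<in> borel_measurable M"
  using X[of t] unfolding has_stochastic_integral_def by blast

lemma u0_measurable [measurable]: "u\<^sub>0 \<in> borel_measurable M"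
  using u0(2) by (rule second_moment_measurable)

section \<open>The drift and bounds on second moments\<close>

definition drift :: "real \<Rightarrow> real set \<Rightarrow> 'a \<Rightarrow> 'h" where
  "drift t B w = (LINT r:B|lborel. S (t - r) (A (u r w)))"

lemma drift_integrable:
  assumes "set_integrable lborel {0..t} (\<lambda>r. u r w)" "w \<in> space M" "B \<in> sets borel" "B \<subseteq> {0..t}"
  shows "set_integrable lborel B (\<lambda>r. S (t' - r) (A (u r w)))"
  unfolding set_integrable_def
proof (rule Bochner_Integration.integrable_bound)
  show "integrable lborel (\<lambda>r. C *\<^sub>R indicator {0..t} r *\<^sub>R u r w)"
    using assms(1) unfolding set_integrable_def by (intro integrable_scaleR_right)
  show "(\<lambda>r. indicator B r *\<^sub>R S (t' - r) (A (u r w))) \<in> borel_measurable lborel"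
    using assms(2,3) by measurable
  show "AE r in lborel. norm (indicator B r *\<^sub>R S (t' - r) (A (u r w))) \<le> norm (C *\<^sub>R indicator {0..t} r *\<^sub>R u r w)"
    using assms(4) C A_bound by (intro AE_I2) (auto simp: indicator_def S_norm)
qed

lemma drift_norm:
  assumes "w \<in> space M" "B \<in> sets borel"
  shows "ennreal (norm (drift t B w)) \<le> ennreal C * (\<integral>\<^sup>+r\<in>B. ennreal (norm (u r w)) \<partial>lborel)"
proof (cases "set_integrable lborel B (\<lambda>r. S (t - r) (A (u r w)))")
  case True
  note [measurable] = assms
  have "ennreal (norm (drift t B w)) \<le> (\<integral>\<^sup>+r. ennreal (norm (indicator B r *\<^sub>R S (t - r) (A (u r w)))) \<partial>lborel)"
    using True unfolding drift_def set_lebesgue_integral_def set_integrable_def by (rule integral_norm_bound_ennreal)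
  also have "\<dots> \<le> (\<integral>\<^sup>+r. ennreal C * (ennreal (norm (u r w)) * indicator B r) \<partial>lborel)"
    using A_bound C by (intro nn_integral_mono) (auto simp: indicator_def S_norm ennreal_leI simp flip: ennreal_mult)
  also have "\<dots> = ennreal C * (\<integral>\<^sup>+r\<in>B. ennreal (norm (u r w)) \<partial>lborel)"
    by (rule nn_integral_cmult) measurable
  finally show ?thesis .
next
  \<comment> \<open>The Bochner integral is then 0 by convention, so the bound holds at every sample
    point and not just almost surely.\<close>
  case False
  then have "drift t B w = 0"
    unfolding drift_def set_lebesgue_integral_def set_integrable_def by (rule not_integrable_integral_eq)
  then show ?thesis by simp
qed

text \<open>Cauchy-Schwarz in time against the indicator of \<open>B\<close>. The factor
  \<open>h\<close> gained here gives the drift over a step of length \<open>h\<close> a second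
  moment of order h^2.\<close>

lemma drift_norm_square:
  assumes "w \<in> space M" "B \<in> sets borel" "emeasure lborel B = ennreal h" "0 \<le> h"
  shows "ennreal ((norm (drift t B w))\<^sup>2) \<le> ennreal (C\<^sup>2 * h) * (\<integral>\<^sup>+r\<in>B. ennreal ((norm (u r w))\<^sup>2) \<partial>lborel)"
proof -
  note [measurable] = assms(1,2)
  have "ennreal ((norm (drift t B w))\<^sup>2) = (ennreal (norm (drift t B w)))\<^sup>2"
    by (simp add: ennreal_power)
  also have "\<dots> \<le> (ennreal C * (\<integral>\<^sup>+r\<in>B. ennreal (norm (u r w)) \<partial>lborel))\<^sup>2"
    by (intro power_mono drift_norm assms(1,2)) simp
  \<comment> \<open>The indicator is written twice, one copy for each factor in
    Cauchy-Schwarz.\<close>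
  also have "\<dots> = ennreal (C\<^sup>2) * (\<integral>\<^sup>+r. ennreal (norm (u r w)) * indicator B r * indicator B r \<partial>lborel)\<^sup>2"
    using C by (simp add: power_mult_distrib ennreal_power mult.assoc flip: indicator_inter_arith)
  also have "\<dots> \<le> ennreal (C\<^sup>2) * ((\<integral>\<^sup>+r. (ennreal (norm (u r w)) * indicator B r)\<^sup>2 \<partial>lborel) * (\<integral>\<^sup>+r. (indicator B r)\<^sup>2 \<partial>lborel))"
    by (intro mult_left_mono Cauchy_Schwarz_nn_integral) auto
  also have "(\<integral>\<^sup>+r. (indicator B r)\<^sup>2 \<partial>lborel) = (\<integral>\<^sup>+r. indicator B r \<partial>lborel)"
    by (intro nn_integral_cong) (simp add: indicator_def)
  also have "\<dots> = ennreal h" using assms by simp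
  also have "(\<integral>\<^sup>+r. (ennreal (norm (u r w)) * indicator B r)\<^sup>2 \<partial>lborel) = (\<integral>\<^sup>+r\<in>B. ennreal ((norm (u r w))\<^sup>2) \<partial>lborel)"
    by (intro nn_integral_cong) (simp add: indicator_def ennreal_power)
  finally show ?thesis
    using assms(4) by (simp add: ennreal_mult' ac_simps)
qed

lemma norm_add3_square_le:
  fixes x y z :: 'h
  shows "(norm (x + y + z))\<^sup>2 \<le> 3 * (norm x)\<^sup>2 + 3 * (norm y)\<^sup>2 + 3 * (norm z)\<^sup>2"
proof -
  have "3 * (norm x)\<^sup>2 + 3 * (norm y)\<^sup>2 + 3 * (norm z)\<^sup>2 - (norm (x + y + z))\<^sup>2 =
      (norm (x - y))\<^sup>2 + (norm (x - z))\<^sup>2 + (norm (y - z))\<^sup>2"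
    by (simp add: power2_norm_eq_inner algebra_simps inner_commute)
  then show ?thesis
    using zero_le_power2[of "norm (x - y)"] zero_le_power2[of "norm (x - z)"] zero_le_power2[of "norm (y - z)"]
    by linarith
qed

lemmas increment_facts = convolution_increment[where S=S and J=J, OF S_linear S_norm S_group
  borel_measurable_continuous_onI[OF S_cont] J X X _ _ SJ]

lemma X_moment:
  assumes "0 \<le> t"
  shows "second_moment M (X t)" "mean_square M (X t) = t * trace_op e Q"
  by (rule increment_facts(4)[OF order_refl assms order_refl assms])
    (rule increment_facts(5)[OF order_refl assms order_refl assms])

lemma trace_nonneg: "0 \<le> trace_op e Q"
  unfolding suminf_q[symmetric] by (intro suminf_nonneg summable_q) simp

lemma nn_integral_X: "0 \<le> t \<Longrightarrow> (nn_mean_square M (X t)) = ennreal (t * trace_op e Q)"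
  using second_moment_integrable[OF X_moment(1)] X_moment(2)
  by (subst nn_integral_eq_integral) auto

lemma nn_integral_u0: "(nn_mean_square M u\<^sub>0) = ennreal (\<integral>w. (norm (u\<^sub>0 w))\<^sup>2 \<partial>M)"
  using second_moment_integrable[OF u0(2)] by (subst nn_integral_eq_integral) auto

lemma u_square_le:
  assumes "0 \<le> t"
  shows "AE w in M. ennreal ((norm (u t w))\<^sup>2) \<le>
    3 * ennreal ((norm (u\<^sub>0 w))\<^sup>2) + 3 * ennreal ((norm (X t w))\<^sup>2) + 3 * ennreal ((norm (drift t {0..t} w))\<^sup>2)"
  using mild[OF assms]
proof eventually_elim
  case (elim w)
  have "(norm (u t w))\<^sup>2 \<le> 3 * (norm (u\<^sub>0 w))\<^sup>2 + 3 * (norm (X t w))\<^sup>2 + 3 * (norm (drift t {0..t} w))\<^sup>2"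
    unfolding elim drift_def
    using norm_add3_square_le[of "S t (u\<^sub>0 w)" "LINT r:{0..t}|lborel. S (t - r) (A (u r w))" "J (X t w)"]
    by (simp add: S_norm J)
  then have "ennreal ((norm (u t w))\<^sup>2) \<le>
      ennreal (3 * (norm (u\<^sub>0 w))\<^sup>2 + 3 * (norm (X t w))\<^sup>2 + 3 * (norm (drift t {0..t} w))\<^sup>2)"
    by (rule ennreal_leI)
  then show ?case by (simp add: ennreal_mult'')
qed

text \<open>
  Truncating to the event that \<open>\<integral>\<^sub>0\<^sup>T \<parallel>u\<parallel> \<le> N\<close> makes the second moment a priori finite,
  so that Gronwall applies with a constant independent of \<open>N\<close>.
\<close>

lemma a_priori_bound:
  assumes T: "0 \<le> T"
  shows "\<exists>K\<ge>0. \<forall>t\<in>{0..T}. (nn_mean_square M (u t)) \<le> ennreal K"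
proof -
  let ?d = "\<lambda>t w. ennreal ((norm (drift t {0..t} w))\<^sup>2)" and ?e = "\<lambda>t w. ennreal ((norm (u t w))\<^sup>2)"
  define G where "G w = (\<integral>\<^sup>+r\<in>{0..T}. ennreal (norm (u r w)) \<partial>lborel)" for w
  have G [measurable]: "G \<in> borel_measurable M" unfolding G_def by measurable
  \<comment> \<open>The event depends on the sample point alone, so one truncation serves all times
    and passes through the time integral.\<close>
  define I where "I N w = (indicator {x. x \<le> ennreal (real N)} (G w) :: ennreal)" for N :: nat and w
  have [measurable]: "I N \<in> borel_measurable M" for N unfolding I_def by measurable
  define \<psi> where "\<psi> N t = (\<integral>\<^sup>+w. ?e t w * I N w \<partial>M)" for N t
  define E where "E = (\<integral>w. (norm (u\<^sub>0 w))\<^sup>2 \<partial>M)"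
  define a where "a = 3 * E + 3 * (T * trace_op e Q)"
  \<comment> \<open>The 3 comes from squaring a sum of three terms and \<open>T\<close> from
    Cauchy-Schwarz in time; adding 1 keeps \<open>b\<close> positive even if \<open>C\<close> or
    \<open>T\<close> is 0.\<close>
  define b where "b = 3 * C\<^sup>2 * T + 1"
  have E: "0 \<le> E" by (simp add: E_def)
  have a: "0 \<le> a" using T trace_nonneg E by (simp add: a_def)
  have b: "0 < b" using T by (simp add: b_def add_nonneg_pos)
  have main: "\<psi> N t \<le> ennreal a + 3 * (\<integral>\<^sup>+w. ?d t w * I N w \<partial>M)"
    if t: "t \<in> {0..T}" for N t
  proof -
    have t0: "0 \<le> t" using t by simp
    have [measurable]: "drift t {0..t} \<in> borel_measurable M"
      unfolding drift_def set_lebesgue_integral_def by measurable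
    note X_measurable[OF t0, measurable]
    have "\<psi> N t \<le> (\<integral>\<^sup>+w. 3 * ennreal ((norm (u\<^sub>0 w))\<^sup>2) + 3 * ennreal ((norm (X t w))\<^sup>2) +
        3 * (?d t w * I N w) \<partial>M)"
      unfolding \<psi>_def using u_square_le[OF t0]
      by (intro nn_integral_mono_AE) (auto simp: I_def indicator_def)
    also have "\<dots> = 3 * ennreal E + 3 * ennreal (t * trace_op e Q) +
        3 * (\<integral>\<^sup>+w. ?d t w * I N w \<partial>M)"
      by (simp add: nn_integral_add nn_integral_cmult nn_integral_u0 nn_integral_X[OF t0] E_def)
    also have "3 * ennreal E + 3 * ennreal (t * trace_op e Q) \<le> 3 * ennreal E + 3 * ennreal (T * trace_op e Q)"
      using t trace_nonneg by (intro add_left_mono mult_left_mono ennreal_leI mult_right_mono) auto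
    also have "\<dots> = ennreal a"
      using E T trace_nonneg by (simp add: a_def ennreal_mult'')
    finally show ?thesis by (simp add: add_right_mono)
  qed
  \<comment> \<open>Only finiteness counts: this bound grows with \<open>N\<close>, but the
    conclusion of \<open>gronwall_nn_integral\<close> does not contain it.\<close>
  have bound: "\<psi> N t \<le> ennreal (a + 3 * (C\<^sup>2 * (real N)\<^sup>2))" if t: "t \<in> {0..T}" for N t
  proof -
    have "(\<integral>\<^sup>+w. ?d t w * I N w \<partial>M) \<le> (\<integral>\<^sup>+w. ennreal (C\<^sup>2 * (real N)\<^sup>2) \<partial>M)"
    proof (rule nn_integral_mono)
      fix w assume w: "w \<in> space M"
      show "?d t w * I N w \<le> ennreal (C\<^sup>2 * (real N)\<^sup>2)"
      proof (cases "G w \<le> ennreal (real N)")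
        case True
        have "ennreal (norm (drift t {0..t} w)) \<le> ennreal C * (\<integral>\<^sup>+r\<in>{0..t}. ennreal (norm (u r w)) \<partial>lborel)"
          using w by (intro drift_norm) auto
        also have "\<dots> \<le> ennreal C * G w"
          unfolding G_def using t by (intro mult_left_mono nn_integral_mono) (auto simp: indicator_def)
        also have "\<dots> \<le> ennreal C * ennreal (real N)" using True by (intro mult_left_mono) auto
        also have "\<dots> = ennreal (C * real N)" using C by (simp add: ennreal_mult)
        finally have "norm (drift t {0..t} w) \<le> C * real N" using C by (simp add: ennreal_le_iff)
        then have "(norm (drift t {0..t} w))\<^sup>2 \<le> (C * real N)\<^sup>2" by (intro power_mono) auto
        then show ?thesis using True by (simp add: I_def power_mult_distrib ennreal_leI)
      qed (simp add: I_def)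
    qed
    also have "\<dots> = ennreal (C\<^sup>2 * (real N)\<^sup>2)" by (simp add: emeasure_space_1)
    finally have "\<psi> N t \<le> ennreal a + 3 * ennreal (C\<^sup>2 * (real N)\<^sup>2)"
      by (intro order_trans[OF main[OF t]] add_left_mono mult_left_mono) auto
    also have "\<dots> = ennreal (a + 3 * (C\<^sup>2 * (real N)\<^sup>2))"
      using a by (simp add: ennreal_mult'' ennreal_plus)
    finally show ?thesis .
  qed
  have step: "\<psi> N t \<le> ennreal a + ennreal b * (\<integral>\<^sup>+r\<in>{0..t}. \<psi> N r \<partial>lborel)" if t: "t \<in> {0..T}" for N t
  proof -
    have "(\<integral>\<^sup>+w. ?d t w * I N w \<partial>M) \<le>
        (\<integral>\<^sup>+w. ennreal (C\<^sup>2 * t) * (\<integral>\<^sup>+r. ?e r w * I N w * indicator {0..t} r \<partial>lborel) \<partial>M)"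
    proof (rule nn_integral_mono)
      fix w assume w [measurable]: "w \<in> space M"
      have "?d t w * I N w \<le>
          ennreal (C\<^sup>2 * t) * (\<integral>\<^sup>+r\<in>{0..t}. ?e r w \<partial>lborel) * I N w"
        using w t by (intro mult_right_mono drift_norm_square) auto
      also have "\<dots> = ennreal (C\<^sup>2 * t) * (\<integral>\<^sup>+r. ?e r w * I N w * indicator {0..t} r \<partial>lborel)"
        by (cases "G w \<le> ennreal (real N)") (simp_all add: I_def)
      finally show "?d t w * I N w \<le>
          ennreal (C\<^sup>2 * t) * (\<integral>\<^sup>+r. ?e r w * I N w * indicator {0..t} r \<partial>lborel)" .
    qed
    also have "\<dots> = ennreal (C\<^sup>2 * t) * (\<integral>\<^sup>+w. (\<integral>\<^sup>+r. ?e r w * I N w * indicator {0..t} r \<partial>lborel) \<partial>M)"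
      by (rule nn_integral_cmult) measurable
    also have "(\<integral>\<^sup>+w. (\<integral>\<^sup>+r. ?e r w * I N w * indicator {0..t} r \<partial>lborel) \<partial>M) =
        (\<integral>\<^sup>+r. (\<integral>\<^sup>+w. ?e r w * I N w * indicator {0..t} r \<partial>M) \<partial>lborel)"
      by (rule time_space.Fubini') measurable
    also have "\<dots> = (\<integral>\<^sup>+r\<in>{0..t}. \<psi> N r \<partial>lborel)"
      unfolding \<psi>_def by (intro nn_integral_cong nn_integral_multc) measurable
    finally have "\<psi> N t \<le> ennreal a + 3 * (ennreal (C\<^sup>2 * t) * (\<integral>\<^sup>+r\<in>{0..t}. \<psi> N r \<partial>lborel))"
      by (intro order_trans[OF main[OF t]] add_left_mono mult_left_mono) auto
    also have "3 * (ennreal (C\<^sup>2 * t) * (\<integral>\<^sup>+r\<in>{0..t}. \<psi> N r \<partial>lborel)) = ennreal (3 * C\<^sup>2 * t) * (\<integral>\<^sup>+r\<in>{0..t}. \<psi> N r \<partial>lborel)"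
      using t by (simp add: ennreal_mult'' mult.assoc)
    also have "\<dots> \<le> ennreal b * (\<integral>\<^sup>+r\<in>{0..t}. \<psi> N r \<partial>lborel)"
      using t by (intro mult_right_mono ennreal_leI) (auto simp: b_def intro: order_trans[OF mult_left_mono[of t T]])
    finally show ?thesis by (simp add: add_left_mono)
  qed
  define K where "K = 2 * a * exp (2 * b * T)"
  have "(\<integral>\<^sup>+w. ?e t w \<partial>M) \<le> ennreal K" if t: "t \<in> {0..T}" for t
  proof -
    have N: "\<psi> N t \<le> ennreal K" for N
    proof -
      have "\<psi> N t \<le> ennreal (2 * a * exp (2 * b * t))"
        by (rule gronwall_nn_integral[OF a b _ bound step t]) (use a in auto)
      also have "\<dots> \<le> ennreal K"
        unfolding K_def using a b t by (intro ennreal_leI mult_left_mono) auto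
      finally show ?thesis .
    qed
    \<comment> \<open>Integrable paths make the truncating events exhaust the sample space up to a
      null set; Fatou's lemma then carries the bound over to the untruncated moment.\<close>
    have "AE w in M. G w < \<infinity>"
      using u_integrable
    proof eventually_elim
      case (elim w)
      then have "integrable lborel (\<lambda>r. indicator {0..T} r *\<^sub>R u r w)" using T by (simp add: set_integrable_def)
      then have "(\<integral>\<^sup>+r. ennreal (norm (indicator {0..T} r *\<^sub>R u r w)) \<partial>lborel) < \<infinity>"
        by (simp add: integrable_iff_bounded)
      also have "(\<integral>\<^sup>+r. ennreal (norm (indicator {0..T} r *\<^sub>R u r w)) \<partial>lborel) = G w"
        unfolding G_def by (intro nn_integral_cong) (simp add: indicator_def)
      finally show ?case .
    qed
    then have "(\<integral>\<^sup>+w. ?e t w \<partial>M) =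
        (\<integral>\<^sup>+w. liminf (\<lambda>N. ?e t w * I N w) \<partial>M)"
    proof (intro nn_integral_cong_AE, eventually_elim)
      case (elim w)
      then obtain g where g: "G w = ennreal g" "0 \<le> g" by (cases "G w") auto
      obtain n :: nat where n: "g \<le> real n" using real_arch_simple by blast
      have "\<forall>\<^sub>F N in sequentially. ?e t w * I N w = ?e t w"
        using n by (intro eventually_sequentiallyI[of n]) (auto simp: I_def g ennreal_le_iff2)
      then have "(\<lambda>N. ?e t w * I N w) \<longlonglongrightarrow> ?e t w"
        by (rule tendsto_eventually)
      from lim_imp_Liminf[OF sequentially_bot this] show ?case by simp
    qed
    also have "\<dots> \<le> liminf (\<lambda>N. \<psi> N t)"
      unfolding \<psi>_def by (rule nn_integral_liminf) measurable
    also have "\<dots> \<le> liminf (\<lambda>N::nat. ennreal K)"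
      by (intro Liminf_mono always_eventually allI N)
    also have "\<dots> = ennreal K" by (simp add: Liminf_const)
    finally show ?thesis .
  qed
  moreover have "0 \<le> K" using a by (simp add: K_def)
  ultimately show ?thesis by blast
qed

end

context mild_energy
begin

lemma u_moment: "0 \<le> t \<Longrightarrow> second_moment M (u t)"
proof -
  assume t: "0 \<le> t"
  from a_priori_bound[OF t] obtain K where "(nn_mean_square M (u t)) \<le> ennreal K"
    using t by (metis atLeastAtMost_iff order_refl)
  then have "(nn_mean_square M (u t)) < \<infinity>" by (rule order.strict_trans1) simp
  then show ?thesis
    unfolding second_moment_def by (auto intro!: integrableI_bounded)
qed

lemma nn_integral_second_moment:
  "second_moment M Y \<Longrightarrow> (nn_mean_square M Y) = ennreal (mean_square M Y)"
  by (rule nn_integral_eq_integral[OF second_moment_integrable]) auto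

section \<open>One time step of the energy balance\<close>

definition noise :: "real \<Rightarrow> real \<Rightarrow> 'a \<Rightarrow> 'h" where
  "noise s t w = J (X t w) - S (t - s) (J (X s w))"

text \<open>Defined as a difference so that square integrability is inherited from its terms; it
  agrees with the drift over \<open>(s, t]\<close> almost surely.\<close>

definition remainder :: "real \<Rightarrow> real \<Rightarrow> 'a \<Rightarrow> 'h" where
  "remainder s t w = u t w - S (t - s) (u s w) - noise s t w"

lemma noise_facts:
  assumes "0 \<le> s" "s \<le> t"
  shows "second_moment M (noise s t)" "mean_square M (noise s t) = (t - s) * trace_op e Q"
    "Y \<in> borel_measurable (F s) \<Longrightarrow> second_moment M Y \<Longrightarrow> (\<integral>w. Y w \<bullet> noise s t w \<partial>M) = 0"
  using increment_facts(1-3)[OF assms(1) order_trans[OF assms] assms]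
  unfolding noise_def[abs_def] by auto

lemma second_moment_flow: "0 \<le> s \<Longrightarrow> second_moment M (\<lambda>w. S r (u s w))"
  by (rule second_moment_linear[OF S_bounded u_moment])

lemma second_moment_remainder: "0 \<le> s \<Longrightarrow> s \<le> t \<Longrightarrow> second_moment M (remainder s t)"
  unfolding remainder_def[abs_def]
  by (intro second_moment_diff u_moment second_moment_flow noise_facts) auto

lemma AE_drift_integrable:
  "AE w in M. \<forall>t\<ge>0. \<forall>t'. \<forall>B\<in>sets borel. B \<subseteq> {0..t} \<longrightarrow> set_integrable lborel B (\<lambda>r. S (t' - r) (A (u r w)))"
  using u_integrable AE_space
  by eventually_elim (auto intro!: drift_integrable)

text \<open>By the group law, \<open>S (t - s)\<close> applied to the mild equation at
  \<open>s\<close> has the same initial term as the equation at \<open>t\<close> and the same drift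
  integrand on \<open>[0, s]\<close>; subtraction leaves the drift over
  \<open>(s, t]\<close>.\<close>

lemma remainder_eq_drift:
  assumes st: "0 \<le> s" "s \<le> t"
  shows "AE w in M. remainder s t w = drift t {s<..t} w"
proof -
  have t: "0 \<le> t" using st by simp
  from mild[OF st(1)] mild[OF t] AE_drift_integrable show ?thesis
  proof eventually_elim
    case (elim w)
    have i: "set_integrable lborel B (\<lambda>r. S (t' - r) (A (u r w)))" if "B \<in> sets borel" "B \<subseteq> {0..t}" for t' B
      using elim(3) t that by blast
    have "S (t - s) (LINT r:{0..s}|lborel. S (s - r) (A (u r w))) =
        (LINT r:{0..s}|lborel. S (t - r) (A (u r w)))"
      unfolding set_lebesgue_integral_def
      using i[of "{0..s}" s] st
      by (subst integral_bounded_linear[OF S_bounded, symmetric])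
        (auto simp: set_integrable_def linear_scale[OF S_linear] S_group)
    moreover have "(LINT r:{0..t}|lborel. S (t - r) (A (u r w))) =
        (LINT r:{0..s}|lborel. S (t - r) (A (u r w))) + (LINT r:{s<..t}|lborel. S (t - r) (A (u r w)))"
    proof -
      have "{0..t} = {0..s} \<union> {s<..t}" using st by auto
      then show ?thesis using st by (simp only:) (intro set_integral_Un i; auto)
    qed
    ultimately show ?case
      unfolding remainder_def noise_def drift_def elim(1,2)
      by (simp add: linear_add[OF S_linear] S_group)
  qed
qed

lemma remainder_norm:
  assumes st: "0 \<le> s" "s \<le> t" "t \<le> T"
    and K: "0 \<le> K" "\<And>r. r \<in> {0..T} \<Longrightarrow> (nn_mean_square M (u r)) \<le> ennreal K"
  shows "mean_square M (remainder s t) \<le> C\<^sup>2 * K * (t - s)\<^sup>2"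
proof -
  define h where "h = t - s"
  have h: "0 \<le> h" "emeasure lborel {s<..t} = ennreal h" using st by (simp_all add: h_def)
  have "ennreal (mean_square M (remainder s t)) = (nn_mean_square M (remainder s t))"
    using nn_integral_second_moment[OF second_moment_remainder] st by simp
  also have "\<dots> \<le> (\<integral>\<^sup>+w. ennreal (C\<^sup>2 * h) * (\<integral>\<^sup>+r\<in>{s<..t}. ennreal ((norm (u r w))\<^sup>2) \<partial>lborel) \<partial>M)"
  proof (rule nn_integral_mono_AE)
    show "AE w in M. ennreal ((norm (remainder s t w))\<^sup>2) \<le>
        ennreal (C\<^sup>2 * h) * (\<integral>\<^sup>+r\<in>{s<..t}. ennreal ((norm (u r w))\<^sup>2) \<partial>lborel)"
      using remainder_eq_drift[OF st(1,2)] AE_space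
    proof eventually_elim
      case (elim w)
      show ?case unfolding elim(1) by (rule drift_norm_square) (use elim(2) h in auto)
    qed
  qed
  also have "\<dots> = ennreal (C\<^sup>2 * h) * (\<integral>\<^sup>+w. (\<integral>\<^sup>+r\<in>{s<..t}. ennreal ((norm (u r w))\<^sup>2) \<partial>lborel) \<partial>M)"
    by (rule nn_integral_cmult) measurable
  also have "(\<integral>\<^sup>+w. (\<integral>\<^sup>+r\<in>{s<..t}. ennreal ((norm (u r w))\<^sup>2) \<partial>lborel) \<partial>M) =
      (\<integral>\<^sup>+r. (\<integral>\<^sup>+w. ennreal ((norm (u r w))\<^sup>2) * indicator {s<..t} r \<partial>M) \<partial>lborel)"
    by (rule time_space.Fubini') measurable
  also have "\<dots> \<le> (\<integral>\<^sup>+r. ennreal K * indicator {s<..t} r \<partial>lborel)"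
    using K(2) st by (intro nn_integral_mono) (auto simp: indicator_def)
  also have "\<dots> = ennreal K * ennreal h" using h by (subst nn_integral_cmult) auto
  finally have "ennreal (mean_square M (remainder s t)) \<le> ennreal (C\<^sup>2 * h) * (ennreal K * ennreal h)"
    by (simp add: mult_left_mono)
  also have "\<dots> = ennreal (C\<^sup>2 * h * (K * h))"
    using h(1) K(1) by (simp only: ennreal_mult mult_nonneg_nonneg zero_le_power2)
  also have "C\<^sup>2 * h * (K * h) = C\<^sup>2 * K * h\<^sup>2" by (simp add: power2_eq_square)
  finally show ?thesis using K(1) by (simp add: h_def)
qed

text \<open>The noise decides the order: its second moment is linear in \<open>t - s\<close>, while
  that of the remainder is quadratic and is absorbed through \<open>t - s \<le> T\<close>.\<close>

lemma deviation_norm: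
  assumes st: "0 \<le> s" "s \<le> t" "t \<le> T"
    and K: "0 \<le> K" "\<And>r. r \<in> {0..T} \<Longrightarrow> (nn_mean_square M (u r)) \<le> ennreal K"
  shows "(\<integral>w. (norm (u t w - S (t - s) (u s w)))\<^sup>2 \<partial>M) \<le> (2 * C\<^sup>2 * K * T + 2 * trace_op e Q) * (t - s)"
proof -
  note sm = second_moment_integrable[OF second_moment_remainder[OF st(1,2)]] second_moment_integrable[OF noise_facts(1)[OF st(1,2)]]
  have "(\<integral>w. (norm (u t w - S (t - s) (u s w)))\<^sup>2 \<partial>M) \<le>
      (\<integral>w. 2 * (norm (remainder s t w))\<^sup>2 + 2 * (norm (noise s t w))\<^sup>2 \<partial>M)"
  proof (rule integral_mono)
    show "integrable M (\<lambda>w. (norm (u t w - S (t - s) (u s w)))\<^sup>2)"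
      using st by (intro second_moment_integrable second_moment_diff u_moment second_moment_flow) auto
    show "(norm (u t w - S (t - s) (u s w)))\<^sup>2 \<le> 2 * (norm (remainder s t w))\<^sup>2 + 2 * (norm (noise s t w))\<^sup>2" for w
      using norm_add_square_le[of "remainder s t w" "noise s t w"] by (simp add: remainder_def)
  qed (use sm in simp)
  also have "\<dots> \<le> 2 * (C\<^sup>2 * K * (t - s)\<^sup>2) + 2 * ((t - s) * trace_op e Q)"
    using sm remainder_norm[OF st K] noise_facts(2)[OF st(1,2)] by simp
  also have "\<dots> \<le> 2 * (C\<^sup>2 * K * (T * (t - s))) + 2 * ((t - s) * trace_op e Q)"
    using st K(1) by (intro add_right_mono mult_left_mono) (auto simp: power2_eq_square intro!: mult_right_mono)
  finally show ?thesis by (simp add: algebra_simps)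
qed

text \<open>
  Skewness of \<open>A\<close> cancels the leading part of \<open>S(t - s) u(s) \<bullet> S(t - r) A u(r)\<close>, leaving only the
  deviation of \<open>u(r)\<close> from the free flow.
\<close>

lemma flow_inner_drift:
  assumes "0 < \<delta>"
  shows "\<bar>S (t - s) x \<bullet> S (t - r) (A y)\<bar> \<le> C / 2 * (\<delta> * (norm x)\<^sup>2 + (norm (y - S (r - s) x))\<^sup>2 / \<delta>)"
proof -
  let ?x = "S (r - s) x"
  have "S (t - s) x \<bullet> S (t - r) (A y) = ?x \<bullet> A y"
    using S_inner[of "t - r" ?x "A y"] by (simp add: S_group)
  also have "\<dots> = ?x \<bullet> A (y - ?x)"
    by (simp add: linear_diff[OF A_linear] inner_diff_right A_skew)
  finally have "\<bar>S (t - s) x \<bullet> S (t - r) (A y)\<bar> = \<bar>?x \<bullet> A (y - ?x)\<bar>" by simp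
  also have "\<dots> \<le> norm ?x * norm (A (y - ?x))" by (rule Cauchy_Schwarz_ineq2)
  also have "\<dots> \<le> norm x * (C * norm (y - ?x))"
    by (intro mult_mono A_bound) (simp_all add: S_norm)
  also have "\<dots> = C / 2 * (2 * \<bar>norm x \<bullet> norm (y - ?x)\<bar>)" by simp
  also have "\<dots> \<le> C / 2 * (\<delta> * (norm (norm x))\<^sup>2 + (norm (norm (y - ?x)))\<^sup>2 / \<delta>)"
    using C by (intro mult_left_mono inner_le_weighted assms) auto
  finally show ?thesis by simp
qed

text \<open>\<open>K\<close> controls the flow and \<open>D\<close> the deviation from it. If
  \<open>D\<close> has order \<open>h\<close> with \<open>h = t - s\<close>, the weight
  \<open>\<delta> = sqrt h\<close> makes the right side of order \<open>h * sqrt h\<close>.\<close>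

lemma flow_inner_remainder:
  assumes st: "0 \<le> s" "s < t" "t \<le> T" and \<delta>: "0 < \<delta>"
    and K: "0 \<le> K" "\<And>r. r \<in> {0..T} \<Longrightarrow> (nn_mean_square M (u r)) \<le> ennreal K"
    and D: "\<And>r. s \<le> r \<Longrightarrow> r \<le> t \<Longrightarrow> (\<integral>w. (norm (u r w - S (r - s) (u s w)))\<^sup>2 \<partial>M) \<le> D"
  shows "\<bar>\<integral>w. S (t - s) (u s w) \<bullet> remainder s t w \<partial>M\<bar> \<le> C / 2 * (\<delta> * K + D / \<delta>) * (t - s)"
proof -
  \<comment> \<open>The bound of \<open>flow_inner_drift\<close> for \<open>x = u s w\<close> and
    \<open>y = u r w\<close>.\<close>
  define g where "g r w = C / 2 * (\<delta> * (norm (u s w))\<^sup>2 + (norm (u r w - S (r - s) (u s w)))\<^sup>2 / \<delta>)" for r w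
  have g0: "0 \<le> g r w" for r w using C \<delta> by (simp add: g_def)
  have D0: "0 \<le> D" using D[of s] st by (auto intro: order_trans[rotated])
  have [measurable]: "(\<lambda>(w, r). g r w) \<in> borel_measurable (M \<Otimes>\<^sub>M borel)"
    "(\<lambda>(r, w). g r w) \<in> borel_measurable (borel \<Otimes>\<^sub>M M)" "g r \<in> borel_measurable M" for r
    unfolding g_def by measurable
  have K': "mean_square M (u s) \<le> K"
    using K(2)[of s] nn_integral_second_moment[OF u_moment[OF st(1)]] st K(1) by (simp add: ennreal_le_iff)
  have Eg: "(\<integral>\<^sup>+w. ennreal (g r w) \<partial>M) \<le> ennreal (C / 2 * (\<delta> * K + D / \<delta>))" if r: "r \<in> {s<..t}" for r
  proof -
    have i: "integrable M (\<lambda>w. (norm (u s w))\<^sup>2)" "integrable M (\<lambda>w. (norm (u r w - S (r - s) (u s w)))\<^sup>2)"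
      using st r by (auto intro!: second_moment_integrable second_moment_diff u_moment second_moment_flow)
    have "(\<integral>\<^sup>+w. ennreal (g r w) \<partial>M) = ennreal (\<integral>w. g r w \<partial>M)"
      using i g0 by (intro nn_integral_eq_integral) (auto simp: g_def)
    also have "(\<integral>w. g r w \<partial>M) = C / 2 * (\<delta> * (mean_square M (u s)) +
        (\<integral>w. (norm (u r w - S (r - s) (u s w)))\<^sup>2 \<partial>M) / \<delta>)"
      unfolding g_def using i by simp
    also have "\<dots> \<le> C / 2 * (\<delta> * K + D / \<delta>)"
      using C \<delta> K' D[of r] r by (intro mult_left_mono add_mono divide_right_mono) auto
    finally show ?thesis by (simp add: ennreal_leI)
  qed
  have "ennreal \<bar>\<integral>w. S (t - s) (u s w) \<bullet> remainder s t w \<partial>M\<bar> \<le>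
      (\<integral>\<^sup>+w. ennreal \<bar>S (t - s) (u s w) \<bullet> remainder s t w\<bar> \<partial>M)"
    using integral_norm_bound_ennreal[OF second_moment_inner_integrable[OF second_moment_flow second_moment_remainder], of s s t "t - s"] st
    by simp
  also have "\<dots> \<le> (\<integral>\<^sup>+w. (\<integral>\<^sup>+r\<in>{s<..t}. ennreal (g r w) \<partial>lborel) \<partial>M)"
  proof (rule nn_integral_mono_AE)
    show "AE w in M. ennreal \<bar>S (t - s) (u s w) \<bullet> remainder s t w\<bar> \<le> (\<integral>\<^sup>+r\<in>{s<..t}. ennreal (g r w) \<partial>lborel)"
      using remainder_eq_drift[OF st(1) less_imp_le[OF st(2)]] AE_drift_integrable
    proof eventually_elim
      case (elim w)
      let ?f = "\<lambda>r. indicator {s<..t} r *\<^sub>R S (t - r) (A (u r w))"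
      have i: "integrable lborel ?f"
        using elim(2)[rule_format, of t "{s<..t}" t] st by (simp add: set_integrable_def subset_iff)
      have "S (t - s) (u s w) \<bullet> remainder s t w = (\<integral>r. S (t - s) (u s w) \<bullet> ?f r \<partial>lborel)"
        unfolding elim(1) drift_def set_lebesgue_integral_def
        by (rule integral_inner_right[symmetric]) (rule i)
      then have "ennreal \<bar>S (t - s) (u s w) \<bullet> remainder s t w\<bar> \<le>
          (\<integral>\<^sup>+r. ennreal \<bar>S (t - s) (u s w) \<bullet> ?f r\<bar> \<partial>lborel)"
        using integral_norm_bound_ennreal[OF integrable_inner_right[OF i], of "S (t - s) (u s w)"] by simp
      also have "\<dots> \<le> (\<integral>\<^sup>+r\<in>{s<..t}. ennreal (g r w) \<partial>lborel)"
        using flow_inner_drift[OF \<delta>] by (intro nn_integral_mono) (auto simp: g_def indicator_def ennreal_leI)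
      finally show ?case .
    qed
  qed
  also have "\<dots> = (\<integral>\<^sup>+r. (\<integral>\<^sup>+w. ennreal (g r w) * indicator {s<..t} r \<partial>M) \<partial>lborel)"
    by (rule time_space.Fubini') measurable
  also have "\<dots> \<le> (\<integral>\<^sup>+r. ennreal (C / 2 * (\<delta> * K + D / \<delta>)) * indicator {s<..t} r \<partial>lborel)"
    using Eg by (intro nn_integral_mono) (auto simp: indicator_def)
  also have "\<dots> = ennreal (C / 2 * (\<delta> * K + D / \<delta>)) * ennreal (t - s)"
    using st by (subst nn_integral_cmult) auto
  also have "\<dots> = ennreal (C / 2 * (\<delta> * K + D / \<delta>) * (t - s))"
    using st by (simp only: ennreal_mult'' diff_ge_0_iff_ge less_imp_le)
  finally show ?thesis
    using C \<delta> K(1) D0 st by (subst (asm) ennreal_le_iff) auto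
qed

lemma energy_increment:
  assumes st: "0 \<le> s" "s < t" "t \<le> T"
    and K: "0 \<le> K" "\<And>r. r \<in> {0..T} \<Longrightarrow> (nn_mean_square M (u r)) \<le> ennreal K"
  defines "K1 \<equiv> 2 * C\<^sup>2 * K * T + 2 * trace_op e Q"
  shows "\<bar>(mean_square M (u t)) - (mean_square M (u s)) - (t - s) * trace_op e Q\<bar> \<le>
    (C\<^sup>2 * K * sqrt T + C * (K + K1) + trace_op e Q + C\<^sup>2 * K) * ((t - s) * sqrt (t - s))"
proof -
  define h where "h = t - s"
  \<comment> \<open>With this weight both halves of each weighted estimate below have order
    \<open>h * \<delta>\<close>.\<close>
  define \<delta> where "\<delta> = sqrt h"
  have h: "0 < h" "h \<le> T" using st by (auto simp: h_def)
  then have \<delta>: "0 < \<delta>" "\<delta> \<le> sqrt T" and h\<delta>: "h = \<delta> * \<delta>" by (auto simp: \<delta>_def)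
  have st': "0 \<le> s" "s \<le> t" "t \<le> T" using st by auto
  let ?w = "\<lambda>w. S (t - s) (u s w)" and ?P = "remainder s t" and ?Z = "noise s t"
  note sm = second_moment_flow[OF st'(1), of "t - s"] second_moment_remainder[OF st'(1,2)] noise_facts(1)[OF st'(1,2)]
  note sq = sm[THEN second_moment_integrable]
  have K1: "0 \<le> K1" using K(1) st trace_nonneg by (simp add: K1_def)
  \<comment> \<open>The free flow started at \<open>s\<close> is known at time \<open>s\<close>, as
    orthogonality to the noise over \<open>(s, t]\<close> demands.\<close>
  have "?w \<in> borel_measurable (F s)"
    by (rule S_measurable) (use u_adapted[OF st(1)] in auto)
  then have wZ: "(\<integral>w. ?w w \<bullet> ?Z w \<partial>M) = 0"
    using noise_facts(3)[OF st'(1,2) _ sm(1)] by simp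
  have P: "mean_square M ?P \<le> C\<^sup>2 * K * h\<^sup>2"
    using remainder_norm[OF st' K] by (simp add: h_def)
  have Z: "mean_square M ?Z = h * trace_op e Q"
    using noise_facts(2)[OF st'(1,2)] by (simp add: h_def)
  have D: "(\<integral>w. (norm (u r w - S (r - s) (u s w)))\<^sup>2 \<partial>M) \<le> K1 * h" if "s \<le> r" "r \<le> t" for r
  proof -
    have "(\<integral>w. (norm (u r w - S (r - s) (u s w)))\<^sup>2 \<partial>M) \<le> K1 * (r - s)"
      unfolding K1_def by (rule deviation_norm) (use that st K in auto)
    also have "\<dots> \<le> K1 * h" using that K1 by (intro mult_left_mono) (auto simp: h_def)
    finally show ?thesis .
  qed
  have wP: "\<bar>\<integral>w. ?w w \<bullet> ?P w \<partial>M\<bar> \<le> C / 2 * (\<delta> * K + K1 * h / \<delta>) * h"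
    using flow_inner_remainder[OF st \<delta>(1) K D] by (simp add: h_def)
  \<comment> \<open>Noise and remainder are correlated, so this term is estimated rather than
    cancelled.\<close>
  have "\<bar>\<integral>w. 2 * (?Z w \<bullet> ?P w) \<partial>M\<bar> \<le> (\<integral>w. \<bar>2 * (?Z w \<bullet> ?P w)\<bar> \<partial>M)"
    by (rule integral_abs_bound)
  also have "\<dots> \<le> (\<integral>w. \<delta> * (norm (?Z w))\<^sup>2 + (norm (?P w))\<^sup>2 / \<delta> \<partial>M)"
    using sq second_moment_inner_integrable[OF sm(3,2)] inner_le_weighted[OF \<delta>(1)]
    by (intro integral_mono) (auto simp: abs_mult)
  also have "\<dots> \<le> \<delta> * (h * trace_op e Q) + C\<^sup>2 * K * h\<^sup>2 / \<delta>"
    using sq P Z \<delta> by (simp add: divide_right_mono)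
  finally have ZP: "\<bar>\<integral>w. 2 * (?Z w \<bullet> ?P w) \<partial>M\<bar> \<le> \<delta> * (h * trace_op e Q) + C\<^sup>2 * K * h\<^sup>2 / \<delta>" .
  have "mean_square M (u t) =
      (\<integral>w. (norm (?w w))\<^sup>2 + (norm (?P w))\<^sup>2 + (norm (?Z w))\<^sup>2 + 2 * (?w w \<bullet> ?P w) + 2 * (?w w \<bullet> ?Z w) + 2 * (?Z w \<bullet> ?P w) \<partial>M)"
  proof (rule Bochner_Integration.integral_cong[OF refl])
    fix w
    have u: "u t w = ?w w + ?P w + ?Z w" by (simp add: remainder_def)
    show "(norm (u t w))\<^sup>2 = (norm (?w w))\<^sup>2 + (norm (?P w))\<^sup>2 + (norm (?Z w))\<^sup>2 + 2 * (?w w \<bullet> ?P w) + 2 * (?w w \<bullet> ?Z w) + 2 * (?Z w \<bullet> ?P w)"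
      unfolding u by (simp add: power2_norm_eq_inner inner_add_left inner_add_right inner_commute)
  qed
  also have "\<dots> = (mean_square M (u s)) + (mean_square M ?P) + h * trace_op e Q +
      2 * (\<integral>w. ?w w \<bullet> ?P w \<partial>M) + (\<integral>w. 2 * (?Z w \<bullet> ?P w) \<partial>M)"
    using sq second_moment_inner_integrable[OF sm(3,2)] second_moment_inner_integrable[OF sm(1,2)]
      second_moment_inner_integrable[OF sm(1,3)] wZ Z S_norm by simp
  moreover have P0: "0 \<le> (mean_square M ?P)" by simp
  ultimately have "\<bar>(mean_square M (u t)) - (mean_square M (u s)) - h * trace_op e Q\<bar> \<le>
      (mean_square M ?P) + 2 * \<bar>\<integral>w. ?w w \<bullet> ?P w \<partial>M\<bar> + \<bar>\<integral>w. 2 * (?Z w \<bullet> ?P w) \<partial>M\<bar>"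
    by linarith
  also have "\<dots> \<le> C\<^sup>2 * K * h\<^sup>2 + 2 * (C / 2 * (\<delta> * K + K1 * h / \<delta>) * h) + (\<delta> * (h * trace_op e Q) + C\<^sup>2 * K * h\<^sup>2 / \<delta>)"
    using P wP ZP by linarith
  also have "\<dots> = C\<^sup>2 * K * \<delta> * (h * \<delta>) + C * (K + K1) * (h * \<delta>) + trace_op e Q * (h * \<delta>) + C\<^sup>2 * K * (h * \<delta>)"
    using \<delta>(1) by (simp add: h\<delta> power2_eq_square field_simps)
  \<comment> \<open>The first term has the higher order h^2; one factor
    \<open>\<delta> \<le> sqrt T\<close> is given up to reach the common order.\<close>
  also have "\<dots> \<le> C\<^sup>2 * K * sqrt T * (h * \<delta>) + C * (K + K1) * (h * \<delta>) + trace_op e Q * (h * \<delta>) + C\<^sup>2 * K * (h * \<delta>)"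
    using \<delta> h K(1) by (intro add_right_mono mult_right_mono mult_left_mono) auto
  finally show ?thesis by (simp add: h_def \<delta>_def algebra_simps)
qed

text \<open>The mild equation at time 0 holds almost surely; there the drift is an integral over a
  single point and \<open>X 0\<close> has second moment 0.\<close>

lemma energy_zero: "mean_square M (u 0) = (\<integral>w. (norm (u\<^sub>0 w))\<^sup>2 \<partial>M)"
proof (rule integral_cong_AE)
  have X0: "AE w in M. (norm (X 0 w))\<^sup>2 = 0"
    using X_moment[of 0] integral_nonneg_eq_0_iff_AE[OF second_moment_integrable[OF X_moment(1)[of 0]]] by simp
  have drift0: "(LINT r:{0..0}|lborel. S (0 - r) (A (u r w))) = 0" for w
    unfolding set_lebesgue_integral_def by (intro integral_eq_zero_AE AE_I'[of "{0}"]) (auto simp: indicator_def)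
  show "AE w in M. (norm (u 0 w))\<^sup>2 = (norm (u\<^sub>0 w))\<^sup>2"
    using X0 mild[OF order_refl]
  proof eventually_elim
    case (elim w)
    from elim(1) have "X 0 w = 0" by simp
    then show ?case unfolding elim(2) drift0 by (simp add: linear_0[OF J(1)] S_norm)
  qed
qed measurable

lemma energy_identity:
  assumes t: "0 \<le> t"
  shows "mean_square M (u t) = (\<integral>w. (norm (u\<^sub>0 w))\<^sup>2 \<partial>M) + t * trace_op e Q"
proof (cases "t = 0")
  case False
  with t have T: "0 < t" by simp
  obtain K where K: "0 \<le> K" "\<And>r. r \<in> {0..t} \<Longrightarrow> (nn_mean_square M (u r)) \<le> ennreal K"
    using a_priori_bound[OF t] by blast
  have "(\<lambda>t. (mean_square M (u t)) - t * trace_op e Q) t = (\<lambda>t. (mean_square M (u t)) - t * trace_op e Q) 0"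
  proof (rule constant_of_increments[OF T])
    fix s r assume "0 \<le> s" "s < r" "r \<le> t"
    from energy_increment[OF this K]
    show "\<bar>((mean_square M (u r)) - r * trace_op e Q) - ((mean_square M (u s)) - s * trace_op e Q)\<bar> \<le>
      (C\<^sup>2 * K * sqrt t + C * (K + (2 * C\<^sup>2 * K * t + 2 * trace_op e Q)) + trace_op e Q + C\<^sup>2 * K) * ((r - s) * sqrt (r - s))"
      by (simp add: algebra_simps)
  qed
  then show ?thesis by (simp add: energy_zero)
qed (simp add: energy_zero)

end

section \<open>Fourier series on the torus\<close>

lemma integral_cis:
  fixes n :: int
  shows "(\<integral>y. indicator {0..<2 * pi} y *\<^sub>R cis (of_int n * y) \<partial>lborel) = (if n = 0 then 2 * pi else 0 :: complex)"
    and "integrable lborel (\<lambda>y. indicator {0..<2 * pi} y *\<^sub>R cis (of_int n * y))"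
proof -
  have c: "continuous_on A (\<lambda>y. cis (of_int n * y))" for A
    unfolding cis_conv_exp by (intro continuous_intros)
  have i: "integrable lborel (\<lambda>y. indicator {0..2 * pi} y *\<^sub>R cis (of_int n * y))"
    using borel_integrable_atLeastAtMost'[OF c] by (simp add: set_integrable_def)
  have [measurable]: "(\<lambda>y. cis (of_int n * y)) \<in> borel_measurable borel"
    by (rule borel_measurable_continuous_onI[OF c])
  \<comment> \<open>The torus is cut out by half-open intervals, the fundamental theorem of calculus
    speaks of closed ones; they differ by a null set.\<close>
  have ae: "AE y in lborel. indicator {0..<2 * pi} y *\<^sub>R cis (of_int n * y) = indicator {0..2 * pi} y *\<^sub>R cis (of_int n * y)"
    by (rule AE_I'[of "{2 * pi}"]) (auto simp: indicator_def)
  show "integrable lborel (\<lambda>y. indicator {0..<2 * pi} y *\<^sub>R cis (of_int n * y))"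
    using i ae by (subst integrable_cong_AE) auto
  have eq: "(\<integral>y. indicator {0..<2 * pi} y *\<^sub>R cis (of_int n * y) \<partial>lborel) =
      (\<integral>y. indicator {0..2 * pi} y *\<^sub>R cis (of_int n * y) \<partial>lborel)"
    using ae by (intro integral_cong_AE) auto
  show "(\<integral>y. indicator {0..<2 * pi} y *\<^sub>R cis (of_int n * y) \<partial>lborel) = (if n = 0 then 2 * pi else 0 :: complex)"
  proof (cases "n = 0")
    case False
    have "(\<integral>y. indicator {0..2 * pi} y *\<^sub>R cis (of_int n * y) \<partial>lborel) =
        cis (of_int n * (2 * pi)) / (\<i> * of_int n) - cis (of_int n * 0) / (\<i> * of_int n)"
    proof (rule integral_FTC_atLeastAtMost[OF _ _ c])
      show "((\<lambda>y. cis (of_int n * y) / (\<i> * of_int n)) has_vector_derivative cis (of_int n * x)) (at x within {0..2 * pi})" for x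
      proof -
        have "((\<lambda>z. exp (\<i> * (of_int n * z)) / (\<i> * of_int n)) has_field_derivative exp (\<i> * (of_int n * of_real x))) (at (of_real x))"
          using False by (auto intro!: derivative_eq_intros simp: ac_simps)
        from has_vector_derivative_real_field[OF this]
        show ?thesis by (simp add: cis_conv_exp)
      qed
    qed simp
    also have "cis (of_int n * (2 * pi)) = 1"
      by (metis cis_multiple_2pi Ints_of_int mult.commute mult.assoc)
    finally show ?thesis using False eq by simp
  qed (use eq in \<open>simp add: scaleR_conv_of_real\<close>)
qed

lemma torus_cube: "space torus = {x::real ^ 'd::finite. \<forall>i. 0 \<le> x $ i \<and> x $ i < 2 * pi}"
  by (simp add: torus_def space_restrict_space)

lemma prod_cis: "(\<Prod>i\<in>I. cis (f i)) = cis (\<Sum>i\<in>I. f i)"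
  by (induction I rule: infinite_finite_induct) (auto simp: cis_mult)

text \<open>The integrand is a product of functions of single coordinates, and one nonzero
  \<open>k $ i\<close> suffices to make its factor integrate to 0.\<close>

lemma integral_mode:
  fixes k :: "int ^ 'd::finite"
  shows "(\<integral>x. cis (phase k x) \<partial>torus) = (if k = 0 then (2 * pi) ^ CARD('d) else 0 :: complex)"
proof -
  let ?C = "{x::real ^ 'd. \<forall>i. 0 \<le> x $ i \<and> x $ i < 2 * pi}"
  let ?B = "Basis :: (real ^ 'd) set"
  \<comment> \<open>Lebesgue measure appears below as a product over the basis vectors, so the
    frequency of coordinate \<open>i\<close> is attached to \<open>axis i 1\<close>.\<close>
  define n where "n b = (\<Sum>i\<in>UNIV. if b = axis i 1 then k $ i else 0)" for b :: "real ^ 'd"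
  have n: "n (axis i 1) = k $ i" for i
  proof -
    have "n (axis i 1) = (\<Sum>j\<in>UNIV. if j = i then k $ j else 0)"
      unfolding n_def by (intro sum.cong) (auto simp: axis_eq_axis)
    then show ?thesis by simp
  qed
  have Basis: "?B = (\<lambda>i. axis i 1) ` UNIV" by (auto simp: Basis_vec_def)
  have inj: "inj (\<lambda>i. axis i 1 :: real ^ 'd)" by (auto simp: inj_def axis_eq_axis)
  define g where "g b y = indicator {0..<2 * pi} y *\<^sub>R cis (of_int (n b) * y)" for b :: "real ^ 'd" and y :: real
  have gm: "g b \<in> borel_measurable borel" for b
    using integral_cis(2)[of "n b", THEN borel_measurable_integrable] unfolding g_def[abs_def] by simp
  have "(\<integral>x. cis (phase k x) \<partial>torus) = (\<integral>x. indicator ?C x *\<^sub>R cis (phase k x) \<partial>lborel)"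
    unfolding torus_def using cube_sets[where 'd='d] by (subst integral_restrict_space) auto
  also have "(\<lambda>x. indicator ?C x *\<^sub>R cis (phase k x)) = (\<lambda>x. \<Prod>b\<in>?B. g b (x \<bullet> b))"
  proof
    fix x :: "real ^ 'd"
    have "(\<Prod>b\<in>?B. g b (x \<bullet> b)) = (\<Prod>i\<in>UNIV. indicator {0..<2 * pi} (x $ i) *\<^sub>R cis (of_int (k $ i) * (x $ i)))"
      unfolding Basis by (subst prod.reindex[OF inj]) (simp add: g_def n inner_axis)
    also have "\<dots> = (\<Prod>i\<in>UNIV. of_real (indicator {0..<2 * pi} (x $ i))) * cis (phase k x)"
      by (simp add: scaleR_conv_of_real prod.distrib phase_def prod_cis)
    also have "(\<Prod>i\<in>UNIV. of_real (indicator {0..<2 * pi} (x $ i))) = (of_real (indicator ?C x) :: complex)"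
    proof (cases "x \<in> ?C")
      case False
      then obtain i where "x $ i \<notin> {0..<2 * pi}" by auto
      then have "of_real (indicator {0..<2 * pi} (x $ i)) = (0 :: complex)" by simp
      then have "(\<Prod>i\<in>UNIV. of_real (indicator {0..<2 * pi} (x $ i))) = (0 :: complex)"
        by (intro prod_zero) auto
      then show ?thesis using False by simp
    qed simp
    finally show "indicator ?C x *\<^sub>R cis (phase k x) = (\<Prod>b\<in>?B. g b (x \<bullet> b))"
      by (simp add: scaleR_conv_of_real)
  qed
  also have "(\<integral>x. (\<Prod>b\<in>?B. g b (x \<bullet> b)) \<partial>lborel) =
      (\<integral>f. (\<Prod>b\<in>?B. g b ((\<Sum>b\<in>?B. f b *\<^sub>R b) \<bullet> b)) \<partial>(\<Pi>\<^sub>M b\<in>?B. lborel))"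
    using gm by (subst lborel_eq, subst integral_distr) (auto intro!: borel_measurable_prod measurable_compose[OF _ gm])
  also have "\<dots> = (\<integral>f. (\<Prod>b\<in>?B. g b (f b)) \<partial>(\<Pi>\<^sub>M b\<in>?B. lborel))"
    by (intro Bochner_Integration.integral_cong refl prod.cong) (simp add: inner_sum_left inner_Basis if_distrib cong: if_cong)
  also have "\<dots> = (\<Prod>b\<in>?B. integral\<^sup>L lborel (g b))"
  proof -
    interpret product_sigma_finite "\<lambda>b :: real ^ 'd. lborel :: real measure"
      by standard
    show ?thesis
      by (rule product_integral_prod) (auto simp: g_def integral_cis(2))
  qed
  also have "\<dots> = (\<Prod>i\<in>(UNIV::'d set). if k $ i = 0 then 2 * pi else 0 :: complex)"
    unfolding Basis using integral_cis(1)
    by (subst prod.reindex[OF inj]) (simp add: g_def[abs_def] n)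
  also have "\<dots> = (if k = 0 then (2 * pi) ^ CARD('d) else 0 :: complex)"
  proof (cases "k = 0")
    case False
    then obtain i where "k $ i \<noteq> 0" by (auto simp: vec_eq_iff)
    then show ?thesis using False by (auto intro: prod_zero)
  qed simp
  finally show ?thesis .
qed

section \<open>The complex inner product\<close>

lift_definition cinner :: "'d::finite L2 \<Rightarrow> 'd L2 \<Rightarrow> complex" is "\<lambda>f g. \<integral>x. f x * cnj (g x) \<partial>torus"
  by (rule inner_cong)

lemma inner_eq_cinner: "u \<bullet> v = Re (cinner u v)"
  by transfer simp

lemma cinner_add_left: "cinner (u + v) z = cinner u z + cinner v z"
  by transfer (simp add: distrib_right sqi_prod_integrable)

lemma cinner_cscale_left: "cinner (c *\<^sub>C u) v = c * cinner u v"
  by transfer (simp add: mult.assoc)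

lemma cinner_commute: "cinner u v = cnj (cinner v u)"
  by transfer (simp add: mult.commute flip: Bochner_Integration.integral_cnj)

lemma cscale_add_right: "c *\<^sub>C (u + v) = c *\<^sub>C u + c *\<^sub>C v"
  by transfer (auto simp: algebra_simps intro!: sqi_add sqi_cmult)

lemma cscale_add_left: "(c + d) *\<^sub>C u = c *\<^sub>C u + d *\<^sub>C u"
  by transfer (auto simp: algebra_simps intro!: sqi_add sqi_cmult)

lemma cscale_cscale: "c *\<^sub>C d *\<^sub>C u = (c * d) *\<^sub>C u"
  by transfer (auto simp: algebra_simps intro!: sqi_cmult)

lemma cscale_of_real: "of_real r *\<^sub>C u = r *\<^sub>R u"
  by transfer (auto simp: scaleR_conv_of_real intro!: sqi_cmult)

lemma cscale_scaleR: "c *\<^sub>C r *\<^sub>R u = r *\<^sub>R c *\<^sub>C u"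
  by (simp add: cscale_cscale mult.commute flip: cscale_of_real)

lemma cscale_linear: "linear (\<lambda>u. c *\<^sub>C u)"
  by (intro linearI) (simp_all add: cscale_add_right cscale_scaleR)

lemma cinner_cscale_right: "cinner u (c *\<^sub>C v) = cnj c * cinner u v"
  by (metis cinner_commute cinner_cscale_left complex_cnj_mult)

lemma cinner_self: "cinner u u = of_real ((norm u)\<^sup>2)"
proof (rule complex_eqI)
  show "Re (cinner u u) = Re (of_real ((norm u)\<^sup>2))"
    by (simp add: power2_norm_eq_inner inner_eq_cinner)
  have "Im (cinner u u) = - Im (cinner u u)"
    by (subst cinner_commute) simp
  then show "Im (cinner u u) = Im (of_real ((norm u)\<^sup>2))" by simp
qed

lemma norm_cscale: "norm (c *\<^sub>C u) = cmod c * norm u"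
proof -
  have "complex_of_real ((norm (c *\<^sub>C u))\<^sup>2) = c * cnj c * of_real ((norm u)\<^sup>2)"
    by (simp only: cinner_self[symmetric] cinner_cscale_left cinner_cscale_right ac_simps)
  also have "\<dots> = of_real ((cmod c * norm u)\<^sup>2)"
    by (simp add: power_mult_distrib flip: complex_norm_square)
  finally have "(norm (c *\<^sub>C u))\<^sup>2 = (cmod c * norm u)\<^sup>2" by (simp only: of_real_eq_iff)
  then show ?thesis by (simp add: power2_eq_iff_nonneg)
qed

lemma bounded_linear_cscale: "bounded_linear (\<lambda>u. c *\<^sub>C u)"
  by (intro bounded_linear_intro[where K="cmod c"])
    (simp_all add: cscale_add_right cscale_scaleR norm_cscale mult.commute)

lemma bounded_linear_cscale_left: "bounded_linear (\<lambda>c. c *\<^sub>C u)"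
  by (intro bounded_linear_intro[where K="norm u"])
    (simp_all add: cscale_add_left norm_cscale cscale_cscale scaleR_conv_of_real flip: cscale_of_real)

lemma cinner_le: "cmod (cinner u v) \<le> norm u * norm v"
proof (cases "cinner u v = 0")
  case False
  \<comment> \<open>A unimodular factor that turns the inner product into its absolute value, so
    that Cauchy-Schwarz for the real part applies.\<close>
  define c where "c = cnj (sgn (cinner u v))"
  have "cmod c = 1" using False by (simp add: c_def norm_sgn)
  have "complex_of_real (cmod (cinner u v)) = c * cinner u v"
  proof -
    have "complex_of_real (cmod (cinner u v)) * complex_of_real (cmod (cinner u v)) = cinner u v * cnj (cinner u v)"
      using complex_norm_square[of "cinner u v"] by (simp add: power2_eq_square)
    then show ?thesis using False by (simp add: c_def sgn_eq field_simps)
  qed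
  then have "cmod (cinner u v) = Re (cinner (c *\<^sub>C u) v)"
    by (metis Re_complex_of_real cinner_cscale_left)
  also have "\<dots> \<le> norm (c *\<^sub>C u) * norm v"
    unfolding inner_eq_cinner[symmetric] by (rule norm_cauchy_schwarz)
  finally show ?thesis using \<open>cmod c = 1\<close> by (simp add: norm_cscale)
qed simp

lemma bounded_linear_cinner_left: "bounded_linear (\<lambda>u. cinner u v)"
  by (intro bounded_linear_intro[where K="norm v"])
    (simp_all add: cinner_add_left cinner_cscale_left cinner_le scaleR_conv_of_real flip: cscale_of_real)

lemma fourier_coeff_cinner: "fourier_coeff u k = cinner u (fourier_mode k) / (2 * pi) ^ CARD('d)"
  for u :: "'d::finite L2"
  by transfer (simp add: cis_cnj)

lemma cinner_modes: "cinner (fourier_mode k) (fourier_mode l) = (if k = l then (2 * pi) ^ CARD('d) else 0)"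
  for k l :: "int ^ 'd::finite"
proof -
  have "cinner (fourier_mode k) (fourier_mode l) = (\<integral>x. cis (phase (k - l) x) \<partial>torus)"
    by transfer (simp add: cis_cnj cis_mult phase_def sum_subtractf algebra_simps)
  then show ?thesis by (simp add: integral_mode)
qed

lemma fourier_coeff_bounded_linear: "bounded_linear (\<lambda>u. fourier_coeff u k)"
  unfolding fourier_coeff_cinner divide_inverse
  by (rule bounded_linear_mult_const[OF bounded_linear_cinner_left])

lemma fourier_coeff_mode: "fourier_coeff (fourier_mode k) l = (if k = l then 1 else 0)"
  by (simp add: fourier_coeff_cinner cinner_modes)

lemma fourier_coeff_cscale: "fourier_coeff (c *\<^sub>C u) k = c * fourier_coeff u k"
  by (simp add: fourier_coeff_cinner cinner_cscale_left)

section \<open>Completeness of the Fourier modes\<close>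

definition circle_map :: "real ^ 'd \<Rightarrow> complex ^ 'd" where
  "circle_map x = (\<chi> i. cis (x $ i))"

lemma continuous_circle_map: "continuous_on A (circle_map :: real ^ 'd::finite \<Rightarrow> complex ^ 'd)"
  unfolding circle_map_def[abs_def] cis_conv_exp
  by (intro continuous_on_vec_lambda continuous_intros)

text \<open>Uniform approximation by polynomials needs a compact set, which the half-open cube is
  not. Its injective image in the product of unit circles has a compact ambient set, and continuous
  functions there are automatically periodic in \<open>x\<close>.\<close>

lemma circle_map_inj:
  fixes x y :: "real ^ 'd::finite"
  assumes "x \<in> space torus" "y \<in> space torus" "circle_map x = circle_map y"
  shows "x = y"
proof -
  have "x $ i = y $ i" for i
  proof -
    have "cis (x $ i) = cis (y $ i)" using assms(3) by (simp add: circle_map_def vec_eq_iff)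
    then have "cis (x $ i - y $ i) = 1" by (simp flip: cis_divide)
    then have "cos (x $ i - y $ i) = 1" by (simp add: complex_eq_iff)
    then obtain m :: int where m: "x $ i - y $ i = of_int m * 2 * pi"
      by (auto simp: cos_one_2pi_int)
    have "\<bar>x $ i - y $ i\<bar> < 2 * pi" using assms(1,2) by (auto simp: torus_cube abs_less_iff) (smt (verit))+
    then have "\<bar>real_of_int m\<bar> < 1" unfolding m by (simp add: abs_mult)
    then have "m = 0" by linarith
    with m show ?thesis by simp
  qed
  then show ?thesis by (simp add: vec_eq_iff)
qed

lemma borel_measurable_torusI:
  "f \<in> borel_measurable borel \<Longrightarrow> f \<in> borel_measurable torus"
  unfolding torus_def by (intro measurable_restrict_space1) simp

lemma circle_map_measurable [measurable]: "circle_map \<in> borel_measurable torus"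
  by (intro borel_measurable_torusI borel_measurable_continuous_onI continuous_circle_map)

text \<open>The goal is that these functions vanish almost everywhere. The sign of the phase is
  immaterial because \<open>k\<close> runs over the whole lattice; functions are used instead of
  classes because they get multiplied pointwise.\<close>

definition null_coeffs :: "(real ^ 'd::finite \<Rightarrow> complex) set" where
  "null_coeffs = {f. square_integrable f \<and> (\<forall>k. (\<integral>x. f x * cis (phase k x) \<partial>torus) = 0)}"

text \<open>
  Multipliers of \<open>null_coeffs\<close> form an algebra containing the characters, so by Weierstrass they
  approximate all continuous functions of \<open>circle_map\<close>.
\<close>

definition null_multiplier :: "(real ^ 'd::finite \<Rightarrow> complex) \<Rightarrow> bool" where
  "null_multiplier g \<longleftrightarrow> (\<forall>f\<in>null_coeffs. (\<lambda>x. g x * f x) \<in> null_coeffs)"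

lemma sqi_mode_integrable:
  "square_integrable f \<Longrightarrow> integrable torus (\<lambda>x. f x * cis (phase k x))"
  using sqi_prod_integrable[of f "\<lambda>x. cis (- phase k x)"] sqi_bounded[OF phase_measurable[of "-1" k], of 1]
  by (simp add: cis_cnj)

lemma null_multiplier_add: "null_multiplier g \<Longrightarrow> null_multiplier h \<Longrightarrow> null_multiplier (\<lambda>x. g x + h x)"
  by (auto simp: null_multiplier_def null_coeffs_def distrib_right sqi_add sqi_mode_integrable)

lemma null_multiplier_mult: "null_multiplier g \<Longrightarrow> null_multiplier h \<Longrightarrow> null_multiplier (\<lambda>x. g x * h x)"
  unfolding null_multiplier_def by (auto simp: mult.assoc)

lemma null_multiplier_const: "null_multiplier (\<lambda>x. c)"
  by (auto simp: null_multiplier_def null_coeffs_def mult.assoc sqi_cmult)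

lemma null_multiplier_sum: "(\<And>i. i \<in> I \<Longrightarrow> null_multiplier (g i)) \<Longrightarrow> null_multiplier (\<lambda>x. \<Sum>i\<in>I. g i x)"
  by (induction I rule: infinite_finite_induct) (auto intro: null_multiplier_add null_multiplier_const)

lemma null_multiplier_mode: "null_multiplier (\<lambda>x. cis (phase k x))"
  unfolding null_multiplier_def null_coeffs_def
proof safe
  fix f :: "real ^ 'a \<Rightarrow> complex"
  assume f: "square_integrable f" "\<forall>k. (\<integral>x. f x * cis (phase k x) \<partial>torus) = 0"
  show "square_integrable (\<lambda>x. cis (phase k x) * f x)"
    using f(1) phase_measurable[of 1 k] by (auto simp: square_integrable_def norm_mult)
  fix l
  have "(\<lambda>x. cis (phase k x) * f x * cis (phase l x)) = (\<lambda>x. f x * cis (phase (k + l) x))"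
    by (simp add: fun_eq_iff phase_def distrib_right sum.distrib flip: cis_mult)
  then show "(\<integral>x. cis (phase k x) * f x * cis (phase l x) \<partial>torus) = 0" using f(2) by simp
qed

lemma null_multiplier_coordinate: "null_multiplier (\<lambda>x. cis (x $ i))" "null_multiplier (\<lambda>x. cis (- (x $ i)))"
proof -
  have "phase (axis i 1) x = x $ i" "phase (- axis i 1) x = - (x $ i)" for x :: "real ^ 'a"
  proof -
    have "(\<Sum>j\<in>UNIV. real_of_int ((axis i 1 :: int ^ 'a) $ j) * x $ j) = (\<Sum>j\<in>UNIV. if j = i then x $ j else 0)"
      by (intro sum.cong) (auto simp: axis_def)
    then show "phase (axis i 1) x = x $ i" "phase (- axis i 1) x = - (x $ i)"
      by (simp_all add: phase_def sum_negf)
  qed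
  then show "null_multiplier (\<lambda>x. cis (x $ i))" "null_multiplier (\<lambda>x. cis (- (x $ i)))"
    using null_multiplier_mode[of "axis i 1"] null_multiplier_mode[of "- axis i 1"] by simp_all
qed

text \<open>A real-linear functional of \<open>circle_map x\<close> is a combination of the cosines
  and sines of the coordinates, that is, of the characters with frequencies \<open>axis i 1\<close>
  and \<open>- axis i 1\<close>.\<close>

lemma null_multiplier_polynomial:
  assumes "real_polynomial_function p"
  shows "null_multiplier (\<lambda>x. complex_of_real (p (circle_map x)))"
  using assms
proof (induction p rule: real_polynomial_function.induct)
  case (linear h)
  interpret h: bounded_linear h by (rule linear)
  have "complex_of_real (h (circle_map x)) =
      (\<Sum>i\<in>UNIV. of_real (h (axis i 1)) / 2 * (cis (x $ i) + cis (- (x $ i))) +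
        of_real (h (axis i \<i>)) / (2 * \<i>) * (cis (x $ i) + - 1 * cis (- (x $ i))))" for x :: "real ^ 'a"
  proof -
    have "circle_map x = (\<Sum>i\<in>UNIV. cos (x $ i) *\<^sub>R axis i 1 + sin (x $ i) *\<^sub>R axis i \<i>)"
      by (simp add: vec_eq_iff circle_map_def axis_def complex_eq_iff sum.distrib if_distrib cong: if_cong)
    then have "h (circle_map x) = (\<Sum>i\<in>UNIV. cos (x $ i) * h (axis i 1) + sin (x $ i) * h (axis i \<i>))"
      by (simp add: h.sum h.add h.scaleR)
    then show ?thesis
      by (simp only: of_real_sum) (intro sum.cong refl, simp add: complex_eq_iff)
  qed
  then show ?case
    by (simp only:) (intro null_multiplier_sum null_multiplier_add null_multiplier_mult
      null_multiplier_const null_multiplier_coordinate)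
qed (auto intro: null_multiplier_add null_multiplier_mult null_multiplier_const)

lemma null_coeffs_integral: "f \<in> null_coeffs \<Longrightarrow> (\<integral>x. f x \<partial>torus) = 0"
proof -
  assume "f \<in> null_coeffs"
  then have "(\<integral>x. f x * cis (phase 0 x) \<partial>torus) = 0" by (simp add: null_coeffs_def)
  then show ?thesis by (simp add: phase_def)
qed

lemma sqi_integrable: "square_integrable f \<Longrightarrow> integrable torus f"
  using sqi_mode_integrable[of f 0] by (simp add: phase_def)

text \<open>A polynomial in \<open>circle_map\<close> times \<open>f\<close> stays in
  \<open>null_coeffs\<close> and so has integral 0. By the Stone-Weierstrass theorem on the product
  of unit circles, \<open>H\<close> differs from such a polynomial by less than \<open>e\<close>,
  which costs at most \<open>e\<close> times the L^1 norm of \<open>f\<close>.\<close>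

lemma null_coeffs_continuous:
  fixes f :: "real ^ 'd::finite \<Rightarrow> complex"
  assumes f: "f \<in> null_coeffs" and H: "continuous_on UNIV (H :: complex ^ 'd \<Rightarrow> real)"
  shows "(\<integral>x. of_real (H (circle_map x)) * f x \<partial>torus) = 0"
proof -
  let ?S = "{z :: complex ^ 'd. \<forall>i. cmod (z $ i) = 1}"
  have sf: "square_integrable f" using f by (simp add: null_coeffs_def)
  note [measurable] = sqi_measurable[OF sf]
  have "closed ?S"
    by (intro closed_Collect_all closed_Collect_eq continuous_intros)
  moreover have "bounded ?S"
  proof (rule boundedI)
    fix z assume "z \<in> ?S"
    then have "(\<Sum>i\<in>UNIV. norm (z $ i)) = real CARD('d)" by simp
    then show "norm z \<le> real CARD('d)" using L2_set_le_sum[of UNIV "\<lambda>i. norm (z $ i)"] by (simp add: norm_vec_def)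
  qed
  ultimately have S: "compact ?S" by (simp add: compact_eq_bounded_closed)
  have HS: "continuous_on ?S H" using H by (rule continuous_on_subset) simp
  have in_S: "circle_map x \<in> ?S" for x by (simp add: circle_map_def)
  have [measurable]: "H \<in> borel_measurable borel" by (rule borel_measurable_continuous_onI[OF H])
  define m where "m = (\<integral>x. cmod (f x) \<partial>torus)"
  have m0: "0 \<le> m" by (simp add: m_def)
  have "cmod (\<integral>x. of_real (H (circle_map x)) * f x \<partial>torus) \<le> e * m" if e: "0 < e" for e
  proof -
    obtain p where p: "real_polynomial_function p" "\<And>z. z \<in> ?S \<Longrightarrow> \<bar>H z - p z\<bar> < e"
      using Stone_Weierstrass_real_polynomial_function[OF S HS e] by blast
    have pf: "(\<lambda>x. of_real (p (circle_map x)) * f x) \<in> null_coeffs"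
      using null_multiplier_polynomial[OF p(1)] f by (simp add: null_multiplier_def)
    then have ip: "integrable torus (\<lambda>x. of_real (p (circle_map x)) * f x)"
      by (auto simp: null_coeffs_def intro: sqi_integrable)
    have [measurable]: "p \<in> borel_measurable borel"
      using continuous_on_polymonial_function[of p UNIV] p(1)
      by (intro borel_measurable_continuous_onI) (simp add: real_polynomial_function_eq)
    let ?D = "\<lambda>x. of_real (H (circle_map x)) * f x - of_real (p (circle_map x)) * f x"
    have bd: "cmod (?D x) \<le> e * cmod (f x)" for x
    proof -
      have "cmod (?D x) =
          \<bar>H (circle_map x) - p (circle_map x)\<bar> * cmod (f x)"
        by (simp add: norm_mult flip: left_diff_distrib of_real_diff)
      also have "\<dots> \<le> e * cmod (f x)" using p(2)[OF in_S, of x] by (intro mult_right_mono) auto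
      finally show ?thesis .
    qed
    have "integrable torus (\<lambda>x. ?D x)"
    proof (rule Bochner_Integration.integrable_bound)
      show "integrable torus (\<lambda>x. e * cmod (f x))" using sqi_integrable[OF sf] by simp
      show "AE x in torus. cmod (?D x) \<le> norm (e * cmod (f x))"
        using bd that by (auto simp: norm_mult)
    qed measurable
    then have id: "integrable torus (\<lambda>x. ?D x)" .
    have "(\<integral>x. of_real (H (circle_map x)) * f x \<partial>torus) =
        (\<integral>x. ?D x + of_real (p (circle_map x)) * f x \<partial>torus)"
      by simp
    also have "\<dots> = (\<integral>x. ?D x \<partial>torus)"
      by (subst Bochner_Integration.integral_add[OF id ip]) (simp add: null_coeffs_integral[OF pf])
    also have "cmod \<dots> \<le> (\<integral>x. cmod (?D x) \<partial>torus)"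
      by (rule integral_norm_bound)
    also have "\<dots> \<le> (\<integral>x. e * cmod (f x) \<partial>torus)"
      using id sqi_integrable[OF sf] bd by (intro integral_mono) auto
    finally show ?thesis by (simp add: m_def)
  qed
  note bound = this
  \<comment> \<open>The L^1 norm \<open>m\<close> may be 0; then already the bound with
    \<open>e = 1\<close> gives the value 0.\<close>
  have "cmod (\<integral>x. of_real (H (circle_map x)) * f x \<partial>torus) \<le> 0 + e" if "0 < e" for e
    using bound[of "e / m"] bound[of 1] that m0 by (cases "m = 0") auto
  then have "cmod (\<integral>x. of_real (H (circle_map x)) * f x \<partial>torus) \<le> 0" by (rule field_le_epsilon)
  then show ?thesis by simp
qed

text \<open>Tent functions around the image of \<open>K\<close> converge to the indicator of
  \<open>K\<close>: injectivity of \<open>circle_map\<close> on the cube keeps the images of points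
  outside \<open>K\<close> at a positive distance.\<close>

lemma null_coeffs_compact:
  fixes f :: "real ^ 'd::finite \<Rightarrow> complex"
  assumes f: "f \<in> null_coeffs" and K: "compact K" "K \<noteq> {}" "K \<subseteq> space torus"
  shows "(\<integral>x. indicator K x *\<^sub>R f x \<partial>torus) = 0"
proof -
  have sf: "square_integrable f" using f by (simp add: null_coeffs_def)
  note [measurable] = sqi_measurable[OF sf]
  let ?K = "circle_map ` K"
  have cK: "compact ?K" by (intro compact_continuous_image continuous_circle_map K)
  define H where "H n z = max 0 (1 - real n * infdist z ?K)" for n z
  have cH: "continuous_on UNIV (H n)" for n
    unfolding H_def by (intro continuous_intros)
  have [measurable]: "H n \<in> borel_measurable borel" for n by (rule borel_measurable_continuous_onI[OF cH])
  have H01: "\<bar>H n z\<bar> \<le> 1" for n z by (simp add: H_def infdist_nonneg)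
  have lim: "(\<lambda>n. H n (circle_map x)) \<longlonglongrightarrow> indicator K x" if x: "x \<in> space torus" for x
  proof (cases "x \<in> K")
    case True
    then show ?thesis by (simp add: H_def)
  next
    case False
    have "circle_map x \<notin> ?K" using circle_map_inj[OF x] K(3) False by auto
    then have d: "infdist (circle_map x) ?K > 0"
      using cK K(2) by (intro infdist_pos_not_in_closed compact_imp_closed) auto
    obtain N :: nat where N: "1 / infdist (circle_map x) ?K < real N" using reals_Archimedean2 by blast
    have "H n (circle_map x) = 0" if "N \<le> n" for n
    proof -
      have "1 < real N * infdist (circle_map x) ?K" using N d by (simp add: field_simps)
      also have "\<dots> \<le> real n * infdist (circle_map x) ?K" using that d by (intro mult_right_mono) auto
      finally show ?thesis by (simp add: H_def)
    qed
    then have "eventually (\<lambda>n. H n (circle_map x) = 0) sequentially"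
      by (auto simp: eventually_sequentially)
    then show ?thesis using False by (simp add: tendsto_eventually)
  qed
  have "(\<lambda>n. \<integral>x. of_real (H n (circle_map x)) * f x \<partial>torus) \<longlonglongrightarrow> (\<integral>x. indicator K x *\<^sub>R f x \<partial>torus)"
  proof (rule Bochner_Integration.integral_dominated_convergence[where w="\<lambda>x. cmod (f x)"])
    have "K \<in> sets borel" using K(1) by (simp add: borel_compact)
    then have "(indicator K :: _ \<Rightarrow> real) \<in> borel_measurable torus"
      by (intro borel_measurable_torusI) simp
    then show "(\<lambda>x. indicator K x *\<^sub>R f x) \<in> borel_measurable torus" by measurable
    show "(\<lambda>x. of_real (H n (circle_map x)) * f x) \<in> borel_measurable torus" for n by measurable
    show "integrable torus (\<lambda>x. cmod (f x))" using sqi_integrable[OF sf] by simp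
    show "AE x in torus. (\<lambda>n. of_real (H n (circle_map x)) * f x) \<longlonglongrightarrow> indicator K x *\<^sub>R f x"
      using lim by (intro AE_I2) (auto simp: scaleR_conv_of_real intro!: tendsto_mult_right tendsto_of_real)
    show "AE x in torus. norm (of_real (H n (circle_map x)) * f x) \<le> cmod (f x)" for n
      using H01[of n] by (intro AE_I2) (simp add: norm_mult mult_left_le_one_le)
  qed
  then show ?thesis using null_coeffs_continuous[OF f cH] by (simp add: LIMSEQ_const_iff)
qed

lemma torus_inner_regular:
  fixes E :: "(real ^ 'd::finite) set"
  assumes E: "E \<in> sets torus" "0 < emeasure torus E"
  shows "\<exists>K. compact K \<and> K \<subseteq> E \<and> 0 < emeasure torus K \<and> K \<in> sets torus"
proof -
  let ?C = "space torus :: (real ^ 'd) set"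
  have C: "?C \<in> sets borel" using cube_sets[where 'd='d] by (simp add: torus_cube)
  have sets: "A \<in> sets torus \<longleftrightarrow> A \<in> sets borel \<and> A \<subseteq> ?C" for A
    using cube_sets[where 'd='d] by (auto simp: torus_def torus_cube sets_restrict_space_iff)
  have em: "emeasure torus A = emeasure lborel A" if "A \<in> sets borel" "A \<subseteq> ?C" for A
    using that cube_sets[where 'd='d] by (simp add: torus_def torus_cube emeasure_restrict_space)
  \<comment> \<open>Inner regularity concerns finite Borel measures on the whole space; this one
    agrees with the torus measure on the cube and vanishes off it.\<close>
  let ?N = "density lborel (indicator ?C) :: (real ^ 'd) measure"
  have N: "emeasure ?N A = emeasure lborel (A \<inter> ?C)" if "A \<in> sets borel" for A
    using that C by (simp add: emeasure_density Int_commute flip: indicator_inter_arith)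
  have "emeasure ?N E = (SUP K \<in> {K. K \<subseteq> E \<and> compact K}. emeasure ?N K)"
  proof (rule inner_regular)
    show "emeasure ?N (space ?N) \<noteq> \<infinity>"
      using N[of UNIV] em[OF C order_refl] torus.emeasure_finite[of ?C] by simp
  qed (use E sets in auto)
  moreover have "0 < emeasure ?N E" using E sets[of E] N[of E] em[of E] by (simp add: Int_absorb2)
  ultimately obtain K where K: "K \<subseteq> E" "compact K" "0 < emeasure ?N K"
    by (auto simp: less_SUP_iff)
  have "K \<in> sets borel" "K \<subseteq> ?C" using K E sets by (auto simp: borel_compact)
  then show ?thesis using K N[of K] em[of K] sets[of K] by (auto simp: Int_absorb2)
qed

text \<open>If \<open>Re (c * f x)\<close> exceeded a positive constant on a set of positive
  measure, it would do so on a compact \<open>K\<close> of positive measure, and the integral of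
  \<open>f\<close> over \<open>K\<close> could not be 0. The four directions
  \<open>c = 1, - 1, \<i>, - \<i>\<close> together force \<open>f x = 0\<close>.\<close>

lemma null_coeffs_AE_zero:
  fixes f :: "real ^ 'd::finite \<Rightarrow> complex"
  assumes f: "f \<in> null_coeffs"
  shows "AE x in torus. f x = 0"
proof -
  have sf: "square_integrable f" using f by (simp add: null_coeffs_def)
  note [measurable] = sqi_measurable[OF sf]
  have nonpos: "AE x in torus. Re (c * f x) \<le> 0" for c
  proof -
    have "AE x in torus. \<not> 1 / real (Suc n) < Re (c * f x)" for n
    proof (rule ccontr)
      define E where "E = {x \<in> space torus. 1 / real (Suc n) < Re (c * f x)}"
      have E: "E \<in> sets torus" unfolding E_def by measurable
      assume "\<not> (AE x in torus. \<not> 1 / real (Suc n) < Re (c * f x))"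
      then have "emeasure torus E \<noteq> 0"
        using AE_iff_measurable[OF E, of "\<lambda>x. \<not> 1 / real (Suc n) < Re (c * f x)"] by (simp add: E_def)
      then have "0 < emeasure torus E" by (simp add: zero_less_iff_neq_zero)
      from torus_inner_regular[OF E this] obtain K where K: "compact K" "K \<subseteq> E" "0 < emeasure torus K" "K \<in> sets torus"
        by blast
      note K(4)[measurable]
      have "K \<noteq> {}" "K \<subseteq> space torus" using K by (auto simp: E_def)
      then have zero: "(\<integral>x. indicator K x *\<^sub>R f x \<partial>torus) = 0"
        using null_coeffs_compact[OF f K(1)] by blast
      have i: "integrable torus (\<lambda>x. indicator K x *\<^sub>R f x)"
        by (intro integrable_mult_indicator K sqi_integrable sf)
      have "(1 / real (Suc n)) * measure torus K = (\<integral>x. indicator K x * (1 / real (Suc n)) \<partial>torus)"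
        using K(4) by simp
      also have "\<dots> \<le> (\<integral>x. Re (c * (indicator K x *\<^sub>R f x)) \<partial>torus)"
      proof (rule integral_mono)
        show "integrable torus (\<lambda>x. indicator K x * (1 / real (Suc n)))"
          by (intro integrable_mult_left integrable_real_indicator K(4)) (simp add: torus.emeasure_finite flip: less_top)
        show "integrable torus (\<lambda>x. Re (c * (indicator K x *\<^sub>R f x)))"
          using i by (intro integrable_Re integrable_mult_right)
        show "indicator K x * (1 / real (Suc n)) \<le> Re (c * (indicator K x *\<^sub>R f x))" for x
          using K(2) by (auto simp: indicator_def E_def)
      qed
      also have "\<dots> = Re (c * (\<integral>x. indicator K x *\<^sub>R f x \<partial>torus))"
        using i by (simp only: integral_Re integrable_mult_right integral_mult_right_zero)
      also have "\<dots> = 0" by (simp only: zero) simp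
      finally have "measure torus K \<le> 0" by (simp add: field_simps)
      then show False using K(3) by (simp add: torus.emeasure_eq_measure)
    qed
    then have "AE x in torus. \<forall>n. \<not> 1 / real (Suc n) < Re (c * f x)" by (simp add: AE_all_countable)
    then show ?thesis
    proof eventually_elim
      case (elim x)
      show ?case
      proof (rule ccontr)
        assume "\<not> Re (c * f x) \<le> 0"
        then obtain n where "1 / real (Suc n) < Re (c * f x)" using nat_approx_posE[of "Re (c * f x)"] by auto
        with elim show False by blast
      qed
    qed
  qed
  show ?thesis
    using nonpos[of 1] nonpos[of "- 1"] nonpos[of \<i>] nonpos[of "- \<i>"]
    by eventually_elim (simp add: complex_eq_iff)
qed

lemma fourier_coeff_zero_imp_zero:
  assumes "\<And>k. fourier_coeff u k = 0"
  shows "u = 0"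
proof -
  obtain f where f: "square_integrable f" "u = abs_L2 f" by (rule L2_cases)
  have 0: "(\<integral>x. f x * cis (- phase k x) \<partial>torus) = 0" for k
    using assms[of k] f by (simp add: fourier_coeff.abs_eq eq_onp_def)
  have "(\<integral>x. f x * cis (phase k x) \<partial>torus) = 0" for k
    using 0[of "- k"] by (simp add: phase_def sum_negf)
  then have "AE x in torus. f x = 0" using f(1) by (intro null_coeffs_AE_zero) (simp add: null_coeffs_def)
  then show ?thesis
    unfolding f(2) zero_L2_def by (intro abs_L2_eqI f(1) sqi_zero)
qed

lemma fourier_coeff_add: "fourier_coeff (u + v) k = fourier_coeff u k + fourier_coeff v k"
  using bounded_linear.linear[OF fourier_coeff_bounded_linear] by (rule linear_add)

lemma fourier_coeff_diff: "fourier_coeff (u - v) k = fourier_coeff u k - fourier_coeff v k"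
  using bounded_linear.linear[OF fourier_coeff_bounded_linear] by (rule linear_diff)

lemma fourier_coeff_scaleR: "fourier_coeff (r *\<^sub>R u) k = r *\<^sub>R fourier_coeff u k"
  using bounded_linear.linear[OF fourier_coeff_bounded_linear] by (rule linear_scale)

lemma fourier_coeff_eqI:
  assumes "\<And>k. fourier_coeff u k = fourier_coeff v k" shows "u = v"
  using fourier_coeff_zero_imp_zero[of "u - v"] assms by (simp add: fourier_coeff_diff)

section \<open>Fourier series and Parseval's identity\<close>

definition torus_volume :: "'d::finite itself \<Rightarrow> real" where
  "torus_volume _ = (2 * pi) ^ CARD('d)"

lemma torus_volume_pos: "0 < torus_volume TYPE('d::finite)"
  by (simp add: torus_volume_def)

lemma cinner_trig_polynomial:
  fixes u :: "'d::finite L2"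
  assumes "finite I"
  shows "cinner u (\<Sum>k\<in>I. a k *\<^sub>C fourier_mode k) = torus_volume TYPE('d) * (\<Sum>k\<in>I. cnj (a k) * fourier_coeff u k)"
proof -
  have "cinner u (\<Sum>k\<in>I. a k *\<^sub>C fourier_mode k) = cnj (cinner (\<Sum>k\<in>I. a k *\<^sub>C fourier_mode k) u)"
    by (rule cinner_commute)
  also have "\<dots> = (\<Sum>k\<in>I. cinner u (a k *\<^sub>C fourier_mode k))"
    by (simp add: linear_sum[OF bounded_linear.linear[OF bounded_linear_cinner_left]] flip: cinner_commute)
  also have "\<dots> = torus_volume TYPE('d) * (\<Sum>k\<in>I. cnj (a k) * fourier_coeff u k)"
    by (simp add: cinner_cscale_right fourier_coeff_cinner torus_volume_def sum_distrib_left)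
  finally show ?thesis .
qed

lemma fourier_coeff_trig_polynomial:
  assumes "finite I"
  shows "fourier_coeff (\<Sum>k\<in>I. a k *\<^sub>C fourier_mode k) l = (if l \<in> I then a l else 0)"
  using assms
  by (simp add: linear_sum[OF bounded_linear.linear[OF fourier_coeff_bounded_linear]]
    fourier_coeff_cscale fourier_coeff_mode if_distrib cong: if_cong)

text \<open>The modes are orthogonal but not normalized: each has \<open>torus_volume\<close> as its
  squared norm, and this factor persists up to \<open>parseval\<close>.\<close>

lemma norm_trig_polynomial:
  fixes a :: "int ^ 'd::finite \<Rightarrow> complex"
  assumes "finite I"
  shows "(norm (\<Sum>k\<in>I. a k *\<^sub>C fourier_mode k))\<^sup>2 = torus_volume TYPE('d) * (\<Sum>k\<in>I. (cmod (a k))\<^sup>2)"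
proof -
  let ?p = "\<Sum>k\<in>I. a k *\<^sub>C fourier_mode k"
  have "complex_of_real ((norm ?p)\<^sup>2) = torus_volume TYPE('d) * (\<Sum>k\<in>I. cnj (a k) * fourier_coeff ?p k)"
    unfolding cinner_self[symmetric] by (rule cinner_trig_polynomial[OF assms])
  also have "(\<Sum>k\<in>I. cnj (a k) * fourier_coeff ?p k) = (\<Sum>k\<in>I. of_real ((cmod (a k))\<^sup>2))"
    using assms by (intro sum.cong refl)
      (simp add: fourier_coeff_trig_polynomial complex_norm_square mult.commute del: of_real_power)
  finally have "complex_of_real ((norm ?p)\<^sup>2) = of_real (torus_volume TYPE('d) * (\<Sum>k\<in>I. (cmod (a k))\<^sup>2))"
    by (simp only: of_real_mult of_real_sum)
  then show ?thesis by (simp only: of_real_eq_iff)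
qed

abbreviation fourier_sum :: "(int ^ 'd) set \<Rightarrow> 'd::finite L2 \<Rightarrow> 'd L2" where
  "fourier_sum I u \<equiv> (\<Sum>k\<in>I. fourier_coeff u k *\<^sub>C fourier_mode k)"

text \<open>The partial sum is an orthogonal projection of \<open>u\<close>. Nonnegativity of the
  left side is Bessel's inequality, which yields
  \<open>fourier_coeff_square_summable\<close>.\<close>

lemma norm_fourier_tail:
  fixes u :: "'d::finite L2"
  assumes "finite I"
  shows "(norm (u - (fourier_sum I u)))\<^sup>2 =
    (norm u)\<^sup>2 - torus_volume TYPE('d) * (\<Sum>k\<in>I. (cmod (fourier_coeff u k))\<^sup>2)"
proof -
  let ?p = "fourier_sum I u"
  have "u \<bullet> ?p = Re (of_real (torus_volume TYPE('d)) * (\<Sum>k\<in>I. cnj (fourier_coeff u k) * fourier_coeff u k))"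
    unfolding inner_eq_cinner cinner_trig_polynomial[OF assms] by simp
  also have "(\<Sum>k\<in>I. cnj (fourier_coeff u k) * fourier_coeff u k) = of_real (\<Sum>k\<in>I. (cmod (fourier_coeff u k))\<^sup>2)"
    unfolding of_real_sum complex_norm_square by (intro sum.cong refl mult.commute)
  finally have "u \<bullet> ?p = torus_volume TYPE('d) * (\<Sum>k\<in>I. (cmod (fourier_coeff u k))\<^sup>2)"
    by (simp only: Re_complex_of_real flip: of_real_mult)
  moreover have "(norm (u - ?p))\<^sup>2 = (norm u)\<^sup>2 - 2 * (u \<bullet> ?p) + (norm ?p)\<^sup>2"
    by (simp add: power2_norm_eq_inner algebra_simps inner_commute)
  ultimately show ?thesis by (simp add: norm_trig_polynomial[OF assms])
qed

lemma fourier_coeff_square_summable: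
  fixes u :: "'d::finite L2"
  shows "(\<lambda>k. (cmod (fourier_coeff u k))\<^sup>2) summable_on UNIV"
proof (rule nonneg_bdd_above_summable_on)
  show "bdd_above (sum (\<lambda>k. (cmod (fourier_coeff u k))\<^sup>2) ` {I. I \<subseteq> UNIV \<and> finite I})"
  proof (rule bdd_aboveI2)
    fix I :: "(int ^ 'd) set" assume "I \<in> {I. I \<subseteq> UNIV \<and> finite I}"
    then have "0 \<le> (norm u)\<^sup>2 - torus_volume TYPE('d) * (\<Sum>k\<in>I. (cmod (fourier_coeff u k))\<^sup>2)"
      by (subst norm_fourier_tail[symmetric]) auto
    then show "(\<Sum>k\<in>I. (cmod (fourier_coeff u k))\<^sup>2) \<le> (norm u)\<^sup>2 / torus_volume TYPE('d)"
      using torus_volume_pos[where 'd='d] by (simp add: field_simps)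
  qed
qed simp

text \<open>The Riesz-Fischer theorem. By orthogonality the distance of partial sums is a tail of
  the series of squares, so the net of finite partial sums is Cauchy and completeness of the space
  provides the limit.\<close>

lemma modes_summable:
  fixes a :: "int ^ 'd::finite \<Rightarrow> complex"
  assumes a: "(\<lambda>k. (cmod (a k))\<^sup>2) summable_on UNIV"
  shows "(\<lambda>k. a k *\<^sub>C fourier_mode k) summable_on UNIV"
proof -
  let ?f = "\<lambda>k. a k *\<^sub>C (fourier_mode k :: 'd L2)" and ?v = "torus_volume TYPE('d)"
  obtain s where s: "((\<lambda>k. (cmod (a k))\<^sup>2) has_sum s) UNIV" using a by (auto simp: summable_on_def)
  have v: "0 < ?v" by (rule torus_volume_pos)
  have "\<exists>P. eventually P (finite_subsets_at_top UNIV) \<and> (\<forall>I J. P I \<and> P J \<longrightarrow> dist (sum ?f I) (sum ?f J) < e)"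
    if e: "0 < e" for e
  proof -
    \<comment> \<open>A squared distance of partial sums is \<open>?v\<close> times a sum of
      squares, and each of two such distances may use up \<open>e / 2\<close>.\<close>
    have "eventually (\<lambda>I. dist (\<Sum>k\<in>I. (cmod (a k))\<^sup>2) s < (e / 2)\<^sup>2 / ?v) (finite_subsets_at_top UNIV)"
      using s[unfolded has_sum_def] e v by (intro tendstoD) auto
    then obtain I0 where I0: "finite I0" "dist (\<Sum>k\<in>I0. (cmod (a k))\<^sup>2) s < (e / 2)\<^sup>2 / ?v"
      by (auto simp: eventually_finite_subsets_at_top)
    have small: "dist (sum ?f I) (sum ?f I0) < e / 2" if I: "finite I" "I0 \<subseteq> I" for I
    proof -
      have "(\<Sum>k\<in>I. (cmod (a k))\<^sup>2) \<le> s"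
        by (rule finite_sum_le_has_sum[OF s]) (use I in auto)
      moreover have "(\<Sum>k\<in>I. (cmod (a k))\<^sup>2) = (\<Sum>k\<in>I - I0. (cmod (a k))\<^sup>2) + (\<Sum>k\<in>I0. (cmod (a k))\<^sup>2)"
        using I by (simp add: sum.subset_diff)
      ultimately have lt: "(\<Sum>k\<in>I - I0. (cmod (a k))\<^sup>2) < (e / 2)\<^sup>2 / ?v"
        using I0(2) unfolding dist_real_def by linarith
      have "(norm (sum ?f I - sum ?f I0))\<^sup>2 = (norm (sum ?f (I - I0)))\<^sup>2"
        using I by (simp add: sum_diff)
      also have "\<dots> = ?v * (\<Sum>k\<in>I - I0. (cmod (a k))\<^sup>2)"
        using I(1) by (intro norm_trig_polynomial) simp
      also have "\<dots> < ?v * ((e / 2)\<^sup>2 / ?v)"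
        by (rule mult_strict_left_mono[OF lt v])
      also have "\<dots> = (e / 2)\<^sup>2" using v by (metis nonzero_mult_div_cancel_left times_divide_eq_right less_irrefl)
      finally have "(norm (sum ?f I - sum ?f I0))\<^sup>2 < (e / 2)\<^sup>2" .
      then show ?thesis
        unfolding dist_norm by (rule power2_less_imp_less) (use e in linarith)
    qed
    define P where "P I \<longleftrightarrow> finite I \<and> I0 \<subseteq> I" for I
    have "eventually P (finite_subsets_at_top UNIV)"
      unfolding P_def using I0(1) by (auto simp: eventually_finite_subsets_at_top)
    moreover have "dist (sum ?f I) (sum ?f J) < e" if "P I" "P J" for I J
      using small[of I] small[of J] that dist_triangle2[of "sum ?f I" "sum ?f J" "sum ?f I0"]
      by (auto simp: P_def)
    ultimately show ?thesis by blast
  qed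
  then have "cauchy_filter (filtermap (sum ?f) (finite_subsets_at_top UNIV))"
    by (simp add: cauchy_filter_metric_filtermap)
  then have "convergent_filter (filtermap (sum ?f) (finite_subsets_at_top UNIV))"
    by (rule cauchy_filter_convergent)
  then obtain L where "(sum ?f \<longlongrightarrow> L) (finite_subsets_at_top UNIV)"
    by (auto simp: convergent_filter_iff filterlim_def)
  then show ?thesis using summable_on_def has_sum_def by blast
qed

lemma fourier_coeff_infsum:
  assumes a: "(\<lambda>k. (cmod (a k))\<^sup>2) summable_on UNIV"
  shows "fourier_coeff (\<Sum>\<^sub>\<infinity>k. a k *\<^sub>C fourier_mode k) l = a l"
proof -
  have "((\<lambda>k. a k *\<^sub>C fourier_mode k) has_sum (\<Sum>\<^sub>\<infinity>k. a k *\<^sub>C fourier_mode k)) UNIV"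
    using modes_summable[OF a] by (rule has_sum_infsum)
  from has_sum_bounded_linear[OF fourier_coeff_bounded_linear this, of l]
  have "((\<lambda>k. if k = l then a k else 0) has_sum fourier_coeff (\<Sum>\<^sub>\<infinity>k. a k *\<^sub>C fourier_mode k) l) UNIV"
    by (simp add: fourier_coeff_cscale fourier_coeff_mode if_distrib cong: if_cong)
  moreover have "((\<lambda>k. if k = l then a k else 0) has_sum a l) UNIV"
  proof -
    have "((\<lambda>k. if k = l then a k else 0) has_sum (\<Sum>k\<in>{l}. if k = l then a k else 0)) {l}"
      by (rule has_sum_finite) simp
    then have "((\<lambda>k. if k = l then a k else 0) has_sum a l) {l}" by simp
    also have "?this \<longleftrightarrow> ((\<lambda>k. if k = l then a k else 0) has_sum a l) UNIV"
      by (rule has_sum_cong_neutral) auto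
    finally show ?thesis .
  qed
  ultimately show ?thesis by (rule has_sum_unique)
qed

text \<open>The series converges by \<open>modes_summable\<close>, its sum has the coefficients of
  \<open>u\<close>, and by completeness the coefficients determine the function.\<close>

lemma fourier_series: "((\<lambda>k. fourier_coeff u k *\<^sub>C fourier_mode k) has_sum u) UNIV"
proof -
  have "(\<Sum>\<^sub>\<infinity>k. fourier_coeff u k *\<^sub>C fourier_mode k) = u"
    by (rule fourier_coeff_eqI, rule fourier_coeff_infsum, rule fourier_coeff_square_summable)
  then show ?thesis
    using has_sum_infsum[OF modes_summable[OF fourier_coeff_square_summable[of u]]] by simp
qed

lemma parseval:
  fixes u :: "'d::finite L2"
  shows "((\<lambda>k. torus_volume TYPE('d) * (cmod (fourier_coeff u k))\<^sup>2) has_sum (norm u)\<^sup>2) UNIV"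
proof -
  have "((\<lambda>I. (norm (fourier_sum I u))\<^sup>2) \<longlongrightarrow> (norm u)\<^sup>2) (finite_subsets_at_top UNIV)"
    using fourier_series[of u] unfolding has_sum_def by (intro tendsto_intros)
  moreover have "\<forall>\<^sub>F I in finite_subsets_at_top UNIV. (norm (fourier_sum I u))\<^sup>2 =
      (\<Sum>k\<in>I. torus_volume TYPE('d) * (cmod (fourier_coeff u k))\<^sup>2)"
    by (rule eventually_finite_subsets_at_top_weakI) (simp add: norm_trig_polynomial sum_distrib_left)
  ultimately show ?thesis unfolding has_sum_def by (rule Lim_transform_eventually)
qed

lemma norm_eqI_fourier_coeff:
  assumes "\<And>k. cmod (fourier_coeff u k) = cmod (fourier_coeff v k)"
  shows "norm u = norm v"
proof -
  have "(norm u)\<^sup>2 = (norm v)\<^sup>2"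
    using parseval[of u] parseval[of v] by (intro has_sum_unique) (simp_all add: assms)
  then show ?thesis by (simp add: power2_eq_iff_nonneg)
qed

section \<open>The free Schroedinger group\<close>

lemma fourier_coeff_group:
  "fourier_coeff (schroedinger_group t u) k = cis (t * freq_sq k) * fourier_coeff u k"
  unfolding schroedinger_group_def
  by (rule fourier_coeff_infsum) (simp add: norm_mult fourier_coeff_square_summable)

text \<open>Like the norm, composition and scalar laws that follow, this is read off from the
  multiplier coefficient by coefficient.\<close>

lemma group_linear: "linear (schroedinger_group t)"
  by (intro linearI fourier_coeff_eqI)
    (simp_all add: fourier_coeff_group fourier_coeff_add fourier_coeff_scaleR distrib_left)

lemma group_norm: "norm (schroedinger_group t u) = norm u"
  by (rule norm_eqI_fourier_coeff) (simp add: fourier_coeff_group norm_mult)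

lemma group_group: "schroedinger_group s (schroedinger_group t u) = schroedinger_group (s + t) u"
  by (rule fourier_coeff_eqI) (simp add: fourier_coeff_group distrib_right mult.assoc flip: cis_mult)

lemma group_cscale: "schroedinger_group t (c *\<^sub>C u) = c *\<^sub>C schroedinger_group t u"
  by (rule fourier_coeff_eqI) (simp add: fourier_coeff_group fourier_coeff_cscale)

text \<open>The factors \<open>cis (t * freq_sq k)\<close> have modulus 1, so the distance between
  the evolved \<open>u\<close> and its evolved partial sum does not depend on \<open>t\<close>; the
  orbit is a uniform limit of continuous trigonometric polynomials.\<close>

lemma group_continuous:
  fixes u :: "'d::finite L2"
  shows "continuous_on UNIV (\<lambda>t. schroedinger_group t u)"
proof (rule uniform_limit_theorem)
  let ?p = "\<lambda>I t. \<Sum>k\<in>I. (cis (t * freq_sq k) * fourier_coeff u k) *\<^sub>C (fourier_mode k :: 'd L2)"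
  have "continuous_on UNIV (\<lambda>t. (cis (t * r) * c) *\<^sub>C v)" for r c and v :: "'d L2"
  proof -
    have "continuous_on UNIV (\<lambda>t. cis (t * r) * c)"
      unfolding cis_conv_exp by (intro continuous_intros)
    then show ?thesis by (rule bounded_linear.continuous_on[OF bounded_linear_cscale_left])
  qed
  then show "\<forall>\<^sub>F I in finite_subsets_at_top UNIV. continuous_on UNIV (?p I)"
    by (intro always_eventually allI continuous_on_sum)
  have "((\<lambda>I. dist (fourier_sum I u) u) \<longlongrightarrow> 0) (finite_subsets_at_top UNIV)"
    by (rule tendsto_dist_iff[THEN iffD1, OF fourier_series[of u, unfolded has_sum_def]])
  then have lim: "\<forall>\<^sub>F I in finite_subsets_at_top UNIV. dist (fourier_sum I u) u < e"
    if "0 < e" for e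
    using that by (rule order_tendstoD(2))
  have eq: "dist (?p I t) (schroedinger_group t u) = dist (fourier_sum I u) u"
    if "finite I" for I t
    unfolding dist_norm using that
    by (intro norm_eqI_fourier_coeff)
      (simp add: fourier_coeff_diff fourier_coeff_trig_polynomial fourier_coeff_group norm_mult)
  show "uniform_limit UNIV ?p (\<lambda>t. schroedinger_group t u) (finite_subsets_at_top UNIV)"
    unfolding uniform_limit_iff
  proof (intro allI impI)
    fix e :: real assume "0 < e"
    have "\<forall>\<^sub>F I in finite_subsets_at_top (UNIV :: (int ^ 'd) set). finite I" by auto
    with lim[OF \<open>0 < e\<close>]
    show "\<forall>\<^sub>F I in finite_subsets_at_top UNIV. \<forall>t\<in>UNIV. dist (?p I t) (schroedinger_group t u) < e"
    proof eventually_elim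
      case (elim I)
      then show ?case by (simp only: eq) simp
    qed
  qed
qed simp

section \<open>Potentials in the Sobolev space\<close>

text \<open>The exponent shares the decay of order -2 in \<open>1 + freq_sq k\<close> among three
  coordinates. Since the weight decays like |n| to the power -4/3, its sum over the integers still
  converges.\<close>

definition lattice_weight :: "int \<Rightarrow> real" where
  "lattice_weight n = (1 + (real_of_int n)\<^sup>2) powr (- 2 / 3)"

lemma lattice_weight_sum_bounded:
  "\<exists>B. \<forall>I. finite I \<longrightarrow> (\<Sum>n\<in>I. lattice_weight n) \<le> B"
proof -
  have pos: "0 \<le> lattice_weight n" for n by (simp add: lattice_weight_def)
  have "summable (\<lambda>n. lattice_weight (int n))"
  proof (rule summable_comparison_test'[where N=1])
    show "summable (\<lambda>n. real n powr (- 4 / 3))" by (simp add: summable_real_powr_iff)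
    fix n :: nat assume "1 \<le> n"
    then have "lattice_weight (int n) \<le> ((real n)\<^sup>2) powr (- 2 / 3)"
      unfolding lattice_weight_def by (intro powr_mono2') auto
    also have "(real n)\<^sup>2 = real n powr 2" by simp
    also have "(real n powr 2) powr (- 2 / 3) = real n powr (- 4 / 3)" by (subst powr_powr) simp
    finally show "norm (lattice_weight (int n)) \<le> real n powr (- 4 / 3)" using pos by simp
  qed
  then have le: "(\<Sum>n\<in>J. lattice_weight (int n)) \<le> (\<Sum>n. lattice_weight (int n))" if "finite J" for J
    using that pos by (intro sum_le_suminf) auto
  have "(\<Sum>n\<in>I. lattice_weight n) \<le> 2 * (\<Sum>n. lattice_weight (int n))" if "finite I" for I
  proof -
    let ?P = "{n \<in> I. 0 \<le> n}" and ?N = "{n \<in> I. n < 0}"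
    have inj: "inj_on nat ?P" "inj_on (\<lambda>n. nat (- n)) ?N" by (auto simp: inj_on_def)
    have "(\<Sum>n\<in>?P. lattice_weight n) = (\<Sum>n\<in>nat ` ?P. lattice_weight (int n))"
      by (subst sum.reindex[OF inj(1)]) simp
    moreover have "(\<Sum>n\<in>?N. lattice_weight n) = (\<Sum>n\<in>(\<lambda>n. nat (- n)) ` ?N. lattice_weight (int n))"
      by (subst sum.reindex[OF inj(2)]) (simp add: lattice_weight_def)
    moreover have "(\<Sum>n\<in>I. lattice_weight n) = (\<Sum>n\<in>?P. lattice_weight n) + (\<Sum>n\<in>?N. lattice_weight n)"
      using that by (subst sum.union_disjoint[symmetric]) (auto intro: sum.cong)
    ultimately show ?thesis
      using le[of "nat ` ?P"] le[of "(\<lambda>n. nat (- n)) ` ?N"] that by simp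
  qed
  then show ?thesis by blast
qed

text \<open>
  Since \<open>(1 + |k|\<^sup>2)\<^sup>3 \<ge> \<Prod>\<^sub>i (1 + k\<^sub>i\<^sup>2)\<close> in dimension at most three, the lattice sum is
  dominated by a product of convergent one-dimensional sums.
\<close>

lemma inverse_square_freq_summable:
  assumes "CARD('d::finite) \<le> 3"
  shows "(\<lambda>k :: int ^ 'd. 1 / (1 + freq_sq k)\<^sup>2) summable_on UNIV"
proof (rule nonneg_bdd_above_summable_on)
  obtain B where B: "\<And>I. finite I \<Longrightarrow> (\<Sum>n\<in>I. lattice_weight n) \<le> B"
    using lattice_weight_sum_bounded by blast
  have le: "1 / (1 + freq_sq k)\<^sup>2 \<le> (\<Prod>i\<in>UNIV. lattice_weight (k $ i))" for k :: "int ^ 'd"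
  proof -
    have f0: "0 \<le> freq_sq k" by (simp add: freq_sq_def sum_nonneg)
    \<comment> \<open>The dimension enters here: \<open>2 / 3 * CARD('d) \<le> 2\<close>, and the
      base is at least 1.\<close>
    have "(1 + freq_sq k) powr (- 2) \<le> (1 + freq_sq k) powr (- 2 / 3 * real CARD('d))"
      using assms f0 by (intro powr_mono) auto
    also have "\<dots> = ((1 + freq_sq k) powr (- 2 / 3)) powr real CARD('d)"
      by (simp only: powr_powr)
    also have "\<dots> = (\<Prod>i\<in>(UNIV :: 'd set). (1 + freq_sq k) powr (- 2 / 3))"
      using f0 by (subst powr_realpow) auto
    also have "\<dots> \<le> (\<Prod>i\<in>UNIV. lattice_weight (k $ i))"
    proof (rule prod_mono, rule conjI)
      fix i :: 'd
      have "(real_of_int (k $ i))\<^sup>2 \<le> freq_sq k"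
        unfolding freq_sq_def by (rule member_le_sum) auto
      then show "(1 + freq_sq k) powr (- 2 / 3) \<le> lattice_weight (k $ i)"
        unfolding lattice_weight_def by (intro powr_mono2') (auto intro: add_pos_nonneg)
    qed simp
    finally show ?thesis
      using f0 by (simp add: powr_minus divide_inverse)
  qed
  show "bdd_above (sum (\<lambda>k :: int ^ 'd. 1 / (1 + freq_sq k)\<^sup>2) ` {I. I \<subseteq> UNIV \<and> finite I})"
  proof (rule bdd_aboveI2)
    fix I :: "(int ^ 'd) set" assume "I \<in> {I. I \<subseteq> UNIV \<and> finite I}"
    then have I: "finite I" by simp
    \<comment> \<open>Enclosing \<open>I\<close> in a box with sides \<open>J\<close> lets the sum
      of products factor into a product of sums.\<close>
    define J where "J = (\<Union>i. (\<lambda>k. k $ i) ` I)"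
    have J: "finite J" using I by (auto simp: J_def)
    have "(\<Sum>k\<in>I. 1 / (1 + freq_sq k)\<^sup>2) \<le> (\<Sum>k\<in>I. \<Prod>i\<in>UNIV. lattice_weight (k $ i))"
      by (intro sum_mono le)
    also have "\<dots> = (\<Sum>g\<in>vec_nth ` I. \<Prod>i\<in>UNIV. lattice_weight (g i))"
      by (subst sum.reindex) (auto simp: inj_on_def vec_nth_inject)
    also have "\<dots> \<le> (\<Sum>g\<in>PiE UNIV (\<lambda>_ :: 'd. J). \<Prod>i\<in>UNIV. lattice_weight (g i))"
      using J by (intro sum_mono2 finite_PiE prod_nonneg) (auto simp: J_def lattice_weight_def)
    also have "\<dots> = (\<Prod>i\<in>(UNIV :: 'd set). \<Sum>n\<in>J. lattice_weight n)"
      using J by (subst prod_sum_PiE) auto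
    also have "\<dots> \<le> (\<Prod>i\<in>(UNIV :: 'd set). B)"
      using B[OF J] by (intro prod_mono) (auto intro!: sum_nonneg simp: lattice_weight_def)
    finally show "(\<Sum>k\<in>I. 1 / (1 + freq_sq k)\<^sup>2) \<le> (\<Prod>i\<in>(UNIV :: 'd set). B)" .
  qed
qed simp

text \<open>The coefficient is split into \<open>1 + freq_sq k\<close> times itself and the
  reciprocal weight. The first is square summable by \<open>V \<in> H2\<close>, the second by the
  bound on the dimension.\<close>

lemma H2_coeff_summable:
  fixes V :: "'d::finite L2"
  assumes "CARD('d) \<le> 3" "V \<in> H2"
  shows "(\<lambda>k. cmod (fourier_coeff V k)) summable_on UNIV"
proof (rule summable_on_comparison_test)
  show "(\<lambda>k. (1 + freq_sq k)\<^sup>2 * (cmod (fourier_coeff V k))\<^sup>2 + 1 / (1 + freq_sq k)\<^sup>2) summable_on UNIV"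
    using assms by (intro summable_on_add inverse_square_freq_summable) (auto simp: H2_def)
  show "cmod (fourier_coeff V k) \<le> (1 + freq_sq k)\<^sup>2 * (cmod (fourier_coeff V k))\<^sup>2 + 1 / (1 + freq_sq k)\<^sup>2" for k
  proof -
    have f: "0 < 1 + freq_sq k" by (simp add: freq_sq_def sum_nonneg add_pos_nonneg)
    let ?a = "(1 + freq_sq k) * cmod (fourier_coeff V k)" and ?b = "1 / (1 + freq_sq k)"
    have "cmod (fourier_coeff V k) = ?a * ?b" using f by simp
    also have "\<dots> \<le> ?a\<^sup>2 + ?b\<^sup>2"
      using sum_squares_bound[of ?a ?b] zero_le_power2[of ?a] zero_le_power2[of ?b] by linarith
    finally show ?thesis by (simp add: power_mult_distrib power_divide)
  qed
qed simp

section \<open>Multiplication by a bounded potential\<close>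

lemma trig_polynomial_rep:
  fixes I :: "(int ^ 'd::finite) set"
  assumes "finite I"
  shows "square_integrable (\<lambda>x. \<Sum>k\<in>I. a k * cis (phase k x)) \<and>
    (\<Sum>k\<in>I. a k *\<^sub>C fourier_mode k) = abs_L2 (\<lambda>x. \<Sum>k\<in>I. a k * cis (phase k x))"
  using assms
proof induction
  case empty
  then show ?case by (simp add: sqi_zero zero_L2_def)
next
  case (insert k I)
  have m: "square_integrable (\<lambda>x. cis (phase k x))"
    using phase_measurable[of 1 k] by (intro sqi_bounded[where B=1]) auto
  have "a k *\<^sub>C fourier_mode k = abs_L2 (\<lambda>x. a k * cis (phase k x))"
    unfolding fourier_mode_def using m by (simp add: cscale.abs_eq eq_onp_def)
  then show ?case
    using insert m by (simp add: abs_L2_plus sqi_cmult sqi_add)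
qed

text \<open>The Sobolev embedding. Partial Fourier sums stay below the sum \<open>B\<close> of the
  absolute coefficients, but their convergence to \<open>V\<close> is known only in L^2. Pointwise
  limits are avoided by integrating the squared excess \<open>h\<close> of \<open>cmod (g x)\<close>
  over \<open>B\<close>: it is at most the squared distance of \<open>V\<close> to any partial sum,
  hence 0.\<close>

lemma H2_bounded:
  fixes V :: "'d::finite L2"
  assumes "CARD('d) \<le> 3" "V \<in> H2" and g: "square_integrable g" "V = abs_L2 g"
  shows "\<exists>B\<ge>0. AE x in torus. cmod (g x) \<le> B"
proof -
  define B where "B = (\<Sum>\<^sub>\<infinity>k. cmod (fourier_coeff V k))"
  note sm = H2_coeff_summable[OF assms(1,2)]
  have B: "0 \<le> B" unfolding B_def by (rule infsum_nonneg) simp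
  note [measurable] = sqi_measurable[OF g(1)]
  define h where "h x = (max 0 (cmod (g x) - B))\<^sup>2" for x
  have h [measurable]: "h \<in> borel_measurable torus" unfolding h_def by measurable
  have ih: "integrable torus h"
  proof (rule Bochner_Integration.integrable_bound)
    show "integrable torus (\<lambda>x. (cmod (g x))\<^sup>2)" using g(1) by (simp add: square_integrable_def)
    show "AE x in torus. norm (h x) \<le> norm ((cmod (g x))\<^sup>2)"
      using B by (intro AE_I2) (auto simp: h_def intro!: power_mono)
  qed measurable
  have "(\<integral>x. h x \<partial>torus) \<le> 0 + e" if e: "0 < e" for e
  proof -
    have "((\<lambda>I. (norm (V - (fourier_sum I V)))\<^sup>2) \<longlongrightarrow> (norm (V - V))\<^sup>2) (finite_subsets_at_top UNIV)"
      using fourier_series[of V] unfolding has_sum_def by (intro tendsto_intros)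
    then have "eventually (\<lambda>I. (norm (V - (fourier_sum I V)))\<^sup>2 < e) (finite_subsets_at_top UNIV)"
      using e by (intro order_tendstoD) auto
    then obtain I where I: "finite I" "(norm (V - (fourier_sum I V)))\<^sup>2 < e"
      by (auto simp: eventually_finite_subsets_at_top)
    define p where "p x = (\<Sum>k\<in>I. fourier_coeff V k * cis (phase k x))" for x
    have p: "square_integrable p" "(fourier_sum I V) = abs_L2 p"
      using trig_polynomial_rep[OF I(1), of "fourier_coeff V"] by (simp_all add: p_def[abs_def])
    have pB: "cmod (p x) \<le> B" for x
    proof -
      have "cmod (p x) \<le> (\<Sum>k\<in>I. cmod (fourier_coeff V k))"
        unfolding p_def by (rule order_trans[OF norm_sum]) (simp add: norm_mult)
      also have "\<dots> \<le> B"
        unfolding B_def by (rule finite_sum_le_infsum[OF sm I(1)]) auto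
      finally show ?thesis .
    qed
    have "(\<integral>x. h x \<partial>torus) \<le> (\<integral>x. (cmod (g x - p x))\<^sup>2 \<partial>torus)"
    proof (rule integral_mono[OF ih])
      show "integrable torus (\<lambda>x. (cmod (g x - p x))\<^sup>2)"
        using sqi_diff[OF g(1) p(1)] by (simp add: square_integrable_def)
      show "h x \<le> (cmod (g x - p x))\<^sup>2" for x
        unfolding h_def using pB[of x] norm_triangle_ineq2[of "g x" "p x"] by (intro power_mono) auto
    qed
    also have "\<dots> = (norm (V - abs_L2 p))\<^sup>2"
      unfolding g(2) using g(1) p(1) by (simp add: abs_L2_minus norm_abs_L2 sqi_diff)
    also have "\<dots> < e" using I(2) p(2) by simp
    finally show ?thesis by simp
  qed
  then have "(\<integral>x. h x \<partial>torus) \<le> 0" by (rule field_le_epsilon)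
  then have "(\<integral>x. h x \<partial>torus) = 0" by (intro antisym integral_nonneg) (auto simp: h_def)
  then have "AE x in torus. h x = 0"
    using integral_nonneg_eq_0_iff_AE[OF ih] by (simp add: h_def[abs_def])
  then have "AE x in torus. cmod (g x) \<le> B"
    by eventually_elim (simp add: h_def max_def split: if_splits)
  with B show ?thesis by blast
qed

text \<open>Essential boundedness makes multiplication a bounded operator. It is symmetric for the
  complex inner product because the potential is real, so \<open>cinner u (mult_L2 V u)\<close> is
  real and the factor -i leaves no real part.\<close>

lemma potential_facts:
  fixes V :: "'d::finite L2"
  assumes V: "CARD('d) \<le> 3" "V \<in> H2" "real_valued V"
  shows "linear (mult_L2 V)" "\<exists>B\<ge>0. \<forall>u. norm (mult_L2 V u) \<le> B * norm u"
    and "u \<bullet> ((- \<i>) *\<^sub>C mult_L2 V u) = 0"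
proof -
  obtain g where g: "square_integrable g" "V = abs_L2 g" by (rule L2_cases)
  obtain B where B: "0 \<le> B" "AE x in torus. cmod (g x) \<le> B" using H2_bounded[OF V(1,2) g] by blast
  have real: "AE x in torus. g x \<in> \<real>"
    using V(3) g by (simp add: real_valued.abs_eq eq_onp_def)
  \<comment> \<open>All products with \<open>g\<close> stay square integrable, so the default value
    0 in \<open>mult_L2\<close> is never taken.\<close>
  have sq: "square_integrable (\<lambda>x. g x * f x)" if f: "square_integrable f" for f
  proof (rule sqi_dominated)
    show "(\<lambda>x. g x * f x) \<in> borel_measurable torus" using g f by (auto dest: sqi_measurable)
    show "integrable torus (\<lambda>x. (B * cmod (f x))\<^sup>2)"
      using f by (auto simp: square_integrable_def power_mult_distrib)
    show "AE x in torus. (cmod (g x * f x))\<^sup>2 \<le> (B * cmod (f x))\<^sup>2"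
      using B(2) by eventually_elim (auto simp: norm_mult intro!: power_mono mult_right_mono)
  qed
  have mult: "mult_L2 V (abs_L2 f) = abs_L2 (\<lambda>x. g x * f x)" if f: "square_integrable f" for f
    using sq[OF f] f g by (simp add: mult_L2.abs_eq eq_onp_def)
  show "linear (mult_L2 V)"
  proof (rule linearI)
    fix u v :: "'d L2" and r :: real
    obtain f where f: "square_integrable f" "u = abs_L2 f" by (rule L2_cases)
    obtain h where h: "square_integrable h" "v = abs_L2 h" by (rule L2_cases)
    show "mult_L2 V (u + v) = mult_L2 V u + mult_L2 V v"
      using f h by (simp add: abs_L2_plus mult sqi_add sq distrib_left)
    show "mult_L2 V (r *\<^sub>R u) = r *\<^sub>R mult_L2 V u"
      using f by (simp add: abs_L2_scaleR mult sqi_scaleR sq)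
  qed
  have "norm (mult_L2 V u) \<le> B * norm u" for u
  proof -
    obtain f where f: "square_integrable f" "u = abs_L2 f" by (rule L2_cases)
    have "(norm (mult_L2 V u))\<^sup>2 = (\<integral>x. (cmod (g x * f x))\<^sup>2 \<partial>torus)"
      using f by (simp add: mult norm_abs_L2 sq)
    also have "\<dots> \<le> (\<integral>x. B\<^sup>2 * (cmod (f x))\<^sup>2 \<partial>torus)"
    proof (rule integral_mono_AE)
      show "integrable torus (\<lambda>x. (cmod (g x * f x))\<^sup>2)" using sq[OF f(1)] by (simp add: square_integrable_def)
      show "integrable torus (\<lambda>x. B\<^sup>2 * (cmod (f x))\<^sup>2)" using f(1) by (simp add: square_integrable_def)
      show "AE x in torus. (cmod (g x * f x))\<^sup>2 \<le> B\<^sup>2 * (cmod (f x))\<^sup>2"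
        using B(2) by eventually_elim
          (auto simp: norm_mult power_mult_distrib intro!: mult_right_mono power_mono)
    qed
    also have "\<dots> = (B * norm u)\<^sup>2" using f by (simp add: norm_abs_L2 power_mult_distrib)
    finally show ?thesis by (rule power2_le_imp_le) (simp add: B(1))
  qed
  then show "\<exists>B\<ge>0. \<forall>u. norm (mult_L2 V u) \<le> B * norm u" using B(1) by blast
  show "u \<bullet> ((- \<i>) *\<^sub>C mult_L2 V u) = 0"
  proof -
    obtain f where f: "square_integrable f" "u = abs_L2 f" by (rule L2_cases)
    have "cinner u (mult_L2 V u) = (\<integral>x. f x * cnj (g x * f x) \<partial>torus)"
      using f sq[OF f(1)] by (simp add: mult cinner.abs_eq eq_onp_def)
    also have "\<dots> = (\<integral>x. of_real (Re (f x * cnj (g x * f x))) \<partial>torus)"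
    proof (rule integral_cong_AE)
      show "(\<lambda>x. f x * cnj (g x * f x)) \<in> borel_measurable torus"
        using sqi_prod_integrable[OF f(1) sq[OF f(1)]] by (rule borel_measurable_integrable)
      then show "(\<lambda>x. complex_of_real (Re (f x * cnj (g x * f x)))) \<in> borel_measurable torus" by measurable
      show "AE x in torus. f x * cnj (g x * f x) = of_real (Re (f x * cnj (g x * f x)))"
        using real
      proof eventually_elim
        case (elim x)
        then obtain r where r: "g x = of_real r" by (auto simp: Reals_def)
        show ?case unfolding r by (simp add: complex_eq_iff)
      qed
    qed
    also have "\<dots> = of_real (\<integral>x. Re (f x * cnj (g x * f x)) \<partial>torus)" by (rule integral_complex_of_real)
    finally have "Im (cinner u (mult_L2 V u)) = 0" by simp
    then show ?thesis by (simp add: inner_eq_cinner cinner_cscale_right)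
  qed
qed

section \<open>The stochastic Schroedinger equation\<close>

text \<open>Multiplication by a nonzero \<open>c\<close> is invertible, so integrability of either
  side implies that of the other; without it both integrals take the default value 0.\<close>

lemma set_integral_cscale:
  fixes f :: "real \<Rightarrow> 'd::finite L2"
  assumes "c \<noteq> 0"
  shows "(LINT r:B|lborel. c *\<^sub>C f r) = c *\<^sub>C (LINT r:B|lborel. f r)"
proof -
  let ?f = "\<lambda>r. indicator B r *\<^sub>R f r"
  have eq: "(\<lambda>r. indicator B r *\<^sub>R c *\<^sub>C f r) = (\<lambda>r. c *\<^sub>C ?f r)"
    by (simp add: cscale_scaleR)
  show ?thesis
  proof (cases "integrable lborel ?f")
    case True
    then show ?thesis
      unfolding set_lebesgue_integral_def eq by (rule integral_bounded_linear[OF bounded_linear_cscale])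
  next
    case False
    have "\<not> integrable lborel (\<lambda>r. c *\<^sub>C ?f r)"
    proof
      assume "integrable lborel (\<lambda>r. c *\<^sub>C ?f r)"
      from integrable_bounded_linear[OF bounded_linear_cscale[of "1 / c"] this]
      moreover have "(1 / c) *\<^sub>C c *\<^sub>C v = v" for v :: "'d L2"
        using cscale_of_real[of 1 v] assms by (simp add: cscale_cscale)
      ultimately have "integrable lborel ?f" by (simp only:)
      then show False using False by (rule notE[rotated])
    qed
    then show ?thesis
      unfolding set_lebesgue_integral_def eq using False
      by (simp add: not_integrable_integral_eq linear_0[OF cscale_linear])
  qed
qed

theorem proposition4p5:
  fixes M :: "'a measure" and F :: "real \<Rightarrow> 'a measure"
    and V :: "'d::finite L2" and Q :: "'d L2 \<Rightarrow> 'd L2" and e :: "nat \<Rightarrow> 'd L2"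
    and \<beta> :: "nat \<Rightarrow> real \<Rightarrow> 'a \<Rightarrow> real" and W :: "real \<Rightarrow> 'a \<Rightarrow> 'd L2"
    and u\<^sub>0 :: "'a \<Rightarrow> 'd L2" and u :: "real \<Rightarrow> 'a \<Rightarrow> 'd L2"
  assumes "CARD('d) \<in> {1, 2, 3}"
    and "prob_space M" and "normal_filtration M F"
    and "real_valued V" and "V \<in> H2"
    and "orthonormal_basis e"
    and "nonneg_selfadjoint Q" and "trace_class e Q"
    and "Q_wiener_process M F Q e \<beta> W"
    and "u\<^sub>0 \<in> borel_measurable (F 0)" and "integrable M (\<lambda>\<omega>. mass (u\<^sub>0 \<omega>))"
    and "mild_solution M F Q e W V u\<^sub>0 u"
  shows "\<forall>t\<ge>0. integrable M (\<lambda>\<omega>. mass (u t \<omega>)) \<and>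
    (\<integral>\<omega>. mass (u t \<omega>) \<partial>M) = (\<integral>\<omega>. mass (u\<^sub>0 \<omega>) \<partial>M) + t * trace_op e Q"
proof -
  let ?S = "schroedinger_group :: real \<Rightarrow> 'd L2 \<Rightarrow> 'd L2"
  let ?A = "\<lambda>v. (- \<i>) *\<^sub>C mult_L2 V v" and ?J = "\<lambda>v :: 'd L2. (- \<i>) *\<^sub>C v"
  interpret wiener M F Q e \<beta> W
    by (intro wiener.intro wiener_axioms.intro assms)
  have d: "CARD('d) \<le> 3" using assms(1) by auto
  note V = potential_facts[OF d assms(5,4)]
  obtain C where C: "0 \<le> C" "\<And>v. norm (mult_L2 V v) \<le> C * norm v" using V(2) by blast
  from assms(12) have adapted: "\<And>t. 0 \<le> t \<Longrightarrow> u t \<in> borel_measurable (F t)"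
    and joint: "(\<lambda>(t, \<omega>). u t \<omega>) \<in> borel_measurable (restrict_space borel {0..} \<Otimes>\<^sub>M M)"
    and int: "AE \<omega> in M. \<forall>t\<ge>0. set_integrable lborel {0..t} (\<lambda>r. u r \<omega>)"
    and "\<forall>t. \<exists>X. 0 \<le> t \<longrightarrow> has_stochastic_integral M Q e W t (\<lambda>r. ?S (t - r)) X \<and>
        (AE \<omega> in M. u t \<omega> = ?S t (u\<^sub>0 \<omega>)
           - \<i> *\<^sub>C (LINT r:{0..t}|lborel. ?S (t - r) (mult_L2 V (u r \<omega>)))
           - \<i> *\<^sub>C X \<omega>)"
    unfolding mild_solution_def by blast+
  \<comment> \<open>One stochastic integral is chosen for each time; the argument compares them only
    at pairs of fixed times.\<close>
  from choice[OF this(4)] obtain X where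
    X: "\<And>t. 0 \<le> t \<Longrightarrow> has_stochastic_integral M Q e W t (\<lambda>r. ?S (t - r)) (X t)"
    and mild: "\<And>t. 0 \<le> t \<Longrightarrow> AE \<omega> in M. u t \<omega> = ?S t (u\<^sub>0 \<omega>)
           - \<i> *\<^sub>C (LINT r:{0..t}|lborel. ?S (t - r) (mult_L2 V (u r \<omega>))) - \<i> *\<^sub>C X t \<omega>"
    by blast
  have minus: "(- \<i>) *\<^sub>C v = - (\<i> *\<^sub>C v)" for v :: "'d L2"
    using cscale_cscale[of "of_real (- 1)" \<i> v] by (simp only: cscale_of_real) simp
  have u0: "second_moment M u\<^sub>0"
    using assms(11) filtration_measurable_M[OF order_refl assms(10)]
    by (simp add: second_moment_def mass_eq_norm)
  text \<open>
    Freezing \<open>u\<close> before time \<open>0\<close> makes it jointly measurable on the whole line.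
  \<close>
  define U where "U t = u (max 0 t)" for t
  have U: "U t = u t" if "0 \<le> t" for t using that by (simp add: U_def)
  interpret mild_energy M F Q e \<beta> W ?S ?J ?A C X u\<^sub>0 U
  proof (intro mild_energy.intro mild_energy_axioms.intro)
    show "wiener M F Q e \<beta> W" by (rule wiener_axioms)
    show "linear ?J" by (rule cscale_linear)
    show "linear ?A" using linear_compose[OF V(1) cscale_linear[of "- \<i>"]] by (simp add: comp_def)
    show "(\<lambda>(t, \<omega>). U t \<omega>) \<in> borel_measurable (borel \<Otimes>\<^sub>M M)"
    proof -
      have "(\<lambda>x. (max (0 :: real) (fst x), snd x)) \<in> measurable (borel \<Otimes>\<^sub>M M) (restrict_space borel {0..} \<Otimes>\<^sub>M M)"
      proof (intro measurable_Pair measurable_restrict_space2)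
        show "(\<lambda>x. max (0 :: real) (fst x)) \<in> borel_measurable (borel \<Otimes>\<^sub>M M)" by measurable
      qed (auto simp: le_max_iff_disj)
      from measurable_compose[OF this joint] show ?thesis by (simp add: U_def split_beta')
    qed
    show "AE \<omega> in M. \<forall>t\<ge>0. set_integrable lborel {0..t} (\<lambda>r. U r \<omega>)"
      using int
    proof eventually_elim
      case (elim \<omega>)
      show ?case
      proof (intro allI impI)
        fix t :: real assume "0 \<le> t"
        with elim have "set_integrable lborel {0..t} (\<lambda>r. u r \<omega>)" by blast
        also have "?this \<longleftrightarrow> set_integrable lborel {0..t} (\<lambda>r. U r \<omega>)"
          by (intro set_integrable_cong) (auto simp: U)
        finally show "set_integrable lborel {0..t} (\<lambda>r. U r \<omega>)" .
      qed
    qed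
    show "AE \<omega> in M. U t \<omega> = ?S t (u\<^sub>0 \<omega>) + (LINT r:{0..t}|lborel. ?S (t - r) (?A (U r \<omega>))) + ?J (X t \<omega>)"
      if t: "0 \<le> t" for t
      using mild[OF t]
    proof eventually_elim
      case (elim \<omega>)
      \<comment> \<open>The scalar -i commutes with the group and with the integral, which turns the
        given equation into the form with \<open>?A\<close> inside.\<close>
      have "(LINT r:{0..t}|lborel. ?S (t - r) (?A (U r \<omega>))) =
          (LINT r:{0..t}|lborel. (- \<i>) *\<^sub>C ?S (t - r) (mult_L2 V (u r \<omega>)))"
        by (intro set_lebesgue_integral_cong) (auto simp: U group_cscale)
      also have "\<dots> = (- \<i>) *\<^sub>C (LINT r:{0..t}|lborel. ?S (t - r) (mult_L2 V (u r \<omega>)))"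
        by (rule set_integral_cscale) simp
      finally show ?case unfolding U[OF t] elim by (simp add: minus)
    qed
  qed (use assms(10) u0 C V(3) X adapted U in
      \<open>auto simp: group_linear group_norm group_group group_continuous group_cscale norm_cscale\<close>)
  \<comment> \<open>Integrability is stated along with the identity, so that the expectation is not
    a default value.\<close>
  show ?thesis
  proof (intro allI impI)
    fix t :: real assume t: "0 \<le> t"
    show "integrable M (\<lambda>\<omega>. mass (u t \<omega>)) \<and>
      (\<integral>\<omega>. mass (u t \<omega>) \<partial>M) = (\<integral>\<omega>. mass (u\<^sub>0 \<omega>) \<partial>M) + t * trace_op e Q"
      using second_moment_integrable[OF u_moment[OF t]] energy_identity[OF t]
      by (simp add: U[OF t] mass_eq_norm)
  qed
qed

end
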